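(* Let $H\in(0,1)$, let $b:\mathbb{R}\to\mathbb{R}$ be differentiable with bounded derivative, and let $X$ be the solution of $X_t=\theta\int_0^tb(X_s)\,ds+B^H_t$, $X_0=0$. Suppose there exists a constant $\alpha>0$ such that (i) $n^\alpha\,\langle A-B\rangle_n/\langle B\rangle_n$ is bounded almost surely for $n$ large enough; (ii) for all $k\ge1$, for some constant $K>0$, almost surely, for large $n$, $\langle B\rangle_n^k\ge K\,\mathbf E[\langle B\rangle_n^k]$; (iii) for all $k>1$, $\mathbf E[|\langle A-B\rangle_n|^k]\le n^{-k\alpha}\,\mathbf E[|\langle B\rangle_n|^k]$. Then almost surely $\lim_{n\to\infty}\bar\theta_n=\theta$, where $$\bar\theta_n=\frac{\sum_{m=0}^nQ_m(Z_{m+1}-Z_m)}{\sum_{m=0}^n|Q_m|^2}.$$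
   Context: $B^H$ is a fractional Brownian motion with Hurst parameter $H$ on $(\Omega,\mathcal F,\mathbf P)$: a centered continuous Gaussian process with covariance $\frac12(t^{2H}+s^{2H}-|t-s|^{2H})$, represented as $B^H_t=\int_0^tK(t,s)\,dW_s$ with $W$ a standard Brownian motion and $K$ the usual Volterra kernel: $K\equiv1$ if $H=1/2$; $K(t,s)=c_Hs^{1/2-H}\int_s^t(u-s)^{H-3/2}u^{H-1/2}\,du$, $c_H=\big(\frac{H(2H-1)}{\mathrm{Beta}(2-2H,H-1/2)}\big)^{1/2}$, if $H>1/2$; $K(t,s)=c_H\big[(t/s)^{H-1/2}(t-s)^{H-1/2}-(H-\frac12)s^{1/2-H}\int_s^tu^{H-3/2}(u-s)^{H-1/2}\,du\big]$, $c_H=\big(\frac{2H}{(1-2H)\mathrm{Beta}(1-2H,H+1/2)}\big)^{1/2}$, if $H<1/2$. $K_H^{-1}$ is the inverse of $(K_Hf)(t)=\int_0^tK(t,s)f(s)\,ds$; $Q_t=K_H^{-1}\big(\int_0^\cdot b(X_r)\,dr\big)(t)$ for $t>0$, with the convention $Q_0=0$; and $Z_t=W_t+\theta\int_0^tQ_s\,ds$ (equivalently $X_t=\int_0^tK(t,s)\,dZ_s$). With $[s]$ the integer part of $s$, define the semimartingales $A_t=\int_0^tQ_s\,dZ_s$ and $B_t=\int_0^tQ_{[s]}\,dZ_s$, with quadratic variations $\langle\cdot\rangle$; thus $\langle B\rangle_n=\sum_{m=0}^{n-1}|Q_m|^2$ and $\langle A-B\rangle_n=\sum_{m=0}^{n-1}\int_m^{m+1}|Q_s-Q_m|^2\,ds$.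 The index $n$ ranges over positive integers. *)

theory Defs
  imports "HOL-Probability.Probability"
begin

text \<open>Processes are indexed by \<^typ>\<open>real\<close>; only the times \<open>t \<ge> 0\<close> are ever used.\<close>

definition standard_brownian_motion :: "'a measure \<Rightarrow> (real \<Rightarrow> 'a \<Rightarrow> real) \<Rightarrow> bool" where
  "standard_brownian_motion M W \<longleftrightarrow>
     (\<forall>t\<ge>0. W t \<in> borel_measurable M) \<and>
     (AE \<omega> in M. W 0 \<omega> = 0) \<and>
     (AE \<omega> in M. continuous_on {0..} (\<lambda>t. W t \<omega>)) \<and>
     (\<forall>s t. 0 \<le> s \<and> s < t \<longrightarrow>
        distributed M lborel (\<lambda>\<omega>. W t \<omega> - W s \<omega>) (normal_density 0 (sqrt (t - s)))) \<and>
     (\<forall>(\<tau> :: nat \<Rightarrow> real) n. mono \<tau> \<and> 0 \<le> \<tau> 0 \<longrightarrow>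
        prob_space.indep_vars M (\<lambda>_. borel) (\<lambda>i \<omega>. W (\<tau> (Suc i)) \<omega> - W (\<tau> i) \<omega>) {..<n})"

text \<open>A point mass (\<open>\<sigma> = 0\<close>) counts as Gaussian.\<close>

definition gaussian_rv :: "'a measure \<Rightarrow> ('a \<Rightarrow> real) \<Rightarrow> bool" where
  "gaussian_rv M Y \<longleftrightarrow>
     Y \<in> borel_measurable M \<and>
     (\<exists>\<mu> \<sigma>. 0 \<le> \<sigma> \<and>
        distr M borel Y = (if \<sigma> = 0 then return borel \<mu> else density lborel (normal_density \<mu> \<sigma>)))"

definition gaussian_process :: "'a measure \<Rightarrow> (real \<Rightarrow> 'a \<Rightarrow> real) \<Rightarrow> bool" where
  "gaussian_process M Y \<longleftrightarrow>
     (\<forall>T (c :: real \<Rightarrow> real). finite T \<and> T \<subseteq> {0..} \<longrightarrow> gaussian_rv M (\<lambda>\<omega>. \<Sum>t\<in>T. c t * Y t \<omega>))"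

definition fractional_brownian_motion ::
    "'a measure \<Rightarrow> real \<Rightarrow> (real \<Rightarrow> 'a \<Rightarrow> real) \<Rightarrow> bool" where
  "fractional_brownian_motion M H Y \<longleftrightarrow>
     gaussian_process M Y \<and>
     (\<forall>t\<ge>0. (LINT \<omega>|M. Y t \<omega>) = 0) \<and>
     (\<forall>s\<ge>0. \<forall>t\<ge>0. (LINT \<omega>|M. Y t \<omega> * Y s \<omega>) =
        (t powr (2 * H) + s powr (2 * H) - \<bar>t - s\<bar> powr (2 * H)) / 2) \<and>
     (AE \<omega> in M. continuous_on {0..} (\<lambda>t. Y t \<omega>))"

definition c_H :: "real \<Rightarrow> real" where
  "c_H H =
     (if H > 1/2 then sqrt (H * (2 * H - 1) / Beta (2 - 2 * H) (H - 1/2))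
      else sqrt (2 * H / ((1 - 2 * H) * Beta (1 - 2 * H) (H + 1/2))))"

text \<open>The Volterra kernel; its values are meaningful for \<open>0 < s < t\<close> only.\<close>

definition K_H :: "real \<Rightarrow> real \<Rightarrow> real \<Rightarrow> real" where
  "K_H H t s =
     (if H = 1/2 then 1
      else if H > 1/2 then
        c_H H * s powr (1/2 - H) * (LBINT u:{s..t}. (u - s) powr (H - 3/2) * u powr (H - 1/2))
      else
        c_H H * ((t / s) powr (H - 1/2) * (t - s) powr (H - 1/2)
          - (H - 1/2) * s powr (1/2 - H) *
              (LBINT u:{s..t}. u powr (H - 3/2) * (u - s) powr (H - 1/2))))"

definition K_op :: "real \<Rightarrow> (real \<Rightarrow> real) \<Rightarrow> real \<Rightarrow> real" where
  "K_op H f t = (LBINT s:{0..t}. K_H H t s * f s)"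

text \<open>
  \<open>is_K_inverse H g f\<close> says that \<open>f\<close> is the inverse image of \<open>g\<close> under the operator, taken on
  locally square integrable functions. The equation determines \<open>f\<close> only up to null sets;
  continuity on \<open>(0, \<infinity>)\<close> selects the representative whose values at single times are meant.
  Nothing is required at \<open>0\<close>, where that representative may be singular.
\<close>

definition is_K_inverse :: "real \<Rightarrow> (real \<Rightarrow> real) \<Rightarrow> (real \<Rightarrow> real) \<Rightarrow> bool" where
  "is_K_inverse H g f \<longleftrightarrow>
     continuous_on {0<..} f \<and>
     (\<forall>t\<ge>0. set_integrable lborel {0..t} (\<lambda>s. (f s)\<^sup>2)) \<and>
     (\<forall>t\<ge>0. K_op H f t = g t)"

text \<open>
  Wiener integral. A list of triples \<open>(c, u, v)\<close> encodes the step function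
  \<open>\<Sum> c * indicator {u<..v}\<close>; the integral of a square integrable function is the
  mean-square limit of the elementary integrals of approximating step functions.
\<close>

definition step_fun :: "(real \<times> real \<times> real) list \<Rightarrow> real \<Rightarrow> real" where
  "step_fun xs s = (\<Sum>(c, u, v)\<leftarrow>xs. c * indicator {u<..v} s)"

definition step_integral ::
    "(real \<Rightarrow> 'a \<Rightarrow> real) \<Rightarrow> (real \<times> real \<times> real) list \<Rightarrow> 'a \<Rightarrow> real" where
  "step_integral W xs \<omega> = (\<Sum>(c, u, v)\<leftarrow>xs. c * (W v \<omega> - W u \<omega>))"

definition has_wiener_integral ::
    "'a measure \<Rightarrow> (real \<Rightarrow> 'a \<Rightarrow> real) \<Rightarrow> real \<Rightarrow> (real \<Rightarrow> real) \<Rightarrow> ('a \<Rightarrow> real) \<Rightarrow> bool" where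
  "has_wiener_integral M W t f Y \<longleftrightarrow>
     set_borel_measurable lborel {0..t} f \<and>
     Y \<in> borel_measurable M \<and>
     (\<exists>xs :: nat \<Rightarrow> (real \<times> real \<times> real) list.
        (\<forall>n. \<forall>(c, u, v) \<in> set (xs n). 0 \<le> u \<and> u \<le> v \<and> v \<le> t) \<and>
        (\<lambda>n. \<integral>\<^sup>+s\<in>{0..t}. ennreal ((step_fun (xs n) s - f s)\<^sup>2) \<partial>lborel) \<longlonglongrightarrow> 0 \<and>
        (\<lambda>n. \<integral>\<^sup>+\<omega>. ennreal ((step_integral W (xs n) \<omega> - Y \<omega>)\<^sup>2) \<partial>M) \<longlonglongrightarrow> 0)"

definition Z_process ::
    "real \<Rightarrow> (real \<Rightarrow> 'a \<Rightarrow> real) \<Rightarrow> (real \<Rightarrow> 'a \<Rightarrow> real) \<Rightarrow> real \<Rightarrow> 'a \<Rightarrow> real" where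
  "Z_process \<theta> W Q t \<omega> = W t \<omega> + \<theta> * (LBINT s:{0..t}. Q s \<omega>)"

text \<open>
  Quadratic variations at the integer time \<open>n\<close> of \<open>B\<^sub>t = \<integral>\<^sub>0\<^sup>t Q\<^bsub>[s]\<^esub> dZ\<^sub>s\<close> and of
  \<open>A - B\<close>, where \<open>A\<^sub>t = \<integral>\<^sub>0\<^sup>t Q\<^sub>s dZ\<^sub>s\<close>. As \<open>Z\<close> is \<open>W\<close> plus a process of finite variation,
  the quadratic variation of \<open>\<integral>\<phi> dZ\<close> is \<open>\<integral>\<phi>\<^sup>2 ds\<close>.
\<close>

definition qv_B :: "(real \<Rightarrow> 'a \<Rightarrow> real) \<Rightarrow> nat \<Rightarrow> 'a \<Rightarrow> real" where
  "qv_B Q n \<omega> = (\<Sum>m<n. \<bar>Q (real m) \<omega>\<bar>\<^sup>2)"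

definition qv_A_minus_B :: "(real \<Rightarrow> 'a \<Rightarrow> real) \<Rightarrow> nat \<Rightarrow> 'a \<Rightarrow> real" where
  "qv_A_minus_B Q n \<omega> =
     (\<Sum>m<n. LBINT s:{real m..real m + 1}. \<bar>Q s \<omega> - Q (real m) \<omega>\<bar>\<^sup>2)"

definition theta_bar ::
    "(real \<Rightarrow> 'a \<Rightarrow> real) \<Rightarrow> (real \<Rightarrow> 'a \<Rightarrow> real) \<Rightarrow> nat \<Rightarrow> 'a \<Rightarrow> real" where
  "theta_bar Q Z n \<omega> =
     (\<Sum>m=0..n. Q (real m) \<omega> * (Z (real m + 1) \<omega> - Z (real m) \<omega>)) /
     (\<Sum>m=0..n. \<bar>Q (real m) \<omega>\<bar>\<^sup>2)"

end

(* The sum of the Q_m (W_{m+1} - W_m) is a martingale transform whose bracket is <B>_n, and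
   theta_bar_n - theta is its quotient by <B>, plus theta times a drift error that Cauchy-Schwarz
   bounds by sqrt (<A-B> / <B>), which tends to 0 by (i). Condition (i) also forces <B> to diverge, so
   that the martingale strong law applies. The remaining point is that Q_m is adapted: B^H is a mean-square
   limit of step integrals of W, X is a limit of Euler schemes driven by B^H, and Abel's integral
   equation turns K_H f = (integral of y) into an explicit formula for the primitive of
   s powr (1/2 - H) * f s. *)

theory Submission
  imports Defs
begin

section \<open>Strong law for martingale transforms\<close>

text \<open>\<open>Q\<close> is given only implicitly, by an integral equation valid for almost
  every path. Adaptedness needs more than uniqueness of its solution: it needs a formula for
  \<open>Q (real m)\<close> that is visibly measurable in the path of \<open>X\<close> on
  \<open>{0..real m}\<close>. The weight \<open>s powr (1/2 - H)\<close> is what both forms of the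
  kernel carry in \<open>s\<close>; absorbed into \<open>f\<close>, it leaves a convolution kernel
  in \<open>u - s\<close>, to which Abel's inversion applies on either side of
  \<open>H = 1/2\<close>. Only the primitive of the weighted function comes out in closed form. The
  value at \<open>m\<close> is then a limit of difference quotients, taken from the left so that no
  time after \<open>m\<close> enters; continuity of \<open>Q\<close> on the open half-line makes
  this legitimate. Two further points shape the proof. All data hold almost surely, so adaptedness
  means agreement almost everywhere with a variable measurable for the raw Brownian past, and
  exceptional sets are merged countably often. At time \<open>0\<close> the function
  \<open>Q\<close> may be singular while \<open>Q 0 = 0\<close> is a convention, so this time is
  treated apart throughout.\<close>

lemma Cesaro_weighted_tendsto_0:
  fixes a r :: "nat \<Rightarrow> real"
  assumes a: "mono a" "\<And>n. 0 \<le> a n" "filterlim a at_top sequentially" and r: "r \<longlonglongrightarrow> 0"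
  shows "(\<lambda>n. (\<Sum>i<n. (a (Suc i) - a i) * r i) / a n) \<longlonglongrightarrow> 0"
proof (rule LIMSEQ_I)
  fix e :: real assume e: "0 < e"
  obtain N where N: "\<And>n. n \<ge> N \<Longrightarrow> \<bar>r n\<bar> < e / 2"
    using LIMSEQ_D[OF r, of "e/2"] e by auto
  \<comment> \<open>The block before \<open>N\<close> contributes the fixed amount \<open>D\<close>,
    below half of \<open>e * a n\<close> once \<open>a n > 2 * D / e\<close>. The later terms
    telescope to at most the other half.\<close>
  define D where "D = \<bar>\<Sum>i<N. (a (Suc i) - a i) * r i\<bar>"
  have "\<forall>\<^sub>F n in sequentially. a n > 2 * D / e" "\<forall>\<^sub>F n in sequentially. a n > 0"
    using a(3) by (auto simp: filterlim_at_top_dense)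
  then have "\<forall>\<^sub>F n in sequentially. a n > 2 * D / e \<and> a n > 0 \<and> n \<ge> N"
    using eventually_ge_at_top[of N] by eventually_elim auto
  then obtain N' where N': "\<And>n. n \<ge> N' \<Longrightarrow> a n > 2 * D / e \<and> a n > 0 \<and> n \<ge> N"
    by (auto simp: eventually_sequentially)
  have "norm ((\<Sum>i<n. (a (Suc i) - a i) * r i) / a n - 0) < e" if "n \<ge> N'" for n
  proof -
    have n: "a n > 2 * D / e" "a n > 0" "n \<ge> N" using N'[OF that] by auto
    have "(\<Sum>i<n. (a (Suc i) - a i) * r i) =
        (\<Sum>i<N. (a (Suc i) - a i) * r i) + (\<Sum>i=N..<n. (a (Suc i) - a i) * r i)"
      using sum.atLeastLessThan_concat[of 0 N n "\<lambda>i. (a (Suc i) - a i) * r i"] n(3)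
      by (simp add: atLeast0LessThan)
    moreover have "\<bar>\<Sum>i=N..<n. (a (Suc i) - a i) * r i\<bar> \<le> (\<Sum>i=N..<n. (a (Suc i) - a i) * (e/2))"
    proof (intro order.trans[OF sum_abs] sum_mono)
      fix i assume "i \<in> {N..<n}"
      then show "\<bar>(a (Suc i) - a i) * r i\<bar> \<le> (a (Suc i) - a i) * (e/2)"
        using monoD[OF a(1), of i "Suc i"] mult_left_mono[OF less_imp_le[OF N[of i]], of "a (Suc i) - a i"]
        by (simp add: abs_mult)
    qed
    moreover have "(\<Sum>i=N..<n. (a (Suc i) - a i) * (e/2)) = (a n - a N) * (e/2)"
      using sum_Suc_diff'[OF n(3), of a] by (metis sum_distrib_right)
    moreover have "(a n - a N) * (e/2) \<le> a n * (e/2)"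
      using a(2)[of N] e by (intro mult_right_mono) auto
    ultimately have "\<bar>\<Sum>i<n. (a (Suc i) - a i) * r i\<bar> \<le> D + a n * (e/2)"
      unfolding D_def by linarith
    also have "\<dots> < a n * e"
      using n e by (simp add: field_simps)
    finally show ?thesis
      using n(2) by (simp add: field_simps abs_mult)
  qed
  then show "\<exists>no. \<forall>n\<ge>no. norm ((\<Sum>i<n. (a (Suc i) - a i) * r i) / a n - 0) < e"
    by blast
qed

text \<open>Summation by parts around the limit \<open>l\<close> of the series: the sum equals
  \<open>a n * (T n - l)\<close>, minus a constant, minus a sum of the \<open>T i - l\<close>
  weighted by increments of \<open>a\<close>. Each of the three is negligible against
  \<open>a n\<close>.\<close>

lemma Kronecker_tendsto_0:
  fixes a x :: "nat \<Rightarrow> real"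
  assumes a: "mono a" "\<And>n. 0 \<le> a n" "filterlim a at_top sequentially"
    and conv: "convergent (\<lambda>n. \<Sum>i<n. x i)"
  shows "(\<lambda>n. (\<Sum>i<n. a (Suc i) * x i) / a n) \<longlonglongrightarrow> 0"
proof -
  define T where "T n = (\<Sum>i<n. x i)" for n
  obtain l where l: "T \<longlonglongrightarrow> l"
    using conv by (auto simp: convergent_def T_def[abs_def])
  have parts: "(\<Sum>i<n. a (Suc i) * x i) =
      a n * (T n - l) - a 0 * (T 0 - l) - (\<Sum>i<n. (a (Suc i) - a i) * (T i - l))" for n
    by (induction n) (simp_all add: T_def algebra_simps)
  have "(\<lambda>n. T n - l) \<longlonglongrightarrow> 0"
    using l by (simp add: LIM_zero_iff)
  moreover have "(\<lambda>n. a 0 * (T 0 - l) / a n) \<longlonglongrightarrow> 0"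
    by (rule real_tendsto_divide_at_top[OF tendsto_const a(3)])
  moreover have "(\<lambda>n. (\<Sum>i<n. (a (Suc i) - a i) * (T i - l)) / a n) \<longlonglongrightarrow> 0"
    by (rule Cesaro_weighted_tendsto_0[OF a]) (use l in \<open>simp add: LIM_zero_iff\<close>)
  ultimately have "(\<lambda>n. (T n - l) - a 0 * (T 0 - l) / a n
      - (\<Sum>i<n. (a (Suc i) - a i) * (T i - l)) / a n) \<longlonglongrightarrow> 0 - 0 - 0"
    by (intro tendsto_diff)
  moreover have "\<forall>\<^sub>F n in sequentially. a n > 0"
    using a(3) by (auto simp: filterlim_at_top_dense)
  then have "\<forall>\<^sub>F n in sequentially. (T n - l) - a 0 * (T 0 - l) / a n
      - (\<Sum>i<n. (a (Suc i) - a i) * (T i - l)) / a n = (\<Sum>i<n. a (Suc i) * x i) / a n"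
    by eventually_elim (simp add: parts diff_divide_distrib)
  ultimately show ?thesis
    using tendsto_cong by force
qed

text \<open>Each \<open>F n\<close> serves only as a carrier of a sigma-algebra. Independence is
  stated against single real variables because it is applied to products such as an earlier sum
  times the next coefficient. The innovation with index \<open>n\<close> is revealed at time
  \<open>Suc n\<close>, so a coefficient measurable for \<open>F n\<close> is predictable.\<close>

locale innovations = prob_space M for M :: "'a measure" +
  fixes F :: "nat \<Rightarrow> 'a measure" and \<xi> :: "nat \<Rightarrow> 'a \<Rightarrow> real"
  assumes space_F: "\<And>n. space (F n) = space M"
    and sets_F: "\<And>n. sets (F n) \<subseteq> sets M"
    and F_Suc: "\<And>n. sets (F n) \<subseteq> sets (F (Suc n))"
    and innovation_measurable: "\<And>n. \<xi> n \<in> borel_measurable (F (Suc n))"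
    and innovation_indep: "\<And>n Y. Y \<in> borel_measurable (F n) \<Longrightarrow> indep_var borel Y borel (\<xi> n)"
    and innovation_square_integrable: "\<And>n. integrable M (\<lambda>\<omega>. (\<xi> n \<omega>)\<^sup>2)"
    and innovation_mean: "\<And>n. expectation (\<xi> n) = 0"
    and innovation_variance: "\<And>n. expectation (\<lambda>\<omega>. (\<xi> n \<omega>)\<^sup>2) = 1"
begin

lemma F_mono: "m \<le> n \<Longrightarrow> Y \<in> borel_measurable (F m) \<Longrightarrow> Y \<in> borel_measurable (F n)"
  for Y :: "'a \<Rightarrow> real"
proof (induction n rule: dec_induct)
  case (step k)
  then show ?case
    using F_Suc[of k] by (auto intro!: measurableI simp: space_F dest: measurable_sets)
qed auto

lemma F_measurable_M: "Y \<in> borel_measurable (F n) \<Longrightarrow> Y \<in> borel_measurable M"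
  for Y :: "'a \<Rightarrow> real"
  using sets_F[of n] by (auto intro!: measurableI simp: space_F dest: measurable_sets)

lemma innovation_M[measurable]: "\<xi> n \<in> borel_measurable M"
  using F_measurable_M innovation_measurable by blast

lemma innovation_integrable: "integrable M (\<xi> n)"
  using square_integrable_imp_integrable[OF _ innovation_square_integrable] by simp

lemma transform_measurable:
  assumes "\<And>i. v i \<in> borel_measurable (F i)" "n \<le> m"
  shows "(\<lambda>\<omega>. \<Sum>i<n. v i \<omega> * \<xi> i \<omega>) \<in> borel_measurable (F m)"
proof (intro borel_measurable_sum borel_measurable_times)
  fix i assume "i \<in> {..<n}"
  then have "i \<le> m" "Suc i \<le> m" using assms(2) by auto
  then show "v i \<in> borel_measurable (F m)" "\<xi> i \<in> borel_measurable (F m)"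
    using F_mono assms(1) innovation_measurable by blast+
qed

text \<open>In the expanded square the cross term is an \<open>F n\<close>-measurable factor times
  an independent centred one, so it has mean zero; the diagonal term factorises with variance 1.
  Both claims share one induction because integrability of the shorter squared sum is what makes the
  cross term integrable.\<close>

lemma transform_isometry:
  assumes v: "\<And>i. v i \<in> borel_measurable (F i)" and c: "\<And>i \<omega>. \<bar>v i \<omega>\<bar> \<le> c"
  shows "integrable M (\<lambda>\<omega>. (\<Sum>i<n. v i \<omega> * \<xi> i \<omega>)\<^sup>2)" (is "?int n")
    and "expectation (\<lambda>\<omega>. (\<Sum>i<n. v i \<omega> * \<xi> i \<omega>)\<^sup>2) = (\<Sum>i<n. expectation (\<lambda>\<omega>. (v i \<omega>)\<^sup>2))" (is "?eq n")
proof -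
  have [measurable]: "v i \<in> borel_measurable M" for i
    using v F_measurable_M by blast
  have c2: "(v i \<omega>)\<^sup>2 \<le> c\<^sup>2" for i \<omega>
    using c[of i \<omega>] by (metis abs_ge_zero power2_abs power_mono)
  have v2: "integrable M (\<lambda>\<omega>. (v i \<omega>)\<^sup>2)" for i
    by (rule integrable_const_bound[of _ "c\<^sup>2"]) (use c2 in auto)
  have "?int n \<and> ?eq n"
  proof (induction n)
    case 0
    show ?case by simp
  next
    case (Suc n)
    define N where "N \<omega> = (\<Sum>i<n. v i \<omega> * \<xi> i \<omega>)" for \<omega>
    have N_F: "N \<in> borel_measurable (F n)"
      unfolding N_def[abs_def] using v by (intro transform_measurable) auto
    have [measurable]: "N \<in> borel_measurable M"
      using N_F F_measurable_M by blast
    have N2: "integrable M (\<lambda>\<omega>. (N \<omega>)\<^sup>2)"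
      using Suc by (simp add: N_def)
    have N1: "integrable M N"
      using square_integrable_imp_integrable[OF _ N2] by simp
    have Nv: "integrable M (\<lambda>\<omega>. N \<omega> * v n \<omega>)"
    proof (rule Bochner_Integration.integrable_bound)
      show "integrable M (\<lambda>\<omega>. c * N \<omega>)" using N1 by simp
      show "AE \<omega> in M. norm (N \<omega> * v n \<omega>) \<le> norm (c * N \<omega>)"
      proof (rule AE_I2)
        fix \<omega>
        have "\<bar>v n \<omega>\<bar> * \<bar>N \<omega>\<bar> \<le> \<bar>c\<bar> * \<bar>N \<omega>\<bar>"
          by (rule mult_right_mono) (use c[of n \<omega>] in auto)
        then show "norm (N \<omega> * v n \<omega>) \<le> norm (c * N \<omega>)"
          by (simp add: abs_mult mult.commute)
      qed
    qed simp
    have ind1: "indep_var borel (\<lambda>\<omega>. N \<omega> * v n \<omega>) borel (\<xi> n)"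
      by (intro innovation_indep borel_measurable_times N_F v)
    have ind2': "indep_var borel (\<lambda>\<omega>. v n \<omega>) borel (\<xi> n)"
      by (intro innovation_indep v)
    have ind2: "indep_var borel (\<lambda>\<omega>. (v n \<omega>)\<^sup>2) borel (\<lambda>\<omega>. (\<xi> n \<omega>)\<^sup>2)"
      using indep_var_compose[OF ind2', of "\<lambda>x. x\<^sup>2" borel "\<lambda>x. x\<^sup>2" borel] by (simp add: comp_def)
    have cross: "integrable M (\<lambda>\<omega>. N \<omega> * v n \<omega> * \<xi> n \<omega>)"
      "expectation (\<lambda>\<omega>. N \<omega> * v n \<omega> * \<xi> n \<omega>) = 0"
      using indep_var_integrable[OF ind1 Nv innovation_integrable]
        indep_var_lebesgue_integral[OF ind1 Nv innovation_integrable]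
      by (simp_all add: innovation_mean)
    have diag: "integrable M (\<lambda>\<omega>. (v n \<omega>)\<^sup>2 * (\<xi> n \<omega>)\<^sup>2)"
      "expectation (\<lambda>\<omega>. (v n \<omega>)\<^sup>2 * (\<xi> n \<omega>)\<^sup>2) = expectation (\<lambda>\<omega>. (v n \<omega>)\<^sup>2)"
      using indep_var_integrable[OF ind2 v2 innovation_square_integrable]
        indep_var_lebesgue_integral[OF ind2 v2 innovation_square_integrable]
      by (simp_all add: innovation_variance)
    have expand: "(\<Sum>i<Suc n. v i \<omega> * \<xi> i \<omega>)\<^sup>2 =
        (N \<omega>)\<^sup>2 + 2 * (N \<omega> * v n \<omega> * \<xi> n \<omega>) + (v n \<omega>)\<^sup>2 * (\<xi> n \<omega>)\<^sup>2" for \<omega>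
      by (simp add: N_def power2_eq_square algebra_simps)
    show ?case
      using Suc N2 cross diag by (simp only: expand) (simp add: N_def)
  qed
  then show "?int n" "?eq n" by auto
qed

text \<open>The partial sums are stopped at the first exceedance; this keeps the coefficients predictable,
  so that the maximal inequality reduces to Chebyshev for the stopped sum.\<close>

lemma Kolmogorov_maximal:
  assumes u: "\<And>i. u i \<in> borel_measurable (F i)" and c: "\<And>i \<omega>. \<bar>u i \<omega>\<bar> \<le> c" and e: "0 < e"
  shows "prob {\<omega>\<in>space M. \<exists>k\<in>{a..n}. e \<le> \<bar>\<Sum>i=a..<k. u i \<omega> * \<xi> i \<omega>\<bar>}
    \<le> (\<Sum>i=a..<n. expectation (\<lambda>\<omega>. (u i \<omega>)\<^sup>2)) / e\<^sup>2"
proof -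
  define T where "T k \<omega> = (\<Sum>i=a..<k. u i \<omega> * \<xi> i \<omega>)" for k \<omega>
  \<comment> \<open>The test involves \<open>T j\<close> for \<open>j \<le> i\<close>, hence only
    innovations with index below \<open>i\<close>, which makes \<open>v i\<close> predictable. The
    term that causes the first exceedance is still kept.\<close>
  define v where "v i \<omega> = (if a \<le> i \<and> (\<forall>j\<in>{a..i}. \<bar>T j \<omega>\<bar> < e) then u i \<omega> else 0)" for i \<omega>
  have [measurable]: "u i \<in> borel_measurable M" for i
    using u F_measurable_M by blast
  have [measurable]: "T k \<in> borel_measurable M" for k
    unfolding T_def[abs_def] by measurable
  have T_F: "T j \<in> borel_measurable (F i)" if "j \<le> i" for i j
    unfolding T_def[abs_def]
  proof (intro borel_measurable_sum borel_measurable_times)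
    fix k assume "k \<in> {a..<j}"
    then have "k \<le> i" "Suc k \<le> i" using that by auto
    then show "u k \<in> borel_measurable (F i)" "\<xi> k \<in> borel_measurable (F i)"
      using F_mono u innovation_measurable by blast+
  qed
  have v_F: "v i \<in> borel_measurable (F i)" for i
  proof -
    have "{\<omega> \<in> space (F i). a \<le> i \<and> (\<forall>j\<in>{a..i}. \<bar>T j \<omega>\<bar> < e)} \<in> sets (F i)"
    proof (intro sets.sets_Collect_conj sets.sets_Collect_const sets.sets_Collect_finite_All)
      fix j assume "j \<in> {a..i}"
      then have "(\<lambda>\<omega>. \<bar>T j \<omega>\<bar>) \<in> borel_measurable (F i)" using T_F by auto
      then show "{\<omega> \<in> space (F i). \<bar>T j \<omega>\<bar> < e} \<in> sets (F i)" by measurable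
    qed auto
    then show ?thesis
      unfolding v_def[abs_def] by (intro measurable_If u borel_measurable_const)
  qed
  have v_le: "\<bar>v i \<omega>\<bar> \<le> \<bar>u i \<omega>\<bar>" for i \<omega>
    by (simp add: v_def)
  then have v_c: "\<bar>v i \<omega>\<bar> \<le> c" for i \<omega>
    using c order.trans by blast
  define N where "N \<omega> = (\<Sum>i<n. v i \<omega> * \<xi> i \<omega>)" for \<omega>
  \<comment> \<open>All coefficients from the first exceedance \<open>k0\<close> on are
    \<open>0\<close>, so the stopped sum \<open>N\<close> is frozen at the value
    \<open>T k0\<close>.\<close>
  have hit: "e \<le> \<bar>N \<omega>\<bar>" if "k \<in> {a..n}" "e \<le> \<bar>T k \<omega>\<bar>" for k \<omega>
  proof -
    define k0 where "k0 = (LEAST k. a \<le> k \<and> e \<le> \<bar>T k \<omega>\<bar>)"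
    have k0: "a \<le> k0 \<and> e \<le> \<bar>T k0 \<omega>\<bar>"
      unfolding k0_def by (rule LeastI[of _ k]) (use that in auto)
    have k0_le: "k0 \<le> k"
      unfolding k0_def by (rule Least_le) (use that in auto)
    have before: "\<bar>T j \<omega>\<bar> < e" if "a \<le> j" "j < k0" for j
      using not_less_Least[of j "\<lambda>k. a \<le> k \<and> e \<le> \<bar>T k \<omega>\<bar>"] that unfolding k0_def by auto
    have "v i \<omega> = (if i \<in> {a..<k0} then u i \<omega> else 0)" for i
      using k0 before by (auto simp: v_def not_less) (meson atLeastAtMost_iff le_less_trans linorder_not_le)+
    then have "N \<omega> = (\<Sum>i<n. if i \<in> {a..<k0} then u i \<omega> * \<xi> i \<omega> else 0)"
      unfolding N_def by (intro sum.cong) auto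
    also have "\<dots> = T k0 \<omega>"
      unfolding T_def using k0_le that(1) by (subst sum.inter_restrict[symmetric]) (auto intro!: sum.cong)
    finally show ?thesis using k0 by simp
  qed
  have [measurable]: "v i \<in> borel_measurable M" for i
    using v_F F_measurable_M by blast
  have [measurable]: "N \<in> borel_measurable M"
    unfolding N_def[abs_def] by measurable
  have N2: "integrable M (\<lambda>\<omega>. (N \<omega>)\<^sup>2)"
    unfolding N_def by (rule transform_isometry(1)[OF v_F v_c])
  have u2: "integrable M (\<lambda>\<omega>. (u i \<omega>)\<^sup>2)" for i
    by (rule integrable_const_bound[of _ "c\<^sup>2"])
      (use c in \<open>auto intro!: AE_I2 simp: abs_le_square_iff[symmetric] intro: order.trans[OF _ abs_ge_self]\<close>)
  have "prob {\<omega>\<in>space M. \<exists>k\<in>{a..n}. e \<le> \<bar>T k \<omega>\<bar>} \<le> prob {\<omega>\<in>space M. e\<^sup>2 \<le> (N \<omega>)\<^sup>2}"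
  proof (rule finite_measure_mono)
    show "{\<omega>\<in>space M. \<exists>k\<in>{a..n}. e \<le> \<bar>T k \<omega>\<bar>} \<subseteq> {\<omega>\<in>space M. e\<^sup>2 \<le> (N \<omega>)\<^sup>2}"
      using hit e by (auto simp: abs_le_square_iff[symmetric])
  qed measurable
  also have "\<dots> \<le> expectation (\<lambda>\<omega>. (N \<omega>)\<^sup>2) / e\<^sup>2"
    using integral_Markov_inequality_measure[OF N2, of "{}" "e\<^sup>2"] e by auto
  also have "expectation (\<lambda>\<omega>. (N \<omega>)\<^sup>2) = (\<Sum>i<n. expectation (\<lambda>\<omega>. (v i \<omega>)\<^sup>2))"
    unfolding N_def by (rule transform_isometry(2)[OF v_F v_c])
  also have "\<dots> \<le> (\<Sum>i=a..<n. expectation (\<lambda>\<omega>. (u i \<omega>)\<^sup>2))"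
  proof -
    have "(\<Sum>i<n. expectation (\<lambda>\<omega>. (v i \<omega>)\<^sup>2)) = (\<Sum>i=a..<n. expectation (\<lambda>\<omega>. (v i \<omega>)\<^sup>2))"
      by (rule sum.mono_neutral_right) (auto simp: v_def)
    also have "\<dots> \<le> (\<Sum>i=a..<n. expectation (\<lambda>\<omega>. (u i \<omega>)\<^sup>2))"
      by (intro sum_mono Bochner_Integration.integral_mono' u2)
        (use v_le in \<open>auto simp: abs_le_square_iff\<close>)
    finally show ?thesis .
  qed
  finally show ?thesis
    using e by (simp add: T_def divide_right_mono)
qed

text \<open>The maximal inequality bounds the probability of an oscillation of size \<open>e\<close>
  after \<open>a\<close> by a tail of the convergent variance series over the square of
  \<open>e\<close>. Hence almost surely some \<open>a\<close> leaves no such oscillation, for all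
  \<open>e = 1 / (j + 1)\<close> at once, which is the Cauchy property.\<close>

lemma transform_convergent:
  assumes u: "\<And>i. u i \<in> borel_measurable (F i)" and c: "\<And>i \<omega>. \<bar>u i \<omega>\<bar> \<le> c"
    and summ: "summable (\<lambda>i. expectation (\<lambda>\<omega>. (u i \<omega>)\<^sup>2))"
  shows "AE \<omega> in M. convergent (\<lambda>n. \<Sum>i<n. u i \<omega> * \<xi> i \<omega>)"
proof -
  define T where "T a k \<omega> = (\<Sum>i=a..<k. u i \<omega> * \<xi> i \<omega>)" for a k \<omega>
  define s where "s i = expectation (\<lambda>\<omega>. (u i \<omega>)\<^sup>2)" for i
  have s: "summable s" "\<And>i. 0 \<le> s i"
    using summ by (auto simp: s_def[abs_def])
  have [measurable]: "u i \<in> borel_measurable M" for i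
    using u F_measurable_M by blast
  have [measurable]: "T a k \<in> borel_measurable M" for a k
    unfolding T_def[abs_def] by measurable
  have AE_e: "AE \<omega> in M. \<exists>a. \<forall>k\<ge>a. \<bar>T a k \<omega>\<bar> < e" if e: "0 < e" for e
  proof -
    define B where "B a = {\<omega>\<in>space M. \<exists>k\<ge>a. e \<le> \<bar>T a k \<omega>\<bar>}" for a
    have [measurable]: "B a \<in> sets M" for a
      unfolding B_def by measurable
    have B_le: "prob (B a) \<le> (\<Sum>i. s (i + a)) / e\<^sup>2" for a
    proof -
      define C where "C n = {\<omega>\<in>space M. \<exists>k\<in>{a..n}. e \<le> \<bar>T a k \<omega>\<bar>}" for n
      have C: "range C \<subseteq> sets M" unfolding C_def by auto
      have "incseq C"
        by (auto simp: incseq_def C_def)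
      moreover have "(\<Union>n. C n) = B a" by (force simp: B_def C_def)
      ultimately have lim: "(\<lambda>n. prob (C n)) \<longlonglongrightarrow> prob (B a)"
        using finite_Lim_measure_incseq[OF C] by simp
      have "prob (C n) \<le> (\<Sum>i. s (i + a)) / e\<^sup>2" for n
      proof -
        have "prob (C n) \<le> (\<Sum>i=a..<n. s i) / e\<^sup>2"
          unfolding C_def T_def s_def by (rule Kolmogorov_maximal[OF u c e])
        also have "(\<Sum>i=a..<n. s i) \<le> (\<Sum>i. s (i + a))"
        proof -
          have "(\<Sum>i=a..<n. s i) = (\<Sum>i<n-a. s (i + a))"
            by (rule sum.reindex_bij_witness[of _ "\<lambda>i. i + a" "\<lambda>i. i - a"]) auto
          also have "\<dots> \<le> (\<Sum>i. s (i + a))"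
            using s by (intro sum_le_suminf) (auto simp: summable_iff_shift)
          finally show ?thesis .
        qed
        finally show ?thesis using e by (simp add: divide_right_mono)
      qed
      then show ?thesis
        by (intro LIMSEQ_le_const2[OF lim]) auto
    qed
    have "(\<lambda>a. (\<Sum>i. s (i + a)) / e\<^sup>2) \<longlonglongrightarrow> 0 / e\<^sup>2"
      by (intro tendsto_divide suminf_exist_split2 s tendsto_const) (use e in auto)
    \<comment> \<open>The intersection lies in every single \<open>B a\<close>, so the bound for
      each \<open>a\<close> applies to it without any monotonicity in \<open>a\<close>.\<close>
    moreover have "prob (\<Inter>a. B a) \<le> (\<Sum>i. s (i + a)) / e\<^sup>2" for a
      by (rule order.trans[OF _ B_le]) (intro finite_measure_mono, auto)
    ultimately have "prob (\<Inter>a. B a) \<le> 0"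
      by (intro LIMSEQ_le_const[of "\<lambda>a. (\<Sum>i. s (i + a)) / e\<^sup>2"]) auto
    then have "prob (\<Inter>a. B a) = 0"
      using measure_nonneg[of M "\<Inter>a. B a"] by linarith
    then have "AE \<omega> in M. \<omega> \<notin> (\<Inter>a. B a)"
      by (subst (asm) prob_eq_0) auto
    then show ?thesis
      using AE_space by eventually_elim (simp add: B_def, meson not_le)
  qed
  have "AE \<omega> in M. \<forall>j::nat. \<exists>a. \<forall>k\<ge>a. \<bar>T a k \<omega>\<bar> < inverse (real (Suc j))"
    by (subst AE_all_countable) (auto intro: AE_e)
  then show ?thesis
  proof eventually_elim
    fix \<omega> assume *: "\<forall>j::nat. \<exists>a. \<forall>k\<ge>a. \<bar>T a k \<omega>\<bar> < inverse (real (Suc j))"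
    have T: "T a k \<omega> = (\<Sum>i<k. u i \<omega> * \<xi> i \<omega>) - (\<Sum>i<a. u i \<omega> * \<xi> i \<omega>)" if "a \<le> k" for a k
      using sum.atLeastLessThan_concat[of 0 a k "\<lambda>i. u i \<omega> * \<xi> i \<omega>"] that
      by (simp add: T_def atLeast0LessThan)
    have "Cauchy (\<lambda>n. \<Sum>i<n. u i \<omega> * \<xi> i \<omega>)"
    proof (rule CauchyI')
      fix e :: real assume "0 < e"
      then obtain j where j: "inverse (real (Suc j)) < e / 2"
        using reals_Archimedean[of "e/2"] by auto
      obtain a where a: "\<And>k. k \<ge> a \<Longrightarrow> \<bar>T a k \<omega>\<bar> < inverse (real (Suc j))"
        using * by blast
      show "\<exists>N. \<forall>m\<ge>N. \<forall>n>m. dist (\<Sum>i<m. u i \<omega> * \<xi> i \<omega>) (\<Sum>i<n. u i \<omega> * \<xi> i \<omega>) < e"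
      proof (intro exI[of _ a] allI impI)
        fix m n assume "a \<le> m" "m < n"
        then show "dist (\<Sum>i<m. u i \<omega> * \<xi> i \<omega>) (\<Sum>i<n. u i \<omega> * \<xi> i \<omega>) < e"
          using a[of m] a[of n] T[of a m] T[of a n] j by (auto simp: dist_real_def)
      qed
    qed
    then show "convergent (\<lambda>n. \<Sum>i<n. u i \<omega> * \<xi> i \<omega>)"
      by (rule Cauchy_convergent)
  qed
qed

text \<open>Dividing by \<open>1 + \<Sum> q\<^sup>2\<close> makes the coefficients bounded with summable second moments, so no
  integrability of \<open>q\<close> is needed.\<close>

lemma transform_strong_law:
  assumes q: "\<And>i. q i \<in> borel_measurable (F i)"
  shows "AE \<omega> in M. filterlim (\<lambda>n. \<Sum>i<n. (q i \<omega>)\<^sup>2) at_top sequentially \<longrightarrow>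
    (\<lambda>n. (\<Sum>i<n. q i \<omega> * \<xi> i \<omega>) / (\<Sum>i<n. (q i \<omega>)\<^sup>2)) \<longlonglongrightarrow> 0"
proof -
  define S where "S n \<omega> = (\<Sum>i<n. (q i \<omega>)\<^sup>2)" for n \<omega>
  define u where "u i \<omega> = q i \<omega> / (1 + S (Suc i) \<omega>)" for i \<omega>
  have S_nonneg: "0 \<le> S n \<omega>" for n \<omega>
    by (simp add: S_def sum_nonneg)
  have q_F: "q i \<in> borel_measurable (F n)" if "i \<le> n" for i n
    using F_mono[OF that] q by blast
  have u_F: "u i \<in> borel_measurable (F i)" for i
    unfolding u_def[abs_def] S_def[abs_def]
    by (intro borel_measurable_divide borel_measurable_add borel_measurable_sum
        borel_measurable_power q_F borel_measurable_const) auto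
  have u_1: "\<bar>u i \<omega>\<bar> \<le> 1" for i \<omega>
  proof -
    have "\<bar>q i \<omega>\<bar> \<le> 1 + (q i \<omega>)\<^sup>2"
      using sum_power2_ge_zero[of "\<bar>q i \<omega>\<bar> - 1/2" 0] by (simp add: power2_eq_square algebra_simps)
    also have "\<dots> \<le> 1 + S (Suc i) \<omega>"
      using S_nonneg[of i \<omega>] by (simp add: S_def)
    finally show ?thesis
      using S_nonneg[of "Suc i" \<omega>] by (simp add: u_def divide_le_eq)
  qed
  \<comment> \<open>One of the two factors \<open>1 + S (Suc i)\<close> is lowered to
    \<open>1 + S i\<close>. As the squared coefficient is the increment of \<open>S\<close>, the
    quotient becomes a difference of reciprocals and the sum telescopes.\<close>
  have u_sq: "(u i \<omega>)\<^sup>2 \<le> 1 / (1 + S i \<omega>) - 1 / (1 + S (Suc i) \<omega>)" for i \<omega>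
  proof -
    have eq: "S (Suc i) \<omega> = S i \<omega> + (q i \<omega>)\<^sup>2" by (simp add: S_def)
    have "(u i \<omega>)\<^sup>2 \<le> (q i \<omega>)\<^sup>2 / ((1 + S i \<omega>) * (1 + S (Suc i) \<omega>))"
      unfolding u_def power_divide power2_eq_square[of "1 + S (Suc i) \<omega>"]
      by (intro divide_left_mono mult_right_mono mult_pos_pos) (use S_nonneg eq in \<open>auto simp: add_pos_nonneg\<close>)
    also have "\<dots> = 1 / (1 + S i \<omega>) - 1 / (1 + S (Suc i) \<omega>)"
      using S_nonneg[of i \<omega>] S_nonneg[of "Suc i" \<omega>] eq
      by (subst diff_frac_eq) (auto simp: add_nonneg_eq_0_iff)
    finally show ?thesis .
  qed
  have [measurable]: "u i \<in> borel_measurable M" for i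
    using u_F F_measurable_M by blast
  have u2: "integrable M (\<lambda>\<omega>. (u i \<omega>)\<^sup>2)" for i
    by (rule integrable_const_bound[of _ 1])
      (use u_1 in \<open>auto intro!: AE_I2 simp: power_le_one_iff abs_square_le_1\<close>)
  have sum_u: "(\<Sum>i<n. (u i \<omega>)\<^sup>2) \<le> 1" for n \<omega>
  proof -
    have "(\<Sum>i<n. (u i \<omega>)\<^sup>2) \<le> (\<Sum>i<n. 1 / (1 + S i \<omega>) - 1 / (1 + S (Suc i) \<omega>))"
      by (intro sum_mono u_sq)
    also have "\<dots> = 1 / (1 + S 0 \<omega>) - 1 / (1 + S n \<omega>)"
      by (rule sum_lessThan_telescope')
    also have "\<dots> \<le> 1"
      using S_nonneg[of n \<omega>] by (simp add: S_def)
    finally show ?thesis .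
  qed
  have "summable (\<lambda>i. expectation (\<lambda>\<omega>. (u i \<omega>)\<^sup>2))"
  proof (rule bounded_imp_summable)
    fix n
    have "(\<Sum>i\<le>n. expectation (\<lambda>\<omega>. (u i \<omega>)\<^sup>2)) = expectation (\<lambda>\<omega>. \<Sum>i<Suc n. (u i \<omega>)\<^sup>2)"
      using u2 by (subst Bochner_Integration.integral_sum) (auto simp: lessThan_Suc_atMost)
    also have "\<dots> \<le> expectation (\<lambda>\<omega>. 1)"
      by (intro integral_mono Bochner_Integration.integrable_sum u2 sum_u) auto
    finally show "(\<Sum>i\<le>n. expectation (\<lambda>\<omega>. (u i \<omega>)\<^sup>2)) \<le> 1"
      by (simp add: prob_space)
  qed auto
  then have "AE \<omega> in M. convergent (\<lambda>n. \<Sum>i<n. u i \<omega> * \<xi> i \<omega>)"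
    by (rule transform_convergent[OF u_F u_1])
  then show ?thesis
  proof eventually_elim
    fix \<omega> assume conv: "convergent (\<lambda>n. \<Sum>i<n. u i \<omega> * \<xi> i \<omega>)"
    show "filterlim (\<lambda>n. \<Sum>i<n. (q i \<omega>)\<^sup>2) at_top sequentially \<longrightarrow>
      (\<lambda>n. (\<Sum>i<n. q i \<omega> * \<xi> i \<omega>) / (\<Sum>i<n. (q i \<omega>)\<^sup>2)) \<longlonglongrightarrow> 0"
    proof
      assume lim: "filterlim (\<lambda>n. \<Sum>i<n. (q i \<omega>)\<^sup>2) at_top sequentially"
      then have lim_S: "filterlim (\<lambda>n. S n \<omega>) at_top sequentially" by (simp add: S_def)
      \<comment> \<open>\<open>1 + S\<close> supplies the weights in Kronecker's lemma: its value at
        \<open>Suc i\<close> is the denominator of \<open>u i\<close>, so the weighted terms are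
        again \<open>q i \<omega> * \<xi> i \<omega>\<close>.\<close>
      have lim1: "filterlim (\<lambda>n. 1 + S n \<omega>) at_top sequentially"
        by (rule filterlim_tendsto_add_at_top[OF tendsto_const lim_S])
      have "(\<lambda>n. (\<Sum>i<n. (1 + S (Suc i) \<omega>) * (u i \<omega> * \<xi> i \<omega>)) / (1 + S n \<omega>)) \<longlonglongrightarrow> 0"
        by (rule Kronecker_tendsto_0[OF _ _ lim1 conv])
          (use S_nonneg in \<open>auto simp: mono_def S_def intro!: sum_mono2\<close>)
      moreover have "(1 + S (Suc i) \<omega>) * (u i \<omega> * \<xi> i \<omega>) = q i \<omega> * \<xi> i \<omega>" for i
        using S_nonneg[of "Suc i" \<omega>] by (simp add: u_def)
      ultimately have 1: "(\<lambda>n. (\<Sum>i<n. q i \<omega> * \<xi> i \<omega>) / (1 + S n \<omega>)) \<longlonglongrightarrow> 0" by simp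
      have "(\<lambda>n. 1 / S n \<omega>) \<longlonglongrightarrow> 0"
        by (rule real_tendsto_divide_at_top[OF tendsto_const lim_S])
      \<comment> \<open>The extra factor is \<open>(1 + S n) / S n\<close>, which tends to 1 and
        exchanges the normalisation \<open>1 + S n\<close> for \<open>S n\<close>.\<close>
      then have "(\<lambda>n. ((\<Sum>i<n. q i \<omega> * \<xi> i \<omega>) / (1 + S n \<omega>)) * (1 / S n \<omega> + 1)) \<longlonglongrightarrow> 0 * (0 + 1)"
        by (intro tendsto_intros 1)
      moreover have "\<forall>\<^sub>F n in sequentially. S n \<omega> > 0"
        using lim_S by (auto simp: filterlim_at_top_dense)
      then have "\<forall>\<^sub>F n in sequentially. ((\<Sum>i<n. q i \<omega> * \<xi> i \<omega>) / (1 + S n \<omega>)) * (1 / S n \<omega> + 1)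
          = (\<Sum>i<n. q i \<omega> * \<xi> i \<omega>) / S n \<omega>"
        proof eventually_elim
        fix n assume "S n \<omega> > 0"
        then have "1 / S n \<omega> + 1 = (1 + S n \<omega>) / S n \<omega>" "1 + S n \<omega> \<noteq> 0"
          by (simp_all add: field_simps)
        then show "((\<Sum>i<n. q i \<omega> * \<xi> i \<omega>) / (1 + S n \<omega>)) * (1 / S n \<omega> + 1)
          = (\<Sum>i<n. q i \<omega> * \<xi> i \<omega>) / S n \<omega>"
          by simp
      qed
      ultimately show "(\<lambda>n. (\<Sum>i<n. q i \<omega> * \<xi> i \<omega>) / (\<Sum>i<n. (q i \<omega>)\<^sup>2)) \<longlonglongrightarrow> 0"
        using tendsto_cong by (force simp: S_def)
    qed
  qed
qed

end

section \<open>Brownian past and adapted random variables\<close>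

lemma (in prob_space) indep_set_mono:
  assumes "indep_set A B" "A' \<subseteq> A" "B' \<subseteq> B"
  shows "indep_set A' B'"
  using assms unfolding indep_sets2_eq by (meson order.trans subsetD)

locale brownian_motion = prob_space M for M :: "'a measure" +
  fixes W :: "real \<Rightarrow> 'a \<Rightarrow> real"
  assumes brownian: "standard_brownian_motion M W"
begin

lemma W_measurable[measurable]: "0 \<le> t \<Longrightarrow> W t \<in> borel_measurable M"
  using brownian by (simp add: standard_brownian_motion_def)

definition dyadic_increment :: "nat \<Rightarrow> nat \<Rightarrow> 'a \<Rightarrow> real" where
  "dyadic_increment j i \<omega> = W (real (Suc i) / 2 ^ j) \<omega> - W (real i / 2 ^ j) \<omega>"

text \<open>A pullback along one vector of increments, because grouping independent variables yields
  independence of exactly such vectors.\<close>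

definition dyadic_past :: "nat \<Rightarrow> nat \<Rightarrow> 'a measure" where
  "dyadic_past m j = vimage_algebra (space M) (\<lambda>\<omega>. \<lambda>i\<in>{..<m * 2 ^ j}. dyadic_increment j i \<omega>)
     (PiM {..<m * 2 ^ j} (\<lambda>_. borel))"

text \<open>Dyadic times suffice because null sets are disregarded below and the paths are continuous.\<close>

definition past :: "nat \<Rightarrow> 'a measure" where
  "past m = sigma (space M) (\<Union>j. sets (dyadic_past m j))"

lemma dyadic_increment_measurable[measurable]: "dyadic_increment j i \<in> borel_measurable M"
  unfolding dyadic_increment_def[abs_def] by measurable

lemma space_dyadic_past[simp]: "space (dyadic_past m j) = space M"
  by (simp add: dyadic_past_def)

lemma sets_dyadic_past: "sets (dyadic_past m j) \<subseteq> sets M"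
  unfolding dyadic_past_def by (intro sets_image_in_sets) auto

lemma dyadic_increment_past_level:
  assumes "i < m * 2 ^ j"
  shows "dyadic_increment j i \<in> borel_measurable (dyadic_past m j)"
proof -
  have "(\<lambda>\<omega>. (\<lambda>i\<in>{..<m * 2 ^ j}. dyadic_increment j i \<omega>) i) \<in> borel_measurable (dyadic_past m j)"
    unfolding dyadic_past_def
    by (rule measurable_compose[OF measurable_vimage_algebra1 measurable_component_singleton])
      (use assms in \<open>auto simp: space_PiM PiE_iff split: if_splits\<close>)
  then show ?thesis using assms by simp
qed

text \<open>A dyadic increment is the sum of the two increments over its halves. The levels are
  therefore nested, which later makes their union stable under intersection.\<close>

lemma dyadic_past_Suc_level: "sets (dyadic_past m j) \<subseteq> sets (dyadic_past m (Suc j))"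
proof -
  have "dyadic_increment j i \<in> borel_measurable (dyadic_past m (Suc j))" if "i < m * 2 ^ j" for i
  proof -
    have "dyadic_increment j i \<omega> = dyadic_increment (Suc j) (2 * i) \<omega> + dyadic_increment (Suc j) (Suc (2 * i)) \<omega>" for \<omega>
    proof -
      have "real (2 * i) / 2 ^ Suc j = real i / 2 ^ j" "real (Suc (Suc (2 * i))) / 2 ^ Suc j = real (Suc i) / 2 ^ j"
        by (simp_all add: field_simps)
      then show ?thesis by (simp only: dyadic_increment_def)
    qed
    then have "dyadic_increment j i = (\<lambda>\<omega>. dyadic_increment (Suc j) (2 * i) \<omega> + dyadic_increment (Suc j) (Suc (2 * i)) \<omega>)"
      by auto
    moreover have "2 * i < m * 2 ^ Suc j" "Suc (2 * i) < m * 2 ^ Suc j" using that by auto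
    ultimately show ?thesis
      using dyadic_increment_past_level by simp
  qed
  then show ?thesis
    unfolding dyadic_past_def[of m j] by (intro sets_image_in_sets measurable_restrict) auto
qed

lemma dyadic_past_mono_level: "j \<le> k \<Longrightarrow> sets (dyadic_past m j) \<subseteq> sets (dyadic_past m k)"
  by (induction k rule: dec_induct) (use dyadic_past_Suc_level in blast)+

lemma dyadic_past_Suc: "sets (dyadic_past m j) \<subseteq> sets (dyadic_past (Suc m) j)"
  unfolding dyadic_past_def[of m j]
  by (intro sets_image_in_sets measurable_restrict dyadic_increment_past_level) auto

lemma space_past[simp]: "space (past m) = space M"
  unfolding past_def by (rule space_measure_of) (use sets_dyadic_past sets.sets_into_space in blast)

lemma sets_past_eq: "sets (past m) = sigma_sets (space M) (\<Union>j. sets (dyadic_past m j))"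
  unfolding past_def by (rule sets_measure_of) (use sets_dyadic_past sets.sets_into_space in blast)

lemma sets_past: "sets (past m) \<subseteq> sets M"
  unfolding sets_past_eq by (intro sets.sigma_sets_subset) (use sets_dyadic_past in blast)

lemma sets_past_Suc: "sets (past m) \<subseteq> sets (past (Suc m))"
  unfolding sets_past_eq by (intro sigma_sets_mono') (use dyadic_past_Suc in blast)

lemma dyadic_increment_past:
  assumes "i < m * 2 ^ j"
  shows "dyadic_increment j i \<in> borel_measurable (past m)"
proof (rule measurableI)
  fix A :: "real set" assume "A \<in> sets borel"
  then have "dyadic_increment j i -` A \<inter> space M \<in> sets (dyadic_past m j)"
    using measurable_sets[OF dyadic_increment_past_level[OF assms]] by simp
  then show "dyadic_increment j i -` A \<inter> space (past m) \<in> sets (past m)"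
    by (auto simp: sets_past_eq)
qed auto

text \<open>Brownian independence speaks of consecutive increments along one monotone sequence of
  times, so the dyadic grid of the past and the next unit interval are put into a single sequence
  and then separated into two groups.\<close>

lemma indep_dyadic_past:
  "indep_set (sets (dyadic_past m j))
    (sigma_sets (space M) {(\<lambda>\<omega>. W (real m + 1) \<omega> - W (real m) \<omega>) -` A \<inter> space M | A. A \<in> sets borel})"
proof -
  \<comment> \<open>Dyadic points up to \<open>m\<close>, followed by the constant
    \<open>m + 1\<close>. The increment with index \<open>m * 2 ^ j\<close> is then the one over the
    whole unit interval after \<open>m\<close>.\<close>
  define \<tau> :: "nat \<Rightarrow> real" where "\<tau> i = (if i \<le> m * 2 ^ j then real i / 2 ^ j else real m + 1)" for i
  let ?n = "m * 2 ^ j"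
  define X where "X i \<omega> = W (\<tau> (Suc i)) \<omega> - W (\<tau> i) \<omega>" for i \<omega>
  have "mono \<tau>"
    unfolding \<tau>_def mono_def
  proof (intro allI impI)
    fix x y :: nat assume "x \<le> y"
    have "real x / 2 ^ j \<le> real m + 1" if "x \<le> m * 2 ^ j"
    proof -
      have "real x \<le> real m * 2 ^ j"
        using that by (metis of_nat_le_iff of_nat_mult of_nat_numeral of_nat_power)
      then have "real x / 2 ^ j \<le> real m" by (simp add: field_simps)
      then show ?thesis by simp
    qed
    then show "(if x \<le> ?n then real x / 2 ^ j else real m + 1) \<le> (if y \<le> ?n then real y / 2 ^ j else real m + 1)"
      using \<open>x \<le> y\<close> by (auto simp: divide_right_mono)
  qed
  moreover have "0 \<le> \<tau> 0" by (simp add: \<tau>_def)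
  ultimately have ind: "indep_vars (\<lambda>_. borel) X {..<Suc ?n}"
    using brownian unfolding standard_brownian_motion_def X_def[abs_def] by blast
  have "indep_var (PiM {..<?n} (\<lambda>_. borel)) (\<lambda>\<omega>. restrict (\<lambda>i. X i \<omega>) {..<?n})
      (PiM {?n} (\<lambda>_. borel)) (\<lambda>\<omega>. restrict (\<lambda>i. X i \<omega>) {?n})"
    by (rule indep_var_restrict[OF ind]) auto
  then have ind: "indep_set
      (sigma_sets (space M) {(\<lambda>\<omega>. restrict (\<lambda>i. X i \<omega>) {..<?n}) -` A \<inter> space M | A. A \<in> sets (PiM {..<?n} (\<lambda>_. borel))})
      (sigma_sets (space M) {(\<lambda>\<omega>. restrict (\<lambda>i. X i \<omega>) {?n}) -` A \<inter> space M | A. A \<in> sets (PiM {?n} (\<lambda>_. borel))})"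
    unfolding indep_var_eq by blast
  have past_eq: "restrict (\<lambda>i. X i \<omega>) {..<?n} = (\<lambda>i\<in>{..<?n}. dyadic_increment j i \<omega>)" for \<omega>
    by (auto simp: restrict_def X_def \<tau>_def dyadic_increment_def fun_eq_iff)
  have future_eq: "X ?n \<omega> = W (real m + 1) \<omega> - W (real m) \<omega>" for \<omega>
    by (simp add: X_def \<tau>_def)
  show ?thesis
  proof (rule indep_set_mono[OF ind])
    show "sets (dyadic_past m j) \<subseteq> sigma_sets (space M)
        {(\<lambda>\<omega>. restrict (\<lambda>i. X i \<omega>) {..<?n}) -` A \<inter> space M | A. A \<in> sets (PiM {..<?n} (\<lambda>_. borel))}"
      unfolding dyadic_past_def past_eq by (subst sets_vimage_algebra) simp
    show "sigma_sets (space M) {(\<lambda>\<omega>. W (real m + 1) \<omega> - W (real m) \<omega>) -` A \<inter> space M | A. A \<in> sets borel}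
      \<subseteq> sigma_sets (space M)
        {(\<lambda>\<omega>. restrict (\<lambda>i. X i \<omega>) {?n}) -` A \<inter> space M | A. A \<in> sets (PiM {?n} (\<lambda>_. borel))}"
    proof (intro sigma_sets_mono', safe)
      fix A :: "real set" assume A: "A \<in> sets borel"
      let ?P = "PiM {?n} (\<lambda>_. borel) :: (nat \<Rightarrow> real) measure"
      have "(\<lambda>f. f ?n) -` A \<inter> space ?P \<in> sets ?P"
        by (rule measurable_sets[OF _ A]) simp
      moreover have "(\<lambda>\<omega>. W (real m + 1) \<omega> - W (real m) \<omega>) -` A \<inter> space M =
          (\<lambda>\<omega>. restrict (\<lambda>i. X i \<omega>) {?n}) -` ((\<lambda>f. f ?n) -` A \<inter> space ?P) \<inter> space M"
        by (auto simp: future_eq[symmetric] space_PiM PiE_iff)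
      ultimately show "\<exists>B. (\<lambda>\<omega>. W (real m + 1) \<omega> - W (real m) \<omega>) -` A \<inter> space M =
          (\<lambda>\<omega>. restrict (\<lambda>i. X i \<omega>) {?n}) -` B \<inter> space M \<and> B \<in> sets ?P"
        by blast
    qed
  qed
qed

text \<open>Independence holds at each dyadic level; the union of the nested levels is a pi-system,
  so it passes to the generated sigma-algebra.\<close>

lemma indep_past:
  assumes Y: "Y \<in> borel_measurable (past m)"
  shows "indep_var borel Y borel (\<lambda>\<omega>. W (real m + 1) \<omega> - W (real m) \<omega>)"
proof -
  let ?D = "{(\<lambda>\<omega>. W (real m + 1) \<omega> - W (real m) \<omega>) -` A \<inter> space M | A. A \<in> sets borel}"
  let ?G = "\<Union>j. sets (dyadic_past m j)"
  have "indep_set ?G (sigma_sets (space M) ?D)"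
    unfolding indep_sets2_eq
  proof (intro conjI ballI)
    show "?G \<subseteq> events" using sets_dyadic_past by blast
    show "sigma_sets (space M) ?D \<subseteq> events"
      by (intro sets.sigma_sets_subset) auto
    fix a b assume "a \<in> ?G" "b \<in> sigma_sets (space M) ?D"
    then show "prob (a \<inter> b) = prob a * prob b"
      using indep_dyadic_past indep_setD by fast
  qed
  moreover have "Int_stable ?G"
  proof (rule Int_stableI)
    fix a b assume "a \<in> ?G" "b \<in> ?G"
    then obtain j k where "a \<in> sets (dyadic_past m j)" "b \<in> sets (dyadic_past m k)" by blast
    then have "a \<in> sets (dyadic_past m (max j k))" "b \<in> sets (dyadic_past m (max j k))"
      using dyadic_past_mono_level[of j "max j k" m] dyadic_past_mono_level[of k "max j k" m] by auto
    then show "a \<inter> b \<in> ?G" by blast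
  qed
  moreover have "Int_stable (sigma_sets (space M) ?D)"
    by (rule algebra.Int_stable[OF sigma_algebra.axioms(1), OF sigma_algebra_sigma_sets]) auto
  ultimately have "indep_set (sigma_sets (space M) ?G) (sigma_sets (space M) (sigma_sets (space M) ?D))"
    by (intro indep_set_sigma_sets)
  then have ind: "indep_set (sets (past m)) (sigma_sets (space M) ?D)"
    by (rule indep_set_mono) (simp add: sets_past_eq, rule sigma_sets_superset_generator)
  have Y_past: "Y -` A \<inter> space M \<in> sets (past m)" if "A \<in> sets borel" for A
    using measurable_sets[OF Y that] by simp
  show ?thesis
    unfolding indep_var_eq
  proof (intro conjI)
    show "random_variable borel Y"
      using Y_past sets_past by (auto intro!: measurableI)
    show "indep_set (sigma_sets (space M) {Y -` A \<inter> space M |A. A \<in> sets borel}) (sigma_sets (space M) ?D)"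
    proof (rule indep_set_mono[OF ind])
      have "sigma_sets (space (past m)) {Y -` A \<inter> space M |A. A \<in> sets borel} \<subseteq> sets (past m)"
        by (rule sets.sigma_sets_subset) (use Y_past in auto)
      then show "sigma_sets (space M) {Y -` A \<inter> space M |A. A \<in> sets borel} \<subseteq> sets (past m)"
        by simp
    qed simp
  qed measurable
qed

lemma brownian_increment_moments:
  assumes "0 \<le> s" "s < t"
  shows "integrable M (\<lambda>\<omega>. (W t \<omega> - W s \<omega>)\<^sup>2)"
    and "expectation (\<lambda>\<omega>. W t \<omega> - W s \<omega>) = 0"
    and "expectation (\<lambda>\<omega>. (W t \<omega> - W s \<omega>)\<^sup>2) = t - s"
proof -
  have d: "distributed M lborel (\<lambda>\<omega>. W t \<omega> - W s \<omega>) (normal_density 0 (sqrt (t - s)))"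
    using brownian assms unfolding standard_brownian_motion_def by blast
  have pos: "0 < sqrt (t - s)" using assms by simp
  show m: "expectation (\<lambda>\<omega>. W t \<omega> - W s \<omega>) = 0"
    using normal_distributed_expectation[OF pos d] .
  show "integrable M (\<lambda>\<omega>. (W t \<omega> - W s \<omega>)\<^sup>2)"
    using integrable_normal_moment[OF pos, of 0 2]
    by (subst distributed_integrable[OF d, symmetric]) (auto intro: normal_density_nonneg)
  have "variance (\<lambda>\<omega>. W t \<omega> - W s \<omega>) = (sqrt (t - s))\<^sup>2"
    using normal_distributed_variance[OF pos d] .
  then show "expectation (\<lambda>\<omega>. (W t \<omega> - W s \<omega>)\<^sup>2) = t - s"
    using m assms by simp
qed

text \<open>The unit increments are the dyadic increments of level \<open>0\<close>, and unit length
  gives them variance 1. The bracket of a transform is thus the plain sum of squares, that is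
  \<open>qv_B\<close> when the coefficients are \<open>Q\<close> at integer times.\<close>

sublocale innovations M past "\<lambda>m \<omega>. W (real m + 1) \<omega> - W (real m) \<omega>"
proof (unfold_locales)
  fix n
  have "dyadic_increment 0 n \<in> borel_measurable (past (Suc n))"
    by (rule dyadic_increment_past) simp
  then show "(\<lambda>\<omega>. W (real n + 1) \<omega> - W (real n) \<omega>) \<in> borel_measurable (past (Suc n))"
    by (simp add: dyadic_increment_def[abs_def] add.commute)
qed (use sets_past sets_past_Suc indep_past brownian_increment_moments in auto)

text \<open>\<open>past m\<close> contains no completion by null sets, whereas Wiener integrals,
  path continuity and the equations for \<open>X\<close> and \<open>Q\<close> are all given up to
  null sets.\<close>

definition adapted :: "nat \<Rightarrow> ('a \<Rightarrow> real) \<Rightarrow> bool" where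
  "adapted m Y \<longleftrightarrow> (\<exists>Y'\<in>borel_measurable (past m). AE \<omega> in M. Y \<omega> = Y' \<omega>)"

lemma adaptedI: "Y' \<in> borel_measurable (past m) \<Longrightarrow> AE \<omega> in M. Y \<omega> = Y' \<omega> \<Longrightarrow> adapted m Y"
  by (auto simp: adapted_def)

lemma adapted_const: "adapted m (\<lambda>_. c)"
  by (rule adaptedI[of "\<lambda>_. c"]) auto

lemma adapted_compose2:
  assumes "adapted m Y" "adapted m Z" and h: "(\<lambda>(x, y). h x y) \<in> borel_measurable (borel \<Otimes>\<^sub>M borel)"
  shows "adapted m (\<lambda>\<omega>. h (Y \<omega>) (Z \<omega>))"
proof -
  obtain Y' Z' where Y': "Y' \<in> borel_measurable (past m)" "AE \<omega> in M. Y \<omega> = Y' \<omega>"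
    and Z': "Z' \<in> borel_measurable (past m)" "AE \<omega> in M. Z \<omega> = Z' \<omega>"
    using assms unfolding adapted_def by blast
  show ?thesis
  proof (rule adaptedI)
    show "(\<lambda>\<omega>. h (Y' \<omega>) (Z' \<omega>)) \<in> borel_measurable (past m)"
      using measurable_compose[OF measurable_Pair[OF Y'(1) Z'(1)] h] by simp
    show "AE \<omega> in M. h (Y \<omega>) (Z \<omega>) = h (Y' \<omega>) (Z' \<omega>)"
      using Y'(2) Z'(2) by eventually_elim simp
  qed
qed

lemma adapted_add: "adapted m Y \<Longrightarrow> adapted m Z \<Longrightarrow> adapted m (\<lambda>\<omega>. Y \<omega> + Z \<omega>)"
  by (rule adapted_compose2) measurable

lemma adapted_diff: "adapted m Y \<Longrightarrow> adapted m Z \<Longrightarrow> adapted m (\<lambda>\<omega>. Y \<omega> - Z \<omega>)"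
  by (rule adapted_compose2) measurable

lemma adapted_compose: "adapted m Y \<Longrightarrow> h \<in> borel_measurable borel \<Longrightarrow> adapted m (\<lambda>\<omega>. h (Y \<omega>))"
  using adapted_compose2[of m Y Y "\<lambda>x _. h x"] by simp

text \<open>Only countably many null sets are discarded, and \<open>lim\<close> of the chosen
  versions is measurable whether or not they converge at a given point.\<close>

lemma adapted_limit:
  assumes Y: "\<And>n::nat. adapted m (Y n)" and lim: "AE \<omega> in M. (\<lambda>n. Y n \<omega>) \<longlonglongrightarrow> Z \<omega>"
  shows "adapted m Z"
proof -
  obtain Y' where Y': "\<And>n. Y' n \<in> borel_measurable (past m)" "\<And>n. AE \<omega> in M. Y n \<omega> = Y' n \<omega>"
    using Y unfolding adapted_def by metis
  show ?thesis
  proof (rule adaptedI)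
    show "(\<lambda>\<omega>. lim (\<lambda>n. Y' n \<omega>)) \<in> borel_measurable (past m)"
      by (rule borel_measurable_lim_metric) (rule Y'(1))
    have "AE \<omega> in M. \<forall>n. Y n \<omega> = Y' n \<omega>"
      by (subst AE_all_countable) (use Y'(2) in auto)
    with lim show "AE \<omega> in M. Z \<omega> = lim (\<lambda>n. Y' n \<omega>)"
      by eventually_elim (simp add: limI)
  qed
qed

text \<open>Rounding \<open>t\<close> down to the grid of level \<open>j\<close> keeps it at or
  below \<open>m\<close> and makes the increment a finite sum of dyadic ones; path continuity then
  lets \<open>j\<close> tend to infinity.\<close>

lemma adapted_increment_from_0:
  assumes t: "0 \<le> t" "t \<le> real m"
  shows "adapted m (\<lambda>\<omega>. W t \<omega> - W 0 \<omega>)"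
proof -
  define d where "d j = nat \<lfloor>t * 2 ^ j\<rfloor>" for j :: nat
  have d_le: "real (d j) \<le> t * 2 ^ j" for j
    using t by (simp add: d_def)
  have d_ge: "t * 2 ^ j \<le> real (d j) + 1" for j
    unfolding d_def by linarith
  have dm: "d j \<le> m * 2 ^ j" for j
  proof -
    have "real (d j) \<le> real m * 2 ^ j"
      using d_le[of j] t by (meson mult_right_mono order.trans zero_le_numeral zero_le_power)
    then show ?thesis by (metis of_nat_le_iff of_nat_mult of_nat_numeral of_nat_power)
  qed
  have lim: "(\<lambda>j. real (d j) / 2 ^ j) \<longlonglongrightarrow> t"
  proof (rule tendsto_sandwich)
    have "(\<lambda>j. (1/2::real) ^ j) \<longlonglongrightarrow> 0"
      by (rule LIMSEQ_realpow_zero) auto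
    then have "(\<lambda>j. t - (1/2::real) ^ j) \<longlonglongrightarrow> t - 0"
      by (intro tendsto_diff tendsto_const)
    then show "(\<lambda>j. t - (1/2::real) ^ j) \<longlonglongrightarrow> t" by simp
    show "\<forall>\<^sub>F j in sequentially. t - (1/2) ^ j \<le> real (d j) / 2 ^ j"
    proof (intro always_eventually allI)
      fix j
      have "t - (1/2) ^ j = (t * 2 ^ j - 1) / 2 ^ j"
        by (simp add: power_one_over diff_divide_distrib)
      also have "\<dots> \<le> real (d j) / 2 ^ j"
        using d_ge[of j] by (intro divide_right_mono) auto
      finally show "t - (1/2) ^ j \<le> real (d j) / 2 ^ j" .
    qed
    show "\<forall>\<^sub>F j in sequentially. real (d j) / 2 ^ j \<le> t"
      using d_le by (auto simp: field_simps intro!: always_eventually)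
  qed (rule tendsto_const)
  have telescope: "W (real k / 2 ^ j) \<omega> - W 0 \<omega> = (\<Sum>i<k. dyadic_increment j i \<omega>)" for k j \<omega>
    by (induction k) (simp_all add: dyadic_increment_def)
  show ?thesis
  proof (rule adapted_limit)
    fix j
    have "(\<lambda>\<omega>. \<Sum>i<d j. dyadic_increment j i \<omega>) \<in> borel_measurable (past m)"
    proof (rule borel_measurable_sum)
      fix i assume "i \<in> {..<d j}"
      then have "i < m * 2 ^ j" using dm[of j] by auto
      then show "dyadic_increment j i \<in> borel_measurable (past m)"
        by (rule dyadic_increment_past)
    qed
    then show "adapted m (\<lambda>\<omega>. W (real (d j) / 2 ^ j) \<omega> - W 0 \<omega>)"
      unfolding telescope by (rule adaptedI) simp
    have "AE \<omega> in M. continuous_on {0..} (\<lambda>t. W t \<omega>)"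
      using brownian unfolding standard_brownian_motion_def by blast
    then show "AE \<omega> in M. (\<lambda>j. W (real (d j) / 2 ^ j) \<omega> - W 0 \<omega>) \<longlonglongrightarrow> W t \<omega> - W 0 \<omega>"
    proof eventually_elim
      fix \<omega> assume "continuous_on {0..} (\<lambda>t. W t \<omega>)"
      then have "(\<lambda>j. W (real (d j) / 2 ^ j) \<omega>) \<longlonglongrightarrow> W t \<omega>"
        by (rule continuous_on_tendsto_compose[OF _ lim]) (use t in auto)
      then show "(\<lambda>j. W (real (d j) / 2 ^ j) \<omega> - W 0 \<omega>) \<longlonglongrightarrow> W t \<omega> - W 0 \<omega>"
        by (intro tendsto_intros)
    qed
  qed
qed

lemma adapted_increment:
  assumes "0 \<le> u" "u \<le> v" "v \<le> real m"
  shows "adapted m (\<lambda>\<omega>. W v \<omega> - W u \<omega>)"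
  using adapted_diff[OF adapted_increment_from_0[of v m] adapted_increment_from_0[of u m]] assms by simp

section \<open>Measurability of Wiener integrals with respect to the Brownian past\<close>

lemma adapted_step_integral:
  assumes "\<forall>(c, u, v) \<in> set xs. 0 \<le> u \<and> u \<le> v \<and> v \<le> real m"
  shows "adapted m (step_integral W xs)"
  using assms
proof (induction xs)
  case Nil
  then show ?case by (simp add: step_integral_def[abs_def] adapted_const)
next
  case (Cons x xs)
  obtain c u v where x: "x = (c, u, v)" by (cases x)
  have "step_integral W (x # xs) = (\<lambda>\<omega>. c * (W v \<omega> - W u \<omega>) + step_integral W xs \<omega>)"
    by (simp add: step_integral_def x fun_eq_iff)
  moreover have "adapted m (\<lambda>\<omega>. c * (W v \<omega> - W u \<omega>))"
    using adapted_compose[OF adapted_increment[of u v m], of "\<lambda>x. c * x"] Cons.prems x by simp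
  ultimately show ?case
    using Cons by (auto intro: adapted_add)
qed

text \<open>The squared differences tend to 0 in mean, so a subsequence of them tends to 0 almost
  surely, and almost sure limits preserve adaptedness.\<close>

lemma adapted_L2_limit:
  assumes Y: "\<And>n::nat. adapted m (Y n)" and [measurable]: "\<And>n. Y n \<in> borel_measurable M" "Z \<in> borel_measurable M"
    and lim: "(\<lambda>n. \<integral>\<^sup>+\<omega>. ennreal ((Y n \<omega> - Z \<omega>)\<^sup>2) \<partial>M) \<longlonglongrightarrow> 0"
  shows "adapted m Z"
proof -
  have "\<forall>\<^sub>F n in sequentially. (\<integral>\<^sup>+\<omega>. ennreal ((Y n \<omega> - Z \<omega>)\<^sup>2) \<partial>M) < 1"
    by (rule order_tendstoD(2)[OF lim]) simp
  then obtain N where N: "\<And>n. n \<ge> N \<Longrightarrow> (\<integral>\<^sup>+\<omega>. ennreal ((Y n \<omega> - Z \<omega>)\<^sup>2) \<partial>M) < 1"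
    by (auto simp: eventually_sequentially)
  \<comment> \<open>The first few squared differences may have infinite integral; the shift by
    \<open>N\<close> keeps only the integrable ones.\<close>
  define D where "D n \<omega> = (Y (n + N) \<omega> - Z \<omega>)\<^sup>2" for n \<omega>
  have int: "integrable M (D n)" for n
    unfolding integrable_iff_bounded D_def[abs_def]
    using order.strict_trans[OF N[of "n + N"], of \<infinity>] by (auto simp: top.not_eq_extremum)
  have "(\<lambda>n. enn2real (\<integral>\<^sup>+\<omega>. ennreal ((Y (n + N) \<omega> - Z \<omega>)\<^sup>2) \<partial>M)) \<longlonglongrightarrow> enn2real 0"
    by (rule tendsto_enn2real) (use LIMSEQ_ignore_initial_segment[OF lim, of N] in auto)
  then have "(\<lambda>n. \<integral>\<omega>. norm (D n \<omega>) \<partial>M) \<longlonglongrightarrow> 0"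
    by (simp add: D_def integral_eq_nn_integral)
  then obtain r where r: "strict_mono r" "AE \<omega> in M. (\<lambda>n. D (r n) \<omega>) \<longlonglongrightarrow> 0"
    using tendsto_L1_AE_subseq[of M D] int by auto
  show ?thesis
  proof (rule adapted_limit)
    show "adapted m (Y (r n + N))" for n by (rule Y)
    show "AE \<omega> in M. (\<lambda>n. Y (r n + N) \<omega>) \<longlonglongrightarrow> Z \<omega>"
      using r(2)
    proof eventually_elim
      fix \<omega> assume "(\<lambda>n. D (r n) \<omega>) \<longlonglongrightarrow> 0"
      then have "(\<lambda>n. sqrt (D (r n) \<omega>)) \<longlonglongrightarrow> sqrt 0" by (intro tendsto_intros)
      then have "(\<lambda>n. \<bar>Y (r n + N) \<omega> - Z \<omega>\<bar>) \<longlonglongrightarrow> 0" by (simp add: D_def)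
      then have "(\<lambda>n. Y (r n + N) \<omega> - Z \<omega>) \<longlonglongrightarrow> 0" by (simp only: tendsto_rabs_zero_iff)
      then show "(\<lambda>n. Y (r n + N) \<omega>) \<longlonglongrightarrow> Z \<omega>" by (simp add: LIM_zero_iff)
    qed
  qed
qed

lemma adapted_wiener_integral:
  assumes "has_wiener_integral M W t f Y" "t \<le> real m"
  shows "adapted m Y"
proof -
  obtain xs where xs: "\<And>n. \<forall>(c, u, v) \<in> set (xs n). 0 \<le> u \<and> u \<le> v \<and> v \<le> t"
    and lim: "(\<lambda>n. \<integral>\<^sup>+\<omega>. ennreal ((step_integral W (xs n) \<omega> - Y \<omega>)\<^sup>2) \<partial>M) \<longlonglongrightarrow> 0"
    and [measurable]: "Y \<in> borel_measurable M"
    using assms(1) by (auto simp: has_wiener_integral_def)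
  show ?thesis
  proof (rule adapted_L2_limit)
    show "adapted m (step_integral W (xs n))" for n
      using xs[of n] assms(2) by (intro adapted_step_integral) fastforce
    show "step_integral W (xs n) \<in> borel_measurable M" for n
    proof -
      have "step_integral W ys \<in> borel_measurable M" if "\<forall>(c, u, v) \<in> set ys. 0 \<le> u \<and> u \<le> v \<and> v \<le> t" for ys
        using that
      proof (induction ys)
        case (Cons y ys)
        obtain c u v where y: "y = (c, u, v)" by (cases y)
        have "step_integral W (y # ys) = (\<lambda>\<omega>. c * (W v \<omega> - W u \<omega>) + step_integral W ys \<omega>)"
          by (simp add: step_integral_def y fun_eq_iff)
        moreover have "0 \<le> u" "0 \<le> v" "step_integral W ys \<in> borel_measurable M" using Cons y by auto
        ultimately show ?case by simp
      qed (simp add: step_integral_def[abs_def])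
      then show ?thesis using xs by blast
    qed
  qed (use lim in auto)
qed

end

section \<open>Inversion of the Volterra operator\<close>

text \<open>The affine substitution \<open>u = s + (v - s) * t\<close> reduces to the unit interval;
  the two powers and the Jacobian combine to the exponent \<open>p + q - 1\<close>. The nonnegative
  integral is used so that the formula can serve to prove integrability.\<close>

lemma nn_integral_Beta_interval:
  fixes p q s v :: real
  assumes p: "0 < p" and q: "0 < q" and sv: "s < v"
  shows "(\<integral>\<^sup>+u\<in>{s..v}. ennreal ((u - s) powr (p - 1) * (v - u) powr (q - 1)) \<partial>lborel) =
    ennreal ((v - s) powr (p + q - 1) * Beta p q)"
proof -
  let ?b = "\<lambda>t::real. t powr (p - 1) * (1 - t) powr (q - 1)"
  have "((\<lambda>t. if t \<in> {0..1} then ?b t else 0) has_integral Beta p q) UNIV"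
    using has_integral_Beta_real[OF p q] by (simp only: has_integral_restrict_UNIV)
  then have unit: "(\<integral>\<^sup>+t. ennreal (if t \<in> {0..1} then ?b t else 0) \<partial>lborel) = ennreal (Beta p q)"
    by (intro nn_integral_has_integral_lborel) auto
  have "(\<integral>\<^sup>+u. ennreal ((u - s) powr (p - 1) * (v - u) powr (q - 1)) * indicator {s..v} u \<partial>lborel) =
      ennreal \<bar>v - s\<bar> * (\<integral>\<^sup>+t. ennreal ((s + (v - s) * t - s) powr (p - 1) * (v - (s + (v - s) * t)) powr (q - 1))
        * indicator {s..v} (s + (v - s) * t) \<partial>lborel)"
    by (rule nn_integral_real_affine) (use sv in auto)
  also have "\<dots> = ennreal \<bar>v - s\<bar> * (\<integral>\<^sup>+t. ennreal ((v - s) powr (p + q - 2)) * ennreal (if t \<in> {0..1} then ?b t else 0) \<partial>lborel)"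
  proof (rule arg_cong[where f = "(*) _"], rule nn_integral_cong)
    fix t :: real
    have "indicator {s..v} (s + (v - s) * t) = (indicator {0..1} t :: ennreal)"
    proof -
      have "s + (v - s) * t \<le> v \<longleftrightarrow> (v - s) * t \<le> (v - s) * 1" by auto
      also have "\<dots> \<longleftrightarrow> t \<le> 1" using sv by (subst mult_le_cancel_left) auto
      finally show ?thesis using sv by (auto simp: indicator_def zero_le_mult_iff)
    qed
    moreover have "(s + (v - s) * t - s) powr (p - 1) * (v - (s + (v - s) * t)) powr (q - 1) =
        (v - s) powr (p + q - 2) * ?b t" if "t \<in> {0..1}"
    proof -
      have "v - (s + (v - s) * t) = (v - s) * (1 - t)" by (simp add: algebra_simps)
      then have "(s + (v - s) * t - s) powr (p - 1) * (v - (s + (v - s) * t)) powr (q - 1) =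
          ((v - s) powr (p - 1) * (v - s) powr (q - 1)) * ?b t"
        using that sv by (simp add: powr_mult)
      also have "(v - s) powr (p - 1) * (v - s) powr (q - 1) = (v - s) powr (p + q - 2)"
        by (simp add: powr_add[symmetric])
      finally show ?thesis .
    qed
    ultimately show "ennreal ((s + (v - s) * t - s) powr (p - 1) * (v - (s + (v - s) * t)) powr (q - 1))
        * indicator {s..v} (s + (v - s) * t) =
        ennreal ((v - s) powr (p + q - 2)) * ennreal (if t \<in> {0..1} then ?b t else 0)"
      by (auto simp: ennreal_mult'[symmetric])
  qed
  also have "\<dots> = ennreal \<bar>v - s\<bar> * (ennreal ((v - s) powr (p + q - 2)) * ennreal (Beta p q))"
    by (subst nn_integral_cmult, measurable) (simp only: unit)
  also have "\<dots> = ennreal ((v - s) * (v - s) powr (p + q - 2) * Beta p q)"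
    using sv by (simp add: ennreal_mult'[symmetric] mult.assoc)
  also have "(v - s) * (v - s) powr (p + q - 2) = (v - s) powr (p + q - 1)"
  proof -
    have "(v - s) powr (1 + (p + q - 2)) = (v - s) powr 1 * (v - s) powr (p + q - 2)"
      by (rule powr_add)
    moreover have "1 + (p + q - 2) = p + q - 1" by simp
    ultimately show ?thesis using sv by simp
  qed
  finally show ?thesis .
qed

lemma nn_integral_powr_left:
  fixes p s v :: real
  assumes "0 < p" "s < v"
  shows "(\<integral>\<^sup>+u\<in>{s..v}. ennreal ((u - s) powr (p - 1)) \<partial>lborel) = ennreal ((v - s) powr p * Beta p 1)"
proof -
  have "(\<integral>\<^sup>+u\<in>{s..v}. ennreal ((u - s) powr (p - 1)) \<partial>lborel) =
      (\<integral>\<^sup>+u\<in>{s..v}. ennreal ((u - s) powr (p - 1) * (v - u) powr (1 - 1)) \<partial>lborel)"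
    \<comment> \<open>\<open>0 powr 0\<close> is \<open>0\<close>, so the inserted factor with
      exponent \<open>1 - 1\<close> differs from 1 at the endpoint \<open>v\<close>.\<close>
    using AE_lborel_singleton[of v] by (intro nn_integral_cong_AE, eventually_elim) (auto simp: indicator_def)
  then show ?thesis
    using nn_integral_Beta_interval[of p 1 s v] assms by simp
qed

lemma nn_integral_powr_right:
  fixes q s v :: real
  assumes "0 < q" "s < v"
  shows "(\<integral>\<^sup>+u\<in>{s..v}. ennreal ((v - u) powr (q - 1)) \<partial>lborel) = ennreal ((v - s) powr q * Beta 1 q)"
proof -
  have "(\<integral>\<^sup>+u\<in>{s..v}. ennreal ((v - u) powr (q - 1)) \<partial>lborel) =
      (\<integral>\<^sup>+u\<in>{s..v}. ennreal ((u - s) powr (1 - 1) * (v - u) powr (q - 1)) \<partial>lborel)"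
    using AE_lborel_singleton[of s] by (intro nn_integral_cong_AE, eventually_elim) (auto simp: indicator_def)
  then show ?thesis
    using nn_integral_Beta_interval[of 1 q s v] assms by simp
qed

text \<open>Lets finiteness be checked in the order that has the better estimate: for the rough
  kernel this is the one with \<open>s\<close> inside.\<close>

lemma nn_integral_triangle:
  fixes k :: "real \<Rightarrow> real \<Rightarrow> ennreal"
  assumes [measurable]: "(\<lambda>(u, s). k u s) \<in> borel_measurable (borel \<Otimes>\<^sub>M borel)"
  shows "(\<integral>\<^sup>+s\<in>{0..v}. (\<integral>\<^sup>+u\<in>{s..v}. k u s \<partial>lborel) \<partial>lborel) =
    (\<integral>\<^sup>+u\<in>{0..v}. (\<integral>\<^sup>+s\<in>{0..u}. k u s \<partial>lborel) \<partial>lborel)"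
proof -
  define tri :: "real \<Rightarrow> real \<Rightarrow> ennreal" where "tri u s = indicator {(u, s). 0 \<le> s \<and> s \<le> u \<and> u \<le> v} (u, s)" for u s
  have [measurable]: "(\<lambda>(u, s). tri u s) \<in> borel_measurable (borel \<Otimes>\<^sub>M borel)"
    unfolding tri_def by measurable
  have "(\<integral>\<^sup>+s\<in>{0..v}. (\<integral>\<^sup>+u\<in>{s..v}. k u s \<partial>lborel) \<partial>lborel) = (\<integral>\<^sup>+s. (\<integral>\<^sup>+u. k u s * tri u s \<partial>lborel) \<partial>lborel)"
    by (rule nn_integral_cong, rule trans[OF nn_integral_multc[symmetric]], measurable)
      (rule nn_integral_cong, simp add: tri_def indicator_def)
  also have "\<dots> = (\<integral>\<^sup>+u. (\<integral>\<^sup>+s. k u s * tri u s \<partial>lborel) \<partial>lborel)"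
    by (rule lborel_pair.Fubini'[symmetric]) measurable
  also have "\<dots> = (\<integral>\<^sup>+u\<in>{0..v}. (\<integral>\<^sup>+s\<in>{0..u}. k u s \<partial>lborel) \<partial>lborel)"
    by (rule nn_integral_cong, rule trans[OF _ nn_integral_multc], rule nn_integral_cong)
      (auto simp: tri_def indicator_def)
  finally show ?thesis .
qed

lemma
  fixes k :: "real \<Rightarrow> real \<Rightarrow> real"
  assumes k[measurable]: "(\<lambda>(u, s). k u s) \<in> borel_measurable (borel \<Otimes>\<^sub>M borel)"
    and fin: "(\<integral>\<^sup>+s\<in>{0..v}. (\<integral>\<^sup>+u\<in>{s..v}. ennreal \<bar>k u s\<bar> \<partial>lborel) \<partial>lborel) < \<infinity>"
  shows Fubini_triangle:
      "(LBINT s:{0..v}. LBINT u:{s..v}. k u s) = (LBINT u:{0..v}. LBINT s:{0..u}. k u s)"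
    and Fubini_triangle_integrable: "set_integrable lborel {0..v} (\<lambda>u. LBINT s:{0..u}. k u s)"
    and Fubini_triangle_integrable': "set_integrable lborel {0..v} (\<lambda>s. LBINT u:{s..v}. k u s)"
proof -
  define tri :: "real \<Rightarrow> real \<Rightarrow> real" where "tri u s = indicator {(u, s). 0 \<le> s \<and> s \<le> u \<and> u \<le> v} (u, s)" for u s
  have [measurable]: "(\<lambda>(u, s). tri u s) \<in> borel_measurable (borel \<Otimes>\<^sub>M borel)"
    unfolding tri_def by measurable
  have "(\<integral>\<^sup>+x. ennreal (norm (case x of (u, s) \<Rightarrow> tri u s * k u s)) \<partial>(lborel \<Otimes>\<^sub>M lborel)) =
      (\<integral>\<^sup>+s. (\<integral>\<^sup>+u. ennreal (norm (tri u s * k u s)) \<partial>lborel) \<partial>lborel)"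
    by (subst lborel_pair.nn_integral_snd[symmetric]) (auto simp: case_prod_beta')
  also have "\<dots> = (\<integral>\<^sup>+s\<in>{0..v}. (\<integral>\<^sup>+u\<in>{s..v}. ennreal \<bar>k u s\<bar> \<partial>lborel) \<partial>lborel)"
    by (rule nn_integral_cong, rule trans[OF _ nn_integral_multc], rule nn_integral_cong)
      (auto simp: tri_def indicator_def)
  finally have int: "integrable (lborel \<Otimes>\<^sub>M lborel) (\<lambda>(u, s). tri u s * k u s)"
    using fin by (auto simp: integrable_iff_bounded)
  have "(\<lambda>s. tri u s * k u s) = (\<lambda>s. indicator {0..v} u * (indicator {0..u} s *\<^sub>R k u s))" for u
    by (auto simp: tri_def indicator_def)
  then have left: "(LBINT s. tri u s * k u s) = indicator {0..v} u * (LBINT s:{0..u}. k u s)" for u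
    by (simp add: set_lebesgue_integral_def)
  have "(\<lambda>u. tri u s * k u s) = (\<lambda>u. indicator {0..v} s * (indicator {s..v} u *\<^sub>R k u s))" for s
    by (auto simp: tri_def indicator_def)
  then have right: "(LBINT u. tri u s * k u s) = indicator {0..v} s * (LBINT u:{s..v}. k u s)" for s
    by (simp add: set_lebesgue_integral_def)
  show "(LBINT s:{0..v}. LBINT u:{s..v}. k u s) = (LBINT u:{0..v}. LBINT s:{0..u}. k u s)"
    using lborel_pair.Fubini_integral[OF int] left right by (simp add: set_lebesgue_integral_def)
  show "set_integrable lborel {0..v} (\<lambda>u. LBINT s:{0..u}. k u s)"
    using lborel_pair.integrable_fst[OF int] left by (simp add: set_integrable_def)
  show "set_integrable lborel {0..v} (\<lambda>s. LBINT u:{s..v}. k u s)"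
    using lborel_pair.integrable_snd[OF int] right by (simp add: set_integrable_def)
qed

lemma nn_integral_set_integrable_finite:
  fixes \<psi> :: "real \<Rightarrow> real"
  assumes "set_integrable lborel A \<psi>"
  shows "(\<integral>\<^sup>+s\<in>A. ennreal \<bar>\<psi> s\<bar> \<partial>lborel) < \<infinity>"
proof -
  have "(\<integral>\<^sup>+s. ennreal (norm (indicator A s *\<^sub>R \<psi> s)) \<partial>lborel) < \<infinity>"
    using assms by (simp add: set_integrable_def integrable_iff_bounded)
  then show ?thesis
    by (rule back_subst[of "\<lambda>x. x < \<infinity>"]) (auto intro!: nn_integral_cong simp: indicator_def)
qed

lemma set_integrable_nn_integral_finite:
  fixes \<psi> :: "real \<Rightarrow> real"
  assumes [measurable]: "\<psi> \<in> borel_measurable borel" "A \<in> sets borel"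
    and fin: "(\<integral>\<^sup>+s\<in>A. ennreal \<bar>\<psi> s\<bar> \<partial>lborel) < \<infinity>"
  shows "set_integrable lborel A \<psi>"
proof -
  have "(\<integral>\<^sup>+s. ennreal (norm (indicator A s *\<^sub>R \<psi> s)) \<partial>lborel) < \<infinity>"
    using fin by (rule back_subst[of "\<lambda>x. x < \<infinity>"]) (auto intro!: nn_integral_cong simp: indicator_def)
  then show ?thesis
    by (simp add: set_integrable_def integrable_iff_bounded)
qed

text \<open>After exchanging the integrals, the inner one over \<open>{s..v}\<close> is a Beta
  integral whose parameters add up to 1. Its power of \<open>v - s\<close> has exponent
  \<open>0\<close>, so it is the same constant for all \<open>s < v\<close>.\<close>

lemma Abel_inversion:
  fixes \<beta> v :: real and \<psi> :: "real \<Rightarrow> real"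
  assumes \<beta>: "0 < \<beta>" "\<beta> < 1" and [measurable]: "\<psi> \<in> borel_measurable borel"
    and \<psi>: "set_integrable lborel {0..v} \<psi>"
  shows "(LBINT u:{0..v}. (v - u) powr (\<beta> - 1) * (LBINT s:{0..u}. (u - s) powr (- \<beta>) * \<psi> s)) =
    Beta \<beta> (1 - \<beta>) * (LBINT s:{0..v}. \<psi> s)"
proof -
  define k where "k u s = (v - u) powr (\<beta> - 1) * ((u - s) powr (- \<beta>) * \<psi> s)" for u s
  have k[measurable]: "(\<lambda>(u, s). k u s) \<in> borel_measurable (borel \<Otimes>\<^sub>M borel)"
    unfolding k_def by measurable
  have kernel: "(\<integral>\<^sup>+u\<in>{s..v}. ennreal ((v - u) powr (\<beta> - 1) * (u - s) powr (- \<beta>)) \<partial>lborel) = ennreal (Beta \<beta> (1 - \<beta>))"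
    if "s < v" for s
    using nn_integral_Beta_interval[of "1 - \<beta>" \<beta> s v] \<beta> that by (simp add: mult.commute Beta_commute)
  have "(\<integral>\<^sup>+s\<in>{0..v}. (\<integral>\<^sup>+u\<in>{s..v}. ennreal \<bar>k u s\<bar> \<partial>lborel) \<partial>lborel) =
      (\<integral>\<^sup>+s. ennreal (Beta \<beta> (1 - \<beta>)) * (ennreal \<bar>\<psi> s\<bar> * indicator {0..v} s) \<partial>lborel)"
  proof (intro nn_integral_cong_AE)
    show "AE s in lborel. (\<integral>\<^sup>+u\<in>{s..v}. ennreal \<bar>k u s\<bar> \<partial>lborel) * indicator {0..v} s =
        ennreal (Beta \<beta> (1 - \<beta>)) * (ennreal \<bar>\<psi> s\<bar> * indicator {0..v} s)"
      using AE_lborel_singleton[of v]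
    proof eventually_elim
      fix s assume "s \<noteq> v"
      show "(\<integral>\<^sup>+u\<in>{s..v}. ennreal \<bar>k u s\<bar> \<partial>lborel) * indicator {0..v} s =
        ennreal (Beta \<beta> (1 - \<beta>)) * (ennreal \<bar>\<psi> s\<bar> * indicator {0..v} s)"
      proof (cases "s \<in> {0..v}")
        case True
        with \<open>s \<noteq> v\<close> have "s < v" by auto
        have "(\<integral>\<^sup>+u\<in>{s..v}. ennreal \<bar>k u s\<bar> \<partial>lborel) =
            (\<integral>\<^sup>+u. ennreal \<bar>\<psi> s\<bar> * (ennreal ((v - u) powr (\<beta> - 1) * (u - s) powr (- \<beta>)) * indicator {s..v} u) \<partial>lborel)"
          by (intro nn_integral_cong) (auto simp: k_def abs_mult ennreal_mult' indicator_def mult_ac)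
        also have "\<dots> = ennreal \<bar>\<psi> s\<bar> * ennreal (Beta \<beta> (1 - \<beta>))"
          by (subst nn_integral_cmult) (auto simp: kernel[OF \<open>s < v\<close>])
        finally show ?thesis by (simp add: mult_ac)
      qed simp
    qed
  qed
  also have "\<dots> = ennreal (Beta \<beta> (1 - \<beta>)) * (\<integral>\<^sup>+s\<in>{0..v}. ennreal \<bar>\<psi> s\<bar> \<partial>lborel)"
    by (rule nn_integral_cmult) measurable
  also have "\<dots> < \<infinity>"
    using nn_integral_set_integrable_finite[OF \<psi>] by (simp add: ennreal_mult_less_top)
  finally have fin: "(\<integral>\<^sup>+s\<in>{0..v}. (\<integral>\<^sup>+u\<in>{s..v}. ennreal \<bar>k u s\<bar> \<partial>lborel) \<partial>lborel) < \<infinity>" .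
  have "(LBINT u:{0..v}. (v - u) powr (\<beta> - 1) * (LBINT s:{0..u}. (u - s) powr (- \<beta>) * \<psi> s)) =
      (LBINT u:{0..v}. LBINT s:{0..u}. k u s)"
    by (simp add: k_def)
  also have "\<dots> = (LBINT s:{0..v}. LBINT u:{s..v}. k u s)"
    by (rule Fubini_triangle[OF k fin, symmetric])
  also have "\<dots> = (LBINT s:{0..v}. Beta \<beta> (1 - \<beta>) * \<psi> s)"
    unfolding set_lebesgue_integral_def[of lborel "{0..v}"]
  proof (rule integral_cong_AE)
    show "AE s in lborel. indicator {0..v} s *\<^sub>R (LBINT u:{s..v}. k u s) =
        indicator {0..v} s *\<^sub>R (Beta \<beta> (1 - \<beta>) * \<psi> s)"
      using AE_lborel_singleton[of v]
    proof eventually_elim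
      case (elim s)
      show ?case
      proof (cases "s \<in> {0..v}")
        case True
      then have "s < v" using elim by auto
      have "(LBINT u:{s..v}. (v - u) powr (\<beta> - 1) * (u - s) powr (- \<beta>)) = Beta \<beta> (1 - \<beta>)"
        unfolding set_lebesgue_integral_def
      proof (subst integral_eq_nn_integral)
        have "(\<integral>\<^sup>+u. ennreal (indicator {s..v} u *\<^sub>R ((v - u) powr (\<beta> - 1) * (u - s) powr - \<beta>)) \<partial>lborel) = ennreal (Beta \<beta> (1 - \<beta>))"
          using kernel[OF \<open>s < v\<close>]
          by (rule back_subst[of "\<lambda>x. x = _"]) (auto intro!: nn_integral_cong simp: indicator_def)
        then show "enn2real (\<integral>\<^sup>+u. ennreal (indicator {s..v} u *\<^sub>R ((v - u) powr (\<beta> - 1) * (u - s) powr - \<beta>)) \<partial>lborel) = Beta \<beta> (1 - \<beta>)"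
          using \<beta> by (simp add: Beta_def Gamma_real_nonneg)
      qed auto
      moreover have "(LBINT u:{s..v}. k u s) = (LBINT u:{s..v}. (v - u) powr (\<beta> - 1) * (u - s) powr (- \<beta>)) * \<psi> s"
        unfolding k_def mult.assoc[symmetric] by (rule set_integral_mult_left)
      ultimately show ?thesis by simp
      qed simp
    qed
    show "(\<lambda>s. indicator {0..v} s *\<^sub>R (LBINT u:{s..v}. k u s)) \<in> borel_measurable lborel"
      using Fubini_triangle_integrable'[OF k fin]
      by (simp add: set_integrable_def borel_measurable_integrable)
  qed measurable
  finally show ?thesis by simp
qed

text \<open>Half-lines form a pi-system generating the Borel sets, and the sets over which the
  integral vanishes are closed under complements and countable disjoint unions. So the integral over
  every Borel set is zero, which forces the integrand to vanish almost everywhere.\<close>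

lemma AE_zero_if_primitive_zero:
  fixes e :: "real \<Rightarrow> real"
  assumes e: "set_integrable lborel {0..T} e" and zero: "\<And>t. 0 \<le> t \<Longrightarrow> t \<le> T \<Longrightarrow> (LBINT u:{0..t}. e u) = 0"
  shows "AE u in lborel. u \<in> {0..T} \<longrightarrow> e u = 0"
proof (cases "0 \<le> T")
  case True
  define d where "d u = indicator {0..T} u * e u" for u
  have d: "integrable lborel d"
    using e by (simp add: set_integrable_def d_def[abs_def])
  have setint: "set_integrable lborel A d" if "A \<in> sets borel" for A
    using set_integrable_subset[of lborel UNIV d A] d that by (simp add: set_integrable_def)
  have total: "(LBINT u:UNIV. d u) = 0"
    using zero[of T] True by (simp add: set_lebesgue_integral_def d_def)
  have "(LBINT u:A. d u) = 0" if "A \<in> sets borel" for A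
  proof -
    have "Int_stable (range (atMost :: real \<Rightarrow> real set))"
      by (auto simp: Int_stable_def)
    moreover have "range (atMost :: real \<Rightarrow> real set) \<subseteq> Pow UNIV" by simp
    moreover have "A \<in> sigma_sets UNIV (range atMost)"
      using that by (simp add: borel_eq_atMost)
    ultimately show ?thesis
    proof (induction A rule: sigma_sets_induct_disjoint)
      case (basic A)
      then obtain t where A: "A = {..t}" by auto
      \<comment> \<open>For \<open>t < 0\<close> the half-line misses the support of
        \<open>d\<close>, so the interval is replaced by the empty set.\<close>
      have "(LBINT u:A. d u) = (LBINT u:(if 0 \<le> min t T then {0..min t T} else {}). e u)"
        unfolding set_lebesgue_integral_def A d_def
        by (intro Bochner_Integration.integral_cong) (auto simp: indicator_def split: if_splits)
      then show "(LBINT u:A. d u) = 0"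
        using zero[of "min t T"] by (auto simp: set_lebesgue_integral_def[of _ "{}"])
    next
      case (compl A)
      have Ab: "A \<in> sets borel" using compl.hyps by (simp add: borel_eq_atMost)
      have "(LBINT u:A \<union> (UNIV - A). d u) = (LBINT u:A. d u) + (LBINT u:UNIV - A. d u)"
        using Ab by (intro set_integral_Un setint) auto
      then show "(LBINT u:UNIV - A. d u) = 0"
        using compl total by (simp add: Un_absorb1)
    next
      case (union A)
      have Ab: "A i \<in> sets borel" for i using union by (auto simp: borel_eq_atMost)
      have "(LBINT u:(\<Union>i. A i). d u) = (\<Sum>i. LBINT u:A i. d u)"
        using union Ab by (intro lebesgue_integral_countable_add setint) (auto simp: disjoint_family_on_def)
      then show "(LBINT u:(\<Union>i. A i). d u) = 0" using union by simp
    qed (auto simp: set_lebesgue_integral_def)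
  qed
  then have "AE u in lborel. d u = 0"
    by (intro sigma_finite_measure.density_zero sigma_finite_lborel d) auto
  then show ?thesis
    by eventually_elim (auto simp: d_def indicator_def)
qed simp

lemma borel_measurable_LBINT_Icc:
  fixes k :: "'a \<Rightarrow> real \<Rightarrow> real"
  assumes [measurable]: "b \<in> borel_measurable N" "(\<lambda>(x, s). k x s) \<in> borel_measurable (N \<Otimes>\<^sub>M borel)"
  shows "(\<lambda>x. LBINT s:{0..b x}. k x s) \<in> borel_measurable N"
proof -
  have "(\<lambda>(x, s). if 0 \<le> s \<and> s \<le> b x then k x s else 0) \<in> borel_measurable (N \<Otimes>\<^sub>M borel)"
    by measurable
  then have "(\<lambda>x. LBINT s. if 0 \<le> s \<and> s \<le> b x then k x s else 0) \<in> borel_measurable N"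
    by (intro lborel.borel_measurable_lebesgue_integral) (simp cong: measurable_cong_sets)
  also have "(\<lambda>x. LBINT s. if 0 \<le> s \<and> s \<le> b x then k x s else 0) = (\<lambda>x. LBINT s:{0..b x}. k x s)"
    by (auto simp: set_lebesgue_integral_def indicator_def intro!: Bochner_Integration.integral_cong)
  finally show ?thesis .
qed

text \<open>The product is at most the sum of the two squares, and \<open>s powr (2 * p)\<close> is
  integrable at \<open>0\<close> since \<open>2 * p > -1\<close>. The weight exponent
  \<open>1/2 - H\<close> qualifies because \<open>H < 1\<close>.\<close>

lemma set_integrable_powr_mult:
  fixes f :: "real \<Rightarrow> real"
  assumes p: "- (1/2) < p" and [measurable]: "f \<in> borel_measurable borel"
    and f2: "set_integrable lborel {0..T} (\<lambda>s. (f s)\<^sup>2)"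
  shows "set_integrable lborel {0..T} (\<lambda>s. s powr p * f s)"
proof (cases "0 < T")
  case True
  have "(\<integral>\<^sup>+s\<in>{0..T}. ennreal \<bar>s powr p * f s\<bar> \<partial>lborel) \<le>
      (\<integral>\<^sup>+s. ennreal ((s - 0) powr (2 * p + 1 - 1)) * indicator {0..T} s + ennreal \<bar>(f s)\<^sup>2\<bar> * indicator {0..T} s \<partial>lborel)"
  proof (rule nn_integral_mono)
    fix s :: real
    have "\<bar>s powr p * f s\<bar> \<le> (s powr p)\<^sup>2 + (f s)\<^sup>2"
    proof -
      have "0 \<le> s powr p * \<bar>f s\<bar>" by simp
      moreover have "2 * (s powr p * \<bar>f s\<bar>) \<le> (s powr p)\<^sup>2 + (f s)\<^sup>2"
        using sum_squares_bound[of "s powr p" "\<bar>f s\<bar>"] by (simp add: mult.assoc)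
      moreover have "\<bar>s powr p * f s\<bar> = s powr p * \<bar>f s\<bar>" by (simp add: abs_mult)
      ultimately show ?thesis by linarith
    qed
    also have "(s powr p)\<^sup>2 = s powr (2 * p + 1 - 1)"
      by (simp add: powr_add[symmetric] power2_eq_square)
    finally show "ennreal \<bar>s powr p * f s\<bar> * indicator {0..T} s \<le>
        ennreal ((s - 0) powr (2 * p + 1 - 1)) * indicator {0..T} s + ennreal \<bar>(f s)\<^sup>2\<bar> * indicator {0..T} s"
      by (auto simp: indicator_def ennreal_plus[symmetric] simp del: ennreal_plus)
  qed
  also have "\<dots> = ennreal ((T - 0) powr (2 * p + 1) * Beta (2 * p + 1) 1) + (\<integral>\<^sup>+s\<in>{0..T}. ennreal \<bar>(f s)\<^sup>2\<bar> \<partial>lborel)"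
    using nn_integral_powr_left[of "2 * p + 1" 0 T] p True by (subst nn_integral_add) auto
  also have "\<dots> < \<infinity>"
    using nn_integral_set_integrable_finite[OF f2] by simp
  finally show ?thesis
    by (intro set_integrable_nn_integral_finite) auto
next
  case False
  have "(\<integral>\<^sup>+s\<in>{0..T}. ennreal \<bar>s powr p * f s\<bar> \<partial>lborel) = (\<integral>\<^sup>+s. 0 \<partial>(lborel :: real measure))"
    using AE_lborel_singleton[of 0]
    by (intro nn_integral_cong_AE, eventually_elim) (use False in \<open>auto simp: indicator_def\<close>)
  then show ?thesis
    by (intro set_integrable_nn_integral_finite) auto
qed

section \<open>Explicit inversion for the two ranges of the Hurst parameter\<close>

lemma Beta_real_pos: "0 < p \<Longrightarrow> 0 < q \<Longrightarrow> 0 < Beta p (q::real)"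
  by (simp add: Beta_def)

lemma c_H_pos:
  assumes "0 < H" "H < 1" "H \<noteq> 1/2"
  shows "0 < c_H H"
proof (cases "H > 1/2")
  case True
  then show ?thesis
    using assms Beta_real_pos[of "2 - 2 * H" "H - 1/2"] by (simp add: c_H_def)
next
  case False
  then have "0 < 1 - 2 * H" using assms by simp
  then show ?thesis
    using False assms Beta_real_pos[of "1 - 2 * H" "H + 1/2"] by (simp add: c_H_def)
qed

text \<open>With \<open>q = H - 1/2\<close>, Fubini writes the operator as \<open>c\<close> times
  the primitive of \<open>u powr q * h u\<close>, where \<open>h\<close> is, up to a constant, the
  fractional integral of order \<open>q\<close> of the weighted function \<open>\<psi>\<close>.
  Equal primitives give \<open>y u = c * u powr q * h u\<close> almost everywhere, and Abel's
  inversion applied to \<open>h\<close> returns the primitive of \<open>\<psi>\<close>.\<close>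

lemma smooth_kernel_primitive:
  fixes f y :: "real \<Rightarrow> real"
  assumes H: "1/2 < H" "H < 1" and f[measurable]: "f \<in> borel_measurable borel"
    and f2: "set_integrable lborel {0..T} (\<lambda>s. (f s)\<^sup>2)"
    and y: "set_integrable lborel {0..T} y"
    and eq: "\<And>t. 0 \<le> t \<Longrightarrow> t \<le> T \<Longrightarrow> K_op H f t = (LBINT u:{0..t}. y u)"
  shows "(LBINT u:{0..T}. (T - u) powr (1/2 - H) * (u powr (1/2 - H) * y u)) =
    c_H H * Beta (3/2 - H) (H - 1/2) * (LBINT s:{0..T}. s powr (1/2 - H) * f s)"
proof -
  define q where "q = H - 1/2"
  have q: "0 < q" "q < 1/2" using H by (auto simp: q_def)
  define c where "c = c_H H"
  have c: "0 < c" unfolding c_def using H by (intro c_H_pos) auto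
  define \<psi> where "\<psi> s = s powr (- q) * f s" for s
  have [measurable]: "\<psi> \<in> borel_measurable borel" unfolding \<psi>_def[abs_def] by measurable
  have \<psi>: "set_integrable lborel {0..T} \<psi>"
    unfolding \<psi>_def[abs_def] using q f2 by (intro set_integrable_powr_mult) auto
  define h where "h u = (LBINT s:{0..u}. (u - s) powr (q - 1) * \<psi> s)" for u
  define k where "k u s = u powr q * ((u - s) powr (q - 1) * \<psi> s)" for u s
  have k[measurable]: "(\<lambda>(u, s). k u s) \<in> borel_measurable (borel \<Otimes>\<^sub>M borel)"
    unfolding k_def by measurable
  have k_h: "(LBINT s:{0..u}. k u s) = u powr q * h u" for u
    by (simp add: k_def h_def)
  have fin: "(\<integral>\<^sup>+s\<in>{0..t}. (\<integral>\<^sup>+u\<in>{s..t}. ennreal \<bar>k u s\<bar> \<partial>lborel) \<partial>lborel) < \<infinity>" if t: "t \<le> T" for t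
  proof -
    \<comment> \<open>One factor \<open>t powr q\<close> bounds \<open>u powr q\<close>; the other,
      with the Beta value, bounds the integral of the singular factor
      \<open>(u - s) powr (q - 1)\<close>.\<close>
    define B where "B = t powr q * (t powr q * Beta q 1)"
    have B: "0 \<le> B" using Beta_real_pos[of q 1] q by (simp add: B_def)
    have "(\<integral>\<^sup>+s\<in>{0..t}. (\<integral>\<^sup>+u\<in>{s..t}. ennreal \<bar>k u s\<bar> \<partial>lborel) \<partial>lborel) \<le>
        (\<integral>\<^sup>+s. ennreal B * (ennreal \<bar>\<psi> s\<bar> * indicator {0..T} s) \<partial>lborel)"
    proof (rule nn_integral_mono_AE)
      show "AE s in lborel. (\<integral>\<^sup>+u\<in>{s..t}. ennreal \<bar>k u s\<bar> \<partial>lborel) * indicator {0..t} s \<le>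
          ennreal B * (ennreal \<bar>\<psi> s\<bar> * indicator {0..T} s)"
        using AE_lborel_singleton[of t]
      proof eventually_elim
        case (elim s)
        show ?case
        proof (cases "s \<in> {0..t}")
          case True
          then have s: "0 \<le> s" "s < t" using elim by auto
          have "(\<integral>\<^sup>+u\<in>{s..t}. ennreal \<bar>k u s\<bar> \<partial>lborel) \<le>
              (\<integral>\<^sup>+u. ennreal (t powr q * \<bar>\<psi> s\<bar>) * (ennreal ((u - s) powr (q - 1)) * indicator {s..t} u) \<partial>lborel)"
          proof (rule nn_integral_mono)
            fix u :: real
            have "\<bar>k u s\<bar> \<le> t powr q * \<bar>\<psi> s\<bar> * (u - s) powr (q - 1)" if "u \<in> {s..t}"
            proof -
              have "\<bar>k u s\<bar> = u powr q * (\<bar>\<psi> s\<bar> * (u - s) powr (q - 1))"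
                by (simp add: k_def abs_mult)
              also have "\<dots> \<le> t powr q * (\<bar>\<psi> s\<bar> * (u - s) powr (q - 1))"
                using that s q by (intro mult_right_mono powr_mono2) auto
              finally show ?thesis by (simp add: mult.assoc)
            qed
            then show "ennreal \<bar>k u s\<bar> * indicator {s..t} u \<le>
                ennreal (t powr q * \<bar>\<psi> s\<bar>) * (ennreal ((u - s) powr (q - 1)) * indicator {s..t} u)"
              by (auto simp: indicator_def ennreal_mult'[symmetric] intro!: ennreal_leI)
          qed
          also have "\<dots> = ennreal (t powr q * \<bar>\<psi> s\<bar>) * ennreal ((t - s) powr q * Beta q 1)"
            using nn_integral_powr_left[of q s t] s q by (subst nn_integral_cmult) auto
          also have "\<dots> = ennreal (t powr q * \<bar>\<psi> s\<bar> * ((t - s) powr q * Beta q 1))"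
            by (simp add: ennreal_mult'[symmetric])
          also have "\<dots> \<le> ennreal (B * \<bar>\<psi> s\<bar>)"
          proof (rule ennreal_leI)
            have "(t - s) powr q * Beta q 1 \<le> t powr q * Beta q 1"
              using s q Beta_real_pos[of q 1] by (intro mult_right_mono powr_mono2) auto
            then have "t powr q * \<bar>\<psi> s\<bar> * ((t - s) powr q * Beta q 1) \<le> t powr q * \<bar>\<psi> s\<bar> * (t powr q * Beta q 1)"
              by (intro mult_left_mono) auto
            then show "t powr q * \<bar>\<psi> s\<bar> * ((t - s) powr q * Beta q 1) \<le> B * \<bar>\<psi> s\<bar>"
              by (simp add: B_def mult_ac)
          qed
          finally show ?thesis
            using True t B by (simp add: ennreal_mult'[symmetric])
        qed simp
      qed
    qed
    also have "\<dots> = ennreal B * (\<integral>\<^sup>+s\<in>{0..T}. ennreal \<bar>\<psi> s\<bar> \<partial>lborel)"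
      by (rule nn_integral_cmult) measurable
    also have "\<dots> < \<infinity>"
      using nn_integral_set_integrable_finite[OF \<psi>] by (simp add: ennreal_mult_less_top)
    finally show ?thesis .
  qed
  have K_op: "K_op H f t = c * (LBINT u:{0..t}. u powr q * h u)" if "t \<le> T" for t
  proof -
    have "K_H H t s * f s = c * (LBINT u:{s..t}. k u s)" for s
    proof -
      have "(LBINT u:{s..t}. k u s) = (LBINT u:{s..t}. (u - s) powr (q - 1) * u powr q * \<psi> s)"
        by (simp add: k_def mult_ac)
      also have "\<dots> = (LBINT u:{s..t}. (u - s) powr (q - 1) * u powr q) * \<psi> s"
        by (rule set_integral_mult_left)
      finally have "(LBINT u:{s..t}. k u s) = (LBINT u:{s..t}. (u - s) powr (q - 1) * u powr q) * \<psi> s" .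
      moreover have "H - 3/2 = q - 1" "H - 1/2 = q" "1/2 - H = - q" by (auto simp: q_def)
      moreover have "K_H H t s = c_H H * s powr (1/2 - H) * (LBINT u:{s..t}. (u - s) powr (H - 3/2) * u powr (H - 1/2))"
        using H by (simp add: K_H_def)
      ultimately show ?thesis
        by (simp only: c_def \<psi>_def mult_ac)
    qed
    then have "K_op H f t = c * (LBINT s:{0..t}. LBINT u:{s..t}. k u s)"
      by (simp add: K_op_def)
    then show ?thesis
      using Fubini_triangle[OF k fin[OF that]] by (simp add: k_h)
  qed
  have int_h: "set_integrable lborel {0..T} (\<lambda>u. u powr q * h u)"
    using Fubini_triangle_integrable[OF k fin] by (simp add: k_h)
  have "AE u in lborel. u \<in> {0..T} \<longrightarrow> c * (u powr q * h u) - y u = 0"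
  proof (rule AE_zero_if_primitive_zero)
    show "set_integrable lborel {0..T} (\<lambda>u. c * (u powr q * h u) - y u)"
      using int_h y by (intro set_integral_diff set_integrable_mult_right) auto
    fix t assume t: "0 \<le> t" "t \<le> T"
    have sub: "set_integrable lborel {0..t} g" if "set_integrable lborel {0..T} g" for g :: "real \<Rightarrow> real"
      using that by (rule set_integrable_subset) (use t in auto)
    have "(LBINT u:{0..t}. c * (u powr q * h u) - y u) = (LBINT u:{0..t}. c * (u powr q * h u)) - (LBINT u:{0..t}. y u)"
      by (intro set_integral_diff set_integrable_mult_right sub int_h y)
    then show "(LBINT u:{0..t}. c * (u powr q * h u) - y u) = 0"
      using K_op[OF t(2)] eq[OF t] by simp
  qed
  then have y_h: "AE u in lborel. u \<in> {0..T} \<longrightarrow> u powr (- q) * y u = c * h u"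
    using AE_lborel_singleton[of 0]
  proof eventually_elim
    case (elim u)
    show ?case
    proof
      assume u: "u \<in> {0..T}"
      with elim have "0 < u" "y u = c * (u powr q * h u)" by auto
      then show "u powr (- q) * y u = c * h u"
        by (simp add: powr_minus field_simps)
    qed
  qed
  have h_meas[measurable]: "h \<in> borel_measurable borel"
    unfolding h_def[abs_def] by (rule borel_measurable_LBINT_Icc) measurable
  have "(LBINT u:{0..T}. (T - u) powr (- q) * (u powr (- q) * y u)) = (LBINT u:{0..T}. (T - u) powr (- q) * (c * h u))"
    unfolding set_lebesgue_integral_def
  proof (rule integral_cong_AE)
    \<comment> \<open>Integrability on \<open>{0..T}\<close> gives measurability of \<open>y\<close>
      only after cutting off outside this interval, hence the detour through the indicator.\<close>
    have "(\<lambda>u. indicator {0..T} u *\<^sub>R y u) \<in> borel_measurable borel"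
      using y by (simp add: set_integrable_def borel_measurable_integrable)
    then have "(\<lambda>u. (T - u) powr (- q) * u powr (- q) * (indicator {0..T} u *\<^sub>R y u)) \<in> borel_measurable lborel"
      by measurable
    then show "(\<lambda>u. indicator {0..T} u *\<^sub>R ((T - u) powr (- q) * (u powr (- q) * y u))) \<in> borel_measurable lborel"
      by (simp add: mult_ac)
    show "(\<lambda>u. indicator {0..T} u *\<^sub>R ((T - u) powr (- q) * (c * h u))) \<in> borel_measurable lborel"
      by measurable
    show "AE u in lborel. indicator {0..T} u *\<^sub>R ((T - u) powr (- q) * (u powr (- q) * y u)) =
        indicator {0..T} u *\<^sub>R ((T - u) powr (- q) * (c * h u))"
      using y_h by eventually_elim (auto simp: indicator_def)
  qed
  also have "\<dots> = c * (LBINT u:{0..T}. (T - u) powr (- q) * h u)"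
    by (simp add: mult.left_commute)
  \<comment> \<open>Abel's parameter is \<open>1 - q\<close>: its exponents are then
    \<open>- q\<close> outside and \<open>q - 1\<close> inside.\<close>
  also have "(LBINT u:{0..T}. (T - u) powr (- q) * h u) = Beta (1 - q) q * (LBINT s:{0..T}. \<psi> s)"
    using Abel_inversion[of "1 - q" \<psi> T] q \<psi> by (simp add: h_def)
  finally show ?thesis
    by (simp add: q_def c_def \<psi>_def)
qed

text \<open>With \<open>a = 1/2 - H\<close> and \<open>G\<close> the Abel integral of
  \<open>\<psi>\<close>, the operator becomes
  \<open>c * (t powr (- a) * G t + a * \<Phi> t)\<close>, where \<open>\<Phi>\<close> is the
  primitive of \<open>u powr (- a - 1) * G u\<close>. Differentiating formally, the terms without
  \<open>G'\<close> cancel and \<open>c * t powr (- a) * G' t = y t\<close> remains. So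
  \<open>c * G\<close> is the primitive of \<open>u powr a * y u\<close>, and Abel's inversion with
  parameter \<open>a\<close> finishes. Differentiability of \<open>G\<close> is not given in advance
  and is extracted from the equation itself.\<close>

lemma rough_kernel_primitive:
  fixes f y :: "real \<Rightarrow> real"
  assumes H: "0 < H" "H < 1/2" and f[measurable]: "f \<in> borel_measurable borel" and T: "0 \<le> T"
    and f2: "set_integrable lborel {0..T} (\<lambda>s. (f s)\<^sup>2)"
    and y: "continuous_on {0..T} y"
    and eq: "\<And>t. 0 \<le> t \<Longrightarrow> t \<le> T \<Longrightarrow> K_op H f t = (LBINT u:{0..t}. y u)"
  shows "(LBINT u:{0..T}. (T - u) powr (- 1/2 - H) * (LBINT r:{0..u}. r powr (1/2 - H) * y r)) =
    c_H H * Beta (1/2 - H) (1/2 + H) * (LBINT s:{0..T}. s powr (1/2 - H) * f s)"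
proof -
  define a where "a = 1/2 - H"
  have a: "0 < a" "a < 1/2" using H by (auto simp: a_def)
  define c where "c = c_H H"
  have c: "0 < c" unfolding c_def using H by (intro c_H_pos) auto
  define \<psi> where "\<psi> s = s powr a * f s" for s
  have [measurable]: "\<psi> \<in> borel_measurable borel" unfolding \<psi>_def[abs_def] by measurable
  have \<psi>: "set_integrable lborel {0..T} \<psi>"
    unfolding \<psi>_def[abs_def] using a f2 by (intro set_integrable_powr_mult) auto
  define G where "G u = (LBINT s:{0..u}. (u - s) powr (- a) * \<psi> s)" for u
  define k where "k u s = u powr (- a - 1) * ((u - s) powr (- a) * \<psi> s)" for u s
  have k[measurable]: "(\<lambda>(u, s). k u s) \<in> borel_measurable (borel \<Otimes>\<^sub>M borel)"
    unfolding k_def by measurable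
  have k_G: "(LBINT s:{0..u}. k u s) = u powr (- a - 1) * G u" for u
    by (simp add: k_def G_def)
  define N where "N = enn2real (\<integral>\<^sup>+s\<in>{0..T}. ennreal \<bar>(f s)\<^sup>2\<bar> \<partial>lborel)"
  have N: "(\<integral>\<^sup>+s\<in>{0..T}. ennreal \<bar>(f s)\<^sup>2\<bar> \<partial>lborel) = ennreal N" "0 \<le> N"
    using nn_integral_set_integrable_finite[OF f2] by (simp_all add: N_def)
  define B where "B = Beta 1 (1 - 2 * a)"
  have B: "0 < B" using Beta_real_pos[of 1 "1 - 2 * a"] a by (simp add: B_def)
  \<comment> \<open>Square integrability of \<open>f\<close> gives order
    \<open>u powr (1/2)\<close>. Multiplied by \<open>u powr (- a - 1)\<close> this leaves the
    exponent \<open>- a - 1/2\<close>, above \<open>-1\<close> because \<open>a < 1/2\<close>, so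
    the double integral in \<open>fin\<close> converges at \<open>0\<close>.\<close>
  have bound: "(\<integral>\<^sup>+s\<in>{0..u}. ennreal \<bar>(u - s) powr (- a) * \<psi> s\<bar> \<partial>lborel) \<le> ennreal ((B + N) * u powr (1/2))"
    if u: "0 < u" "u \<le> T" for u
  proof -
    \<comment> \<open>the weight in AM-GM that makes both terms of order \<open>u powr (1/2)\<close>\<close>
    define l where "l = u powr (a - 1/2)"
    have l: "0 < l" "1 / l = u powr (1/2 - a)"
      using u powr_minus_divide[of u "a - 1/2"] by (simp_all add: l_def)
    have "(\<integral>\<^sup>+s\<in>{0..u}. ennreal \<bar>(u - s) powr (- a) * \<psi> s\<bar> \<partial>lborel) \<le>
        (\<integral>\<^sup>+s. ennreal (u powr a * l) * (ennreal ((u - s) powr ((1 - 2 * a) - 1)) * indicator {0..u} s)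
          + ennreal (u powr a * (1 / l)) * (ennreal \<bar>(f s)\<^sup>2\<bar> * indicator {0..T} s) \<partial>lborel)"
    proof (rule nn_integral_mono)
      fix s :: real
      have pointwise: "\<bar>(u - s) powr (- a) * \<psi> s\<bar> \<le>
          u powr a * l * (u - s) powr ((1 - 2 * a) - 1) + u powr a * (1 / l) * (f s)\<^sup>2" if s: "s \<in> {0..u}"
      proof -
        define z where "z = (u - s) powr (- a)"
        have z2: "(u - s) powr ((1 - 2 * a) - 1) = z\<^sup>2"
          by (simp add: z_def power2_eq_square powr_add[symmetric])
        have "0 \<le> z" by (simp add: z_def)
        have "z * \<bar>f s\<bar> \<le> l * z\<^sup>2 + (1 / l) * (f s)\<^sup>2"
        proof -
          have "0 \<le> (l * z - \<bar>f s\<bar>)\<^sup>2" by simp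
          then have "2 * (l * z * \<bar>f s\<bar>) \<le> (l * z)\<^sup>2 + (f s)\<^sup>2"
            by (simp add: power2_eq_square algebra_simps)
          moreover have "0 \<le> l * z * \<bar>f s\<bar>" using l \<open>0 \<le> z\<close> by simp
          ultimately have "l * z * \<bar>f s\<bar> \<le> (l * z)\<^sup>2 + (f s)\<^sup>2" by linarith
          then have "l * (z * \<bar>f s\<bar>) \<le> l * (l * z\<^sup>2 + (1 / l) * (f s)\<^sup>2)"
            using l(1) by (simp add: power2_eq_square algebra_simps)
          then show ?thesis using l(1) by (simp only: mult_le_cancel_left_pos)
        qed
        then have "u powr a * (z * \<bar>f s\<bar>) \<le> u powr a * (l * z\<^sup>2 + (1 / l) * (f s)\<^sup>2)"
          by (intro mult_left_mono) auto
        moreover have "\<bar>z * \<psi> s\<bar> \<le> u powr a * (z * \<bar>f s\<bar>)"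
        proof -
          have "\<bar>z * \<psi> s\<bar> = s powr a * (z * \<bar>f s\<bar>)"
            using \<open>0 \<le> z\<close> by (simp add: \<psi>_def abs_mult)
          also have "\<dots> \<le> u powr a * (z * \<bar>f s\<bar>)"
            using s a \<open>0 \<le> z\<close> by (intro mult_right_mono powr_mono2) auto
          finally show ?thesis .
        qed
        ultimately show ?thesis
          unfolding z2 by (simp add: z_def[symmetric] algebra_simps)
      qed
      have le: "ennreal \<bar>(u - s) powr (- a) * \<psi> s\<bar> \<le>
          ennreal (u powr a * l * (u - s) powr ((1 - 2 * a) - 1)) + ennreal (u powr a * (1 / l) * (f s)\<^sup>2)"
        if "s \<in> {0..u}"
      proof (rule order.trans[OF ennreal_leI[OF pointwise[OF that]]])
        show "ennreal (u powr a * l * (u - s) powr ((1 - 2 * a) - 1) + u powr a * (1 / l) * (f s)\<^sup>2) \<le>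
            ennreal (u powr a * l * (u - s) powr ((1 - 2 * a) - 1)) + ennreal (u powr a * (1 / l) * (f s)\<^sup>2)"
          by (rule eq_refl, intro ennreal_plus mult_nonneg_nonneg powr_ge_zero zero_le_power2)
            (use l(1) in simp_all)
      qed
      show "ennreal \<bar>(u - s) powr (- a) * \<psi> s\<bar> * indicator {0..u} s \<le>
          ennreal (u powr a * l) * (ennreal ((u - s) powr ((1 - 2 * a) - 1)) * indicator {0..u} s)
          + ennreal (u powr a * (1 / l)) * (ennreal \<bar>(f s)\<^sup>2\<bar> * indicator {0..T} s)"
      proof (cases "s \<in> {0..u}")
        case True
        then have "s \<in> {0..T}" using u by auto
        then show ?thesis
          using le[OF True] True l by (simp add: ennreal_mult'[symmetric] less_imp_le)
      qed simp
    qed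
    also have "\<dots> = ennreal (u powr a * l) * ennreal ((u - 0) powr (1 - 2 * a) * B) + ennreal (u powr a * (1 / l)) * ennreal N"
    proof (subst nn_integral_add)
      show "(\<integral>\<^sup>+s. ennreal (u powr a * l) * (ennreal ((u - s) powr ((1 - 2 * a) - 1)) * indicator {0..u} s) \<partial>lborel) +
          (\<integral>\<^sup>+s. ennreal (u powr a * (1 / l)) * (ennreal \<bar>(f s)\<^sup>2\<bar> * indicator {0..T} s) \<partial>lborel) =
          ennreal (u powr a * l) * ennreal ((u - 0) powr (1 - 2 * a) * B) + ennreal (u powr a * (1 / l)) * ennreal N"
        unfolding B_def N(1)[symmetric]
        using nn_integral_powr_right[of "1 - 2 * a" 0 u] a u by (subst (1 2) nn_integral_cmult) auto
    qed measurable
    also have "\<dots> = ennreal (u powr a * l * (u powr (1 - 2 * a) * B) + u powr a * (1 / l) * N)"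
      using l B N u by (simp add: ennreal_mult'[symmetric])
    also have "u powr a * l * (u powr (1 - 2 * a) * B) + u powr a * (1 / l) * N = (B + N) * u powr (1/2)"
    proof -
      have "u powr a * l * u powr (1 - 2 * a) = u powr (1/2)" "u powr a * (1 / l) = u powr (1/2)"
        unfolding l(2) by (simp_all add: l_def powr_add[symmetric])
      then show ?thesis by (simp add: algebra_simps)
    qed
    finally show ?thesis .
  qed
  have int_G: "set_integrable lborel {0..u} (\<lambda>s. (u - s) powr (- a) * \<psi> s)" if "0 < u" "u \<le> T" for u
    by (intro set_integrable_nn_integral_finite order.strict_trans1[OF bound[OF that]]) auto
  have fin: "(\<integral>\<^sup>+s\<in>{0..t}. (\<integral>\<^sup>+u\<in>{s..t}. ennreal \<bar>k u s\<bar> \<partial>lborel) \<partial>lborel) < \<infinity>" if t: "0 < t" "t \<le> T" for t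
  proof -
    have "(\<integral>\<^sup>+s\<in>{0..t}. (\<integral>\<^sup>+u\<in>{s..t}. ennreal \<bar>k u s\<bar> \<partial>lborel) \<partial>lborel) =
        (\<integral>\<^sup>+u\<in>{0..t}. (\<integral>\<^sup>+s\<in>{0..u}. ennreal \<bar>k u s\<bar> \<partial>lborel) \<partial>lborel)"
      by (rule nn_integral_triangle) measurable
    also have "\<dots> \<le> (\<integral>\<^sup>+u. ennreal (B + N) * (ennreal ((u - 0) powr ((1/2 - a) - 1)) * indicator {0..t} u) \<partial>lborel)"
    proof (rule nn_integral_mono_AE)
      show "AE u in lborel. (\<integral>\<^sup>+s\<in>{0..u}. ennreal \<bar>k u s\<bar> \<partial>lborel) * indicator {0..t} u \<le>
          ennreal (B + N) * (ennreal ((u - 0) powr ((1/2 - a) - 1)) * indicator {0..t} u)"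
        using AE_lborel_singleton[of 0]
      proof eventually_elim
        case (elim u)
        show ?case
        proof (cases "u \<in> {0..t}")
          case True
          then have u: "0 < u" "u \<le> T" using elim t by auto
          have "(\<integral>\<^sup>+s\<in>{0..u}. ennreal \<bar>k u s\<bar> \<partial>lborel) =
              (\<integral>\<^sup>+s. ennreal (u powr (- a - 1)) * (ennreal \<bar>(u - s) powr (- a) * \<psi> s\<bar> * indicator {0..u} s) \<partial>lborel)"
            by (intro nn_integral_cong) (simp add: k_def abs_mult ennreal_mult' mult.assoc)
          also have "\<dots> = ennreal (u powr (- a - 1)) * (\<integral>\<^sup>+s\<in>{0..u}. ennreal \<bar>(u - s) powr (- a) * \<psi> s\<bar> \<partial>lborel)"
            by (rule nn_integral_cmult) measurable
          also have "\<dots> \<le> ennreal (u powr (- a - 1)) * ennreal ((B + N) * u powr (1/2))"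
            by (intro mult_left_mono bound u) auto
          also have "\<dots> = ennreal ((B + N) * u powr ((1/2 - a) - 1))"
          proof -
            have "u powr (- a - 1) * u powr (1/2) = u powr ((1/2 - a) - 1)"
              by (simp add: powr_add[symmetric])
            then show ?thesis by (simp add: ennreal_mult'[symmetric] mult_ac)
          qed
          finally show ?thesis
            using True B N by (simp add: ennreal_mult'[symmetric] ennreal_mult)
        qed simp
      qed
    qed
    also have "\<dots> = ennreal (B + N) * ennreal ((t - 0) powr (1/2 - a) * Beta (1/2 - a) 1)"
      using nn_integral_powr_left[of "1/2 - a" 0 t] a t by (subst nn_integral_cmult) auto
    also have "\<dots> < \<infinity>"
      by (simp add: ennreal_mult_less_top)
    finally show ?thesis .
  qed
  have K_op: "K_op H f t = c * (t powr (- a) * G t + a * (LBINT u:{0..t}. u powr (- a - 1) * G u))"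
    if t: "0 < t" "t \<le> T" for t
  proof -
    have "K_H H t s * f s = c * (t powr (- a) * ((t - s) powr (- a) * \<psi> s) + a * (LBINT u:{s..t}. k u s))"
      if s: "s \<in> {0..t}" for s
    proof -
      have "(LBINT u:{s..t}. k u s) = (LBINT u:{s..t}. u powr (- a - 1) * (u - s) powr (- a) * \<psi> s)"
        by (simp add: k_def mult_ac)
      also have "\<dots> = (LBINT u:{s..t}. u powr (- a - 1) * (u - s) powr (- a)) * \<psi> s"
        by (rule set_integral_mult_left)
      finally have inner: "(LBINT u:{s..t}. k u s) = (LBINT u:{s..t}. u powr (- a - 1) * (u - s) powr (- a)) * \<psi> s" .
      have expo: "H - 3/2 = - a - 1" "H - 1/2 = - a" "1/2 - H = a" by (auto simp: a_def)
      \<comment> \<open>At \<open>s = 0\<close> both sides are \<open>0\<close>, by the values of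
        division by \<open>0\<close> and of powers of \<open>0\<close>.\<close>
      have "(t / s) powr (- a) = t powr (- a) * s powr a"
        using s t by (cases "s = 0") (simp_all add: powr_divide powr_minus_divide[of s a])
      moreover have "K_H H t s = c_H H * ((t / s) powr (- a) * (t - s) powr (- a)
          - (- a) * s powr a * (LBINT u:{s..t}. u powr (- a - 1) * (u - s) powr (- a)))"
        using H by (simp add: K_H_def flip: expo)
      ultimately show ?thesis
        unfolding inner by (simp add: c_def \<psi>_def algebra_simps)
    qed
    then have "K_op H f t = (LBINT s:{0..t}. c * (t powr (- a) * ((t - s) powr (- a) * \<psi> s) + a * (LBINT u:{s..t}. k u s)))"
      unfolding K_op_def by (intro set_lebesgue_integral_cong) auto
    also have "\<dots> = c * (t powr (- a) * (LBINT s:{0..t}. (t - s) powr (- a) * \<psi> s) + a * (LBINT s:{0..t}. LBINT u:{s..t}. k u s))"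
      using int_G[OF t] Fubini_triangle_integrable'[OF k fin[OF t]]
      by (simp add: set_integral_add(2))
    finally show ?thesis
      using Fubini_triangle[OF k fin[OF t]] by (simp add: k_G G_def)
  qed
  have G_eq: "G t = (LBINT u:{0..t}. u powr a * y u) / c" if t: "0 \<le> t" "t \<le> T" for t
  proof (cases "t = 0")
    case True
    have "(LBINT s:{0..0}. g s) = 0" for g :: "real \<Rightarrow> real"
      using AE_lborel_singleton[of 0] unfolding set_lebesgue_integral_def
      by (intro integral_eq_zero_AE, eventually_elim) (auto simp: indicator_def)
    then show ?thesis using True by (simp add: G_def)
  next
    case False
    then have t0: "0 < t" using t by simp
    define \<phi> where "\<phi> u = u powr (- a - 1) * G u" for u
    have sub: "set_integrable lborel {0..r} g" if "set_integrable lborel {0..t} g" "r \<le> t" for g :: "real \<Rightarrow> real" and r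
      using that(1) by (rule set_integrable_subset) (use that in auto)
    have int_\<phi>: "set_integrable lborel {0..t} \<phi>"
      using Fubini_triangle_integrable[OF k fin[OF t0 t(2)]] by (simp add: k_G \<phi>_def[abs_def])
    have cont_y: "continuous_on {0..t} y"
      using y t by (auto intro: continuous_on_subset)
    have int_y: "set_integrable lborel {0..t} y"
      by (rule borel_integrable_atLeastAtMost'[OF cont_y])
    define g where "g r = integral {0..r} y" for r
    define \<Phi> where "\<Phi> r = integral {0..r} \<phi>" for r
    have g: "g r = (LBINT u:{0..r}. y u)" and \<Phi>: "\<Phi> r = (LBINT u:{0..r}. \<phi> u)" if "r \<le> t" for r
      unfolding g_def \<Phi>_def using that sub int_y int_\<phi>
      by (auto simp: set_borel_integral_eq_integral(2))
    \<comment> \<open>The equation solved for \<open>G\<close>. Its right-hand side contains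
      \<open>G\<close> only through the primitive \<open>\<Phi>\<close>, so it is continuous; this
      makes \<open>\<phi>\<close> continuous inside the interval, then \<open>\<Phi>\<close> and
      finally \<open>P\<close> differentiable there.\<close>
    define P where "P r = r powr a * (g r / c - a * \<Phi> r)" for r
    have G_P: "G r = P r" if r: "0 < r" "r \<le> t" for r
    proof -
      have "c * (r powr (- a) * G r + a * \<Phi> r) = g r"
        using K_op[of r] eq[of r] r t g[of r] \<Phi>[of r] by (simp add: \<phi>_def[abs_def])
      then have "r powr (- a) * G r = g r / c - a * \<Phi> r"
        using c by (simp add: field_simps)
      then have "P r = (r powr a * r powr (- a)) * G r"
        by (simp add: P_def mult.assoc)
      then show ?thesis using r by (simp add: powr_add[symmetric])
    qed
    have cont_g: "continuous_on {0..t} g" and cont_\<Phi>: "continuous_on {0..t} \<Phi>"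
      unfolding g_def[abs_def] \<Phi>_def[abs_def] using int_y int_\<phi>
      by (auto intro!: indefinite_integral_continuous_1 set_borel_integral_eq_integral(1))
    have cont_P: "continuous_on {0..t} P"
      unfolding P_def[abs_def] using a c
      by (intro continuous_intros continuous_on_powr' cont_g cont_\<Phi>) auto
    have "((\<lambda>r. r powr a * y r / c) has_integral (P t - P 0)) {0..t}"
    proof (rule fundamental_theorem_of_calculus_interior)
      fix x assume x: "x \<in> {0<..<t}"
      have at: "at x within {0..t} = at x"
        using x by (intro at_within_Icc_at) auto
      have isCont: "isCont h x" if "continuous_on {0..t} h" for h :: "real \<Rightarrow> real"
        using that x unfolding continuous_on_eq_continuous_within at[symmetric] by auto
      have "(g has_vector_derivative y x) (at x)"
        unfolding g_def[abs_def]
        using integral_has_vector_derivative_continuous_at[of y 0 t x "{}"] x isCont[OF cont_y] int_y at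
        by (auto simp: set_borel_integral_eq_integral(1))
      then have dg: "(g has_real_derivative y x) (at x)"
        by (simp add: has_real_derivative_iff_has_vector_derivative)
      have "isCont \<phi> x"
      proof -
        have "isCont (\<lambda>u. u powr (- a - 1) * P u) x"
          using isCont[OF cont_P] x by (auto intro!: continuous_intros)
        moreover have "\<forall>\<^sub>F u in nhds x. u \<in> {0<..<t}"
          using x by (intro eventually_nhds_in_open) auto
        then have "\<forall>\<^sub>F u in nhds x. \<phi> u = u powr (- a - 1) * P u"
          by eventually_elim (simp add: \<phi>_def G_P)
        ultimately show ?thesis by (simp add: isCont_cong)
      qed
      then have "(\<Phi> has_vector_derivative \<phi> x) (at x)"
        unfolding \<Phi>_def[abs_def]
        using integral_has_vector_derivative_continuous_at[of \<phi> 0 t x "{}"] x int_\<phi> at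
        by (auto simp: set_borel_integral_eq_integral(1))
      then have d\<Phi>: "(\<Phi> has_real_derivative \<phi> x) (at x)"
        by (simp add: has_real_derivative_iff_has_vector_derivative)
      have "(P has_real_derivative (a * x powr (a - 1) * (g x / c - a * \<Phi> x) + x powr a * (y x / c - a * \<phi> x))) (at x)"
        unfolding P_def[abs_def] using x c
        by (auto intro!: derivative_eq_intros dg d\<Phi>)
      \<comment> \<open>Substituting \<open>G = P\<close> gives
        \<open>\<phi> x = (g x / c - a * \<Phi> x) / x\<close>, so the derivative of the power
        cancels against the term with \<open>\<phi>\<close>.\<close>
      moreover have "a * x powr (a - 1) * (g x / c - a * \<Phi> x) + x powr a * (y x / c - a * \<phi> x) = x powr a * y x / c"
      proof -
        have "\<phi> x = x powr (- a - 1) * (x powr a * (g x / c - a * \<Phi> x))"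
          using G_P[of x] x by (simp add: \<phi>_def P_def)
        also have "\<dots> = x powr (- 1) * (g x / c - a * \<Phi> x)"
          by (simp add: mult.assoc[symmetric] powr_add[symmetric])
        finally have "x powr a * \<phi> x = (x powr a * x powr (- 1)) * (g x / c - a * \<Phi> x)"
          by (simp only: mult.assoc)
        also have "x powr a * x powr (- 1) = x powr (a - 1)"
          by (subst powr_add[symmetric]) simp
        finally have "x powr a * \<phi> x = x powr (a - 1) * (g x / c - a * \<Phi> x)" .
        moreover have "x powr a * (y x / c - a * \<phi> x) = x powr a * y x / c - a * (x powr a * \<phi> x)"
          by (simp add: right_diff_distrib)
        ultimately show ?thesis by (simp only: mult.assoc)
      qed
      ultimately show "(P has_vector_derivative x powr a * y x / c) (at x)"
        by (simp add: has_real_derivative_iff_has_vector_derivative)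
    qed (use t cont_P in auto)
    then have "integral {0..t} (\<lambda>r. r powr a * y r / c) = P t"
      by (subst integral_unique) (auto simp: P_def)
    moreover have "set_integrable lborel {0..t} (\<lambda>r. r powr a * y r / c)"
      using a c by (intro borel_integrable_atLeastAtMost' continuous_intros continuous_on_powr' cont_y) auto
    ultimately have "(LBINT r:{0..t}. r powr a * y r / c) = P t"
      using set_borel_integral_eq_integral(2) by metis
    then show ?thesis using G_P[OF t0] by simp
  qed
  have "(LBINT u:{0..T}. (T - u) powr (a - 1) * (LBINT r:{0..u}. r powr a * y r)) =
      (LBINT u:{0..T}. c * ((T - u) powr (a - 1) * G u))"
    using c by (intro set_lebesgue_integral_cong) (auto simp: G_eq)
  also have "\<dots> = c * (Beta a (1 - a) * (LBINT s:{0..T}. \<psi> s))"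
    using Abel_inversion[of a \<psi> T] a \<psi> by (simp add: G_def)
  finally show ?thesis
    by (simp add: a_def c_def \<psi>_def)
qed

text \<open>The primitive of \<open>s powr (1/2 - H) * f s\<close> at \<open>T\<close>, expressed by \<open>y\<close>, when the Volterra operator
  maps \<open>f\<close> to the primitive of \<open>y\<close>; it only involves \<open>y\<close> on \<open>{0..T}\<close>.\<close>

definition K_H_primitive :: "real \<Rightarrow> (real \<Rightarrow> real) \<Rightarrow> real \<Rightarrow> real" where
  "K_H_primitive H y T =
     (if H = 1/2 then LBINT u:{0..T}. y u
      else if H > 1/2 then
        (LBINT u:{0..T}. (T - u) powr (1/2 - H) * (u powr (1/2 - H) * y u)) /
        (c_H H * Beta (3/2 - H) (H - 1/2))
      else
        (LBINT u:{0..T}. (T - u) powr (- 1/2 - H) * (LBINT r:{0..u}. r powr (1/2 - H) * y r)) /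
        (c_H H * Beta (1/2 - H) (1/2 + H)))"

text \<open>Applied with \<open>N\<close> the Brownian past, this transfers adaptedness from the
  path of \<open>X\<close> to the primitive. In the rough case the inner integral has to be jointly
  measurable in its upper limit and \<open>\<omega>\<close> before the outer one can be
  treated.\<close>

lemma K_H_primitive_measurable:
  fixes Y :: "real \<Rightarrow> 'b \<Rightarrow> real"
  assumes [measurable]: "(\<lambda>(u, \<omega>). Y u \<omega>) \<in> borel_measurable (borel \<Otimes>\<^sub>M N)"
  shows "(\<lambda>\<omega>. K_H_primitive H (\<lambda>u. Y u \<omega>) T) \<in> borel_measurable N"
proof -
  have [measurable]: "(\<lambda>\<omega>. LBINT u:{0..T}. Y u \<omega>) \<in> borel_measurable N"
    by (rule borel_measurable_LBINT_Icc) measurable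
  have [measurable]: "(\<lambda>\<omega>. LBINT u:{0..T}. (T - u) powr (1/2 - H) * (u powr (1/2 - H) * Y u \<omega>)) \<in> borel_measurable N"
    by (rule borel_measurable_LBINT_Icc) measurable
  have "(\<lambda>x. LBINT r:{0..snd x}. r powr (1/2 - H) * Y r (fst x)) \<in> borel_measurable (N \<Otimes>\<^sub>M borel)"
    by (rule borel_measurable_LBINT_Icc) measurable
  then have [measurable]: "(\<lambda>(\<omega>, u). LBINT r:{0..u}. r powr (1/2 - H) * Y r \<omega>) \<in> borel_measurable (N \<Otimes>\<^sub>M borel)"
    by (simp add: case_prod_beta')
  have [measurable]: "(\<lambda>\<omega>. LBINT u:{0..T}. (T - u) powr (- (1/2) - H) * (LBINT r:{0..u}. r powr (1/2 - H) * Y r \<omega>)) \<in> borel_measurable N"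
    by (rule borel_measurable_LBINT_Icc) measurable
  show ?thesis
    unfolding K_H_primitive_def by (cases "H = 1/2"; cases "H > 1/2") simp_all
qed

lemma K_H_primitive_cong:
  assumes "\<And>u. u \<in> {0..T} \<Longrightarrow> y u = y' u"
  shows "K_H_primitive H y T = K_H_primitive H y' T"
proof -
  have "(LBINT r:{0..u}. r powr (1/2 - H) * y r) = (LBINT r:{0..u}. r powr (1/2 - H) * y' r)" if "u \<in> {0..T}" for u
    using assms that by (intro set_lebesgue_integral_cong) auto
  moreover have "(LBINT u:{0..T}. y u) = (LBINT u:{0..T}. y' u)"
    using assms by (intro set_lebesgue_integral_cong) auto
  moreover have "(LBINT u:{0..T}. (T - u) powr (1/2 - H) * (u powr (1/2 - H) * y u)) =
      (LBINT u:{0..T}. (T - u) powr (1/2 - H) * (u powr (1/2 - H) * y' u))"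
    using assms by (intro set_lebesgue_integral_cong) auto
  ultimately show ?thesis
    unfolding K_H_primitive_def by (auto intro!: set_lebesgue_integral_cong)
qed

text \<open>The Volterra inverse is regular only on the open half-line, and powers of
  \<open>0\<close> take conventional values; both effects are confined to one point.\<close>

lemma LBINT_cong_except_0:
  fixes g h :: "real \<Rightarrow> real"
  assumes "\<And>s. s \<in> A \<Longrightarrow> s \<noteq> 0 \<Longrightarrow> g s = h s"
  shows "(LBINT s:A. g s) = (LBINT s:A. h s)" and "set_integrable lborel A g \<longleftrightarrow> set_integrable lborel A h"
  unfolding set_lebesgue_integral_def set_integrable_def
  by (rule integral_discrete_difference[of "{0}"] integrable_discrete_difference[of "{0}"];
      use assms in \<open>auto simp: indicator_def\<close>)+

lemma K_inverse_primitive: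
  assumes H: "0 < H" "H < 1" and f: "is_K_inverse H (\<lambda>t. LBINT r:{0..t}. y r) f"
    and y: "continuous_on {0..} y" and T: "0 \<le> T"
  shows "(LBINT s:{0..T}. s powr (1/2 - H) * f s) = K_H_primitive H y T"
    and "set_integrable lborel {0..T} (\<lambda>s. s powr (1/2 - H) * f s)"
proof -
  \<comment> \<open>Continuity on \<open>{0<..}\<close> makes this cut-off Borel on the whole line.
    On \<open>{0..}\<close> it differs from \<open>f\<close> at \<open>0\<close> at most, which no
    integral below notices.\<close>
  define f' where "f' s = indicator {0<..} s *\<^sub>R f s" for s
  have f': "0 \<le> s \<Longrightarrow> s \<noteq> 0 \<Longrightarrow> f' s = f s" for s
    by (simp add: f'_def)
  have [measurable]: "f' \<in> borel_measurable borel"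
    unfolding f'_def[abs_def] using f
    by (intro borel_measurable_continuous_on_indicator) (auto simp: is_K_inverse_def)
  have f'2: "set_integrable lborel {0..T} (\<lambda>s. (f' s)\<^sup>2)"
    using f T LBINT_cong_except_0(2)[of "{0..T}" "\<lambda>s. (f' s)\<^sup>2" "\<lambda>s. (f s)\<^sup>2"] by (simp add: is_K_inverse_def f')
  have eq: "K_op H f' t = (LBINT u:{0..t}. y u)" if "0 \<le> t" for t
    using f that LBINT_cong_except_0(1)[of "{0..t}" "\<lambda>s. K_H H t s * f' s" "\<lambda>s. K_H H t s * f s"]
    by (simp add: is_K_inverse_def f' K_op_def)
  have yT: "continuous_on {0..T} y"
    using y by (rule continuous_on_subset) auto
  have F: "(LBINT s:{0..T}. s powr (1/2 - H) * f s) = (LBINT s:{0..T}. s powr (1/2 - H) * f' s)"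
    by (rule LBINT_cong_except_0) (simp add: f'_def)
  have "set_integrable lborel {0..T} (\<lambda>s. s powr (1/2 - H) * f' s)"
    using H f'2 by (intro set_integrable_powr_mult) auto
  then show "set_integrable lborel {0..T} (\<lambda>s. s powr (1/2 - H) * f s)"
    using LBINT_cong_except_0(2)[of "{0..T}" "\<lambda>s. s powr (1/2 - H) * f' s" "\<lambda>s. s powr (1/2 - H) * f s"] by (simp add: f')
  consider "H = 1/2" | "1/2 < H" | "H < 1/2" by linarith
  then show "(LBINT s:{0..T}. s powr (1/2 - H) * f s) = K_H_primitive H y T"
  proof cases
    case 1
    \<comment> \<open>The weight has exponent \<open>0\<close> here, yet \<open>0 powr 0\<close> is
      \<open>0\<close>, so the integrands may differ at \<open>s = 0\<close>.\<close>
    have "(LBINT s:{0..T}. s powr (1/2 - H) * f' s) = (LBINT s:{0..T}. K_H H T s * f' s)"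
      by (rule LBINT_cong_except_0) (simp add: 1 K_H_def)
    then show ?thesis
      unfolding F K_H_primitive_def using eq[OF T] 1 by (simp only: K_op_def refl if_True)
  next
    case 2
    have "c_H H \<noteq> 0" "Beta (3/2 - H) (H - 1/2) \<noteq> 0"
      using 2 H c_H_pos[of H] Beta_real_pos[of "3/2 - H" "H - 1/2"] by simp_all
    then show ?thesis
      using smooth_kernel_primitive[of H f' T y] 2 H f'2 eq borel_integrable_atLeastAtMost'[OF yT]
      by (simp add: F K_H_primitive_def)
  next
    case 3
    have "c_H H \<noteq> 0" "Beta (1/2 - H) (1/2 + H) \<noteq> 0"
      using 3 H c_H_pos[of H] Beta_real_pos[of "1/2 - H" "1/2 + H"] by simp_all
    then show ?thesis
      using rough_kernel_primitive[of H f' T y] 3 H f'2 eq yT T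
      by (simp add: F K_H_primitive_def)
  qed
qed

text \<open>Continuity at \<open>T\<close> makes the weighted function the derivative of its
  primitive, and dividing by the weight recovers the value at this single time. The times
  \<open>T - T / real (n + 2)\<close> stay in \<open>{0..T}\<close> and differ from
  \<open>T\<close>, so only the past of \<open>T\<close> is consulted.\<close>

lemma primitive_difference_quotient:
  fixes f :: "real \<Rightarrow> real"
  assumes f: "continuous_on {0<..} f" and T: "0 < T"
    and int: "set_integrable lborel {0..T} (\<lambda>s. s powr p * f s)"
    and F: "\<And>t. 0 \<le> t \<Longrightarrow> t \<le> T \<Longrightarrow> (LBINT s:{0..t}. s powr p * f s) = F t"
  shows "(\<lambda>n. T powr (- p) * ((F (T - T / real (n + 2)) - F T) / (T - T / real (n + 2) - T))) \<longlonglongrightarrow> f T"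
proof -
  let ?g = "\<lambda>s. s powr p * f s"
  have F_eq: "F t = integral {0..t} ?g" if "0 \<le> t" "t \<le> T" for t
  proof -
    have "set_integrable lborel {0..t} ?g"
      using int by (rule set_integrable_subset) (use that in auto)
    then show ?thesis
      using F[OF that] set_borel_integral_eq_integral(2) by metis
  qed
  have "isCont f T"
    using f T by (simp add: continuous_on_eq_continuous_at)
  then have "isCont ?g T"
    using T by (intro continuous_intros) auto
  then have "continuous (at T within {0..T}) ?g"
    by (rule continuous_at_imp_continuous_at_within)
  then have "((\<lambda>u. integral {0..u} ?g) has_vector_derivative ?g T) (at T within {0..T})"
    using integral_has_vector_derivative_continuous_at[of ?g 0 T T "{}"] T set_borel_integral_eq_integral(1)[OF int]
    by simp
  then have "((\<lambda>t. (integral {0..t} ?g - integral {0..T} ?g) / (t - T)) \<longlongrightarrow> ?g T) (at T within {0..T})"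
    by (simp add: has_real_derivative_iff_has_vector_derivative[symmetric] has_field_derivative_iff)
  moreover have step: "0 < T / real (n + 2)" "T / real (n + 2) \<le> T" for n
    using T mult_left_mono[of 1 "real (n + 2)" T] by (auto simp: divide_le_eq)
  have "filterlim (\<lambda>n. T - T / real (n + 2)) (at T within {0..T}) sequentially"
    unfolding filterlim_at
  proof
    show "\<forall>\<^sub>F n in sequentially. T - T / real (n + 2) \<in> {0..T} \<and> T - T / real (n + 2) \<noteq> T"
    proof (intro always_eventually allI)
      fix n show "T - T / real (n + 2) \<in> {0..T} \<and> T - T / real (n + 2) \<noteq> T"
        using step[of n] by (simp del: of_nat_add)
    qed
    have "(\<lambda>n. T / real (n + 2)) \<longlonglongrightarrow> 0"
      by (intro LIMSEQ_ignore_initial_segment lim_const_over_n)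
    then have "(\<lambda>n. T - T / real (n + 2)) \<longlonglongrightarrow> T - 0"
      by (intro tendsto_diff tendsto_const)
    then show "(\<lambda>n. T - T / real (n + 2)) \<longlonglongrightarrow> T" by simp
  qed
  ultimately have "(\<lambda>n. (integral {0..T - T / real (n + 2)} ?g - integral {0..T} ?g) / (T - T / real (n + 2) - T)) \<longlonglongrightarrow> ?g T"
    by (rule filterlim_compose)
  moreover have "integral {0..T - T / real (n + 2)} ?g = F (T - T / real (n + 2))" for n
    using step[of n] by (intro F_eq[symmetric]) (simp_all del: of_nat_add)
  moreover have "integral {0..T} ?g = F T"
    using T by (intro F_eq[symmetric]) auto
  ultimately have "(\<lambda>n. (F (T - T / real (n + 2)) - F T) / (T - T / real (n + 2) - T)) \<longlonglongrightarrow> ?g T"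
    by simp
  then have "(\<lambda>n. T powr (- p) * ((F (T - T / real (n + 2)) - F T) / (T - T / real (n + 2) - T))) \<longlonglongrightarrow> T powr (- p) * ?g T"
    by (intro tendsto_mult tendsto_const)
  moreover have "T powr (- p) * ?g T = f T"
    using T by (simp add: mult.assoc[symmetric] powr_add[symmetric])
  ultimately show ?thesis by simp
qed

section \<open>Adaptedness of the solution and of its Volterra inverse\<close>

lemma LBINT_eq_integral_continuous:
  fixes h :: "real \<Rightarrow> real"
  assumes "continuous_on {a..b} h"
  shows "(LBINT s:{a..b}. h s) = integral {a..b} h"
  by (intro set_borel_integral_eq_integral(2) borel_integrable_atLeastAtMost' assms)

text \<open>The noise is additive and enters by its exact increments, so only the drift is
  discretised. The value with index \<open>k\<close> approximates the solution at time
  \<open>k / N\<close>.\<close>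

fun euler :: "(real \<Rightarrow> real) \<Rightarrow> real \<Rightarrow> (real \<Rightarrow> real) \<Rightarrow> nat \<Rightarrow> nat \<Rightarrow> real" where
  "euler b \<theta> B N 0 = 0"
| "euler b \<theta> B N (Suc k) = euler b \<theta> B N k + \<theta> * b (euler b \<theta> B N k) / real N
     + (B (real (Suc k) / real N) - B (real k / real N))"

text \<open>The increments of \<open>B\<close> cancel between scheme and solution, so no regularity
  of \<open>B\<close> beyond the equation enters. The remaining drift error is controlled by a
  discrete Gronwall estimate driven by the modulus of continuity of \<open>x\<close>.\<close>

lemma euler_converges:
  fixes x B b :: "real \<Rightarrow> real"
  assumes lip: "\<And>u v. \<bar>b u - b v\<bar> \<le> L * \<bar>u - v\<bar>"
    and x: "continuous_on {0..} x" "x 0 = 0" and b: "continuous_on UNIV b"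
    and eq: "\<And>t. 0 \<le> t \<Longrightarrow> x t = \<theta> * (LBINT s:{0..t}. b (x s)) + B t"
    and t: "0 \<le> t"
  shows "(\<lambda>N. euler b \<theta> B (Suc N) (nat \<lfloor>t * real (Suc N)\<rfloor>)) \<longlonglongrightarrow> x t"
proof -
  define A where "A = \<bar>\<theta>\<bar> * L"
  have L: "0 \<le> L" using order.trans[OF abs_ge_zero lip[of 1 0]] by simp
  then have A: "0 \<le> A" by (simp add: A_def)
  have cont_bx: "continuous_on {r..s} (\<lambda>u. b (x u))" if "0 \<le> r" for r s
    by (rule continuous_on_compose2[OF b continuous_on_subset[OF x(1)]]) (use that in auto)
  have incr: "x s - x r = \<theta> * integral {r..s} (\<lambda>u. b (x u)) + (B s - B r)" if "0 \<le> r" "r \<le> s" for r s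
  proof -
    have "integral {0..r} (\<lambda>u. b (x u)) + integral {r..s} (\<lambda>u. b (x u)) = integral {0..s} (\<lambda>u. b (x u))"
      using that by (intro Henstock_Kurzweil_Integration.integral_combine integrable_continuous_real cont_bx) auto
    then show ?thesis
      using eq[of r] eq[of s] that by (simp add: LBINT_eq_integral_continuous cont_bx algebra_simps) (simp add: distrib_left[symmetric])
  qed
  \<comment> \<open>In one step the drift argument is off by at most \<open>\<epsilon>\<close> plus
    the current error. Adding \<open>\<epsilon>\<close> to the error makes the recursion
    homogeneous, with factor \<open>1 + A / real N\<close>.\<close>
  have error: "\<bar>euler b \<theta> B N k - x (real k / real N)\<bar> + \<epsilon> \<le> \<epsilon> * (1 + A / real N) ^ k"
    if N: "0 < N" and \<epsilon>: "0 < \<epsilon>" and k: "real k / real N \<le> t"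
      and mod: "\<And>u v. u \<in> {0..t} \<Longrightarrow> v \<in> {0..t} \<Longrightarrow> \<bar>u - v\<bar> \<le> 1 / real N \<Longrightarrow> \<bar>x u - x v\<bar> \<le> \<epsilon>" for N k \<epsilon>
    using k
  proof (induction k)
    case 0
    then show ?case by (simp add: x)
  next
    case (Suc k)
    define r s where "r = real k / real N" and "s = real (Suc k) / real N"
    define z where "z = euler b \<theta> B N k"
    define e where "e = \<bar>z - x r\<bar>"
    have rs: "0 \<le> r" "r \<le> s" "s \<le> t" "s - r = 1 / real N"
      using Suc.prems N by (auto simp: r_def s_def divide_simps)
    have bound: "norm (integral {r..s} (\<lambda>u. b (x u) - b z)) \<le> L * (\<epsilon> + e) * (s - r)"
    proof (rule integral_bound)
      show "continuous_on {r..s} (\<lambda>u. b (x u) - b z)"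
        by (intro continuous_on_diff cont_bx continuous_on_const rs)
      fix u assume u: "u \<in> {r..s}"
      have "\<bar>x u - x r\<bar> \<le> \<epsilon>"
        using u rs by (intro mod) auto
      then have "\<bar>x u - z\<bar> \<le> \<epsilon> + e" by (simp add: e_def)
      then have "L * \<bar>x u - z\<bar> \<le> L * (\<epsilon> + e)" using L by (rule mult_left_mono)
      then show "norm (b (x u) - b z) \<le> L * (\<epsilon> + e)"
        using lip[of "x u" z] by simp
    qed (use rs in auto)
    have "integral {r..s} (\<lambda>u. b (x u) - b z) = integral {r..s} (\<lambda>u. b (x u)) - b z * (s - r)"
      using rs by (subst Henstock_Kurzweil_Integration.integral_diff)
        (auto intro!: integrable_continuous_real cont_bx)
    then have int: "integral {r..s} (\<lambda>u. b (x u)) = integral {r..s} (\<lambda>u. b (x u) - b z) + b z / real N"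
      using rs by simp
    have "euler b \<theta> B N (Suc k) - x s = (z - x r) - \<theta> * integral {r..s} (\<lambda>u. b (x u) - b z)"
      using incr[of r s] rs int
      by (simp add: z_def r_def s_def algebra_simps add_divide_distrib)
    then have "\<bar>euler b \<theta> B N (Suc k) - x s\<bar> \<le> e + \<bar>\<theta>\<bar> * \<bar>integral {r..s} (\<lambda>u. b (x u) - b z)\<bar>"
      using abs_triangle_ineq4[of "z - x r" "\<theta> * integral {r..s} (\<lambda>u. b (x u) - b z)"]
      by (simp add: e_def abs_mult)
    also have "\<dots> \<le> e + \<bar>\<theta>\<bar> * (L * (\<epsilon> + e) * (s - r))"
      using bound by (intro add_left_mono mult_left_mono) auto
    also have "\<dots> = e + A / real N * (\<epsilon> + e)"
      by (simp add: rs A_def)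
    finally have "\<bar>euler b \<theta> B N (Suc k) - x s\<bar> + \<epsilon> \<le> (e + \<epsilon>) * (1 + A / real N)"
      by (simp add: algebra_simps)
    also have "\<dots> \<le> \<epsilon> * (1 + A / real N) ^ k * (1 + A / real N)"
      using Suc.IH rs A by (intro mult_right_mono) (auto simp: e_def z_def r_def s_def)
    finally show ?case by (simp add: s_def mult_ac)
  qed
  show ?thesis
  proof (rule LIMSEQ_I)
    fix \<eta> :: real assume \<eta>: "0 < \<eta>"
    \<comment> \<open>The grid error costs at most \<open>\<epsilon> * exp (A * t)\<close> and
      rounding \<open>t\<close> down to the grid another \<open>\<epsilon>\<close>; together this is
      half of \<open>\<eta>\<close>.\<close>
    define \<epsilon> where "\<epsilon> = \<eta> / (2 * (exp (A * t) + 1))"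
    have \<epsilon>: "0 < \<epsilon>" "\<epsilon> * (exp (A * t) + 1) < \<eta>"
    proof -
      have E: "0 < exp (A * t) + 1" by (simp add: add_pos_pos)
      then have "\<epsilon> * (exp (A * t) + 1) = \<eta> / 2"
        unfolding \<epsilon>_def by (subst times_divide_eq_left, subst frac_eq_eq) auto
      then show "\<epsilon> * (exp (A * t) + 1) < \<eta>" using \<eta> by simp
      show "0 < \<epsilon>" unfolding \<epsilon>_def using E \<eta> by (intro divide_pos_pos mult_pos_pos) auto
    qed
    have "uniformly_continuous_on {0..t} x"
      by (intro compact_uniformly_continuous continuous_on_subset[OF x(1)]) auto
    then obtain d where d: "0 < d" "\<And>u v. u \<in> {0..t} \<Longrightarrow> v \<in> {0..t} \<Longrightarrow> \<bar>u - v\<bar> < d \<Longrightarrow> \<bar>x u - x v\<bar> < \<epsilon>"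
      unfolding uniformly_continuous_on_def dist_real_def using \<epsilon>(1) by (metis abs_minus_commute)
    obtain N0 where N0: "1 / real (Suc N0) < d"
      using d(1) nat_approx_posE by blast
    show "\<exists>no. \<forall>n\<ge>no. norm (euler b \<theta> B (Suc n) (nat \<lfloor>t * real (Suc n)\<rfloor>) - x t) < \<eta>"
    proof (intro exI[of _ N0] allI impI)
      fix n assume n: "N0 \<le> n"
      define N where "N = Suc n"
      define k where "k = nat \<lfloor>t * real N\<rfloor>"
      have N: "0 < N" by (simp add: N_def)
      have small: "1 / real N < d"
        using n N0 by (smt (verit) N_def frac_le of_nat_0_less_iff of_nat_le_iff not_less_eq_eq Suc_le_mono zero_less_Suc)
      have "real k \<le> t * real N"
        unfolding k_def using t by simp
      moreover have "t * real N < real k + 1"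
        unfolding k_def by linarith
      ultimately have k: "real k / real N \<le> t" "t - real k / real N < 1 / real N"
        using N pos_less_divide_eq[of "real N" t "real k + 1"]
        by (auto simp: divide_le_eq add_divide_distrib)
      have mod: "\<bar>x u - x v\<bar> \<le> \<epsilon>" if "u \<in> {0..t}" "v \<in> {0..t}" "\<bar>u - v\<bar> \<le> 1 / real N" for u v
        using d(2)[of u v] that small by auto
      have "(1 + A / real N) ^ k \<le> exp (A / real N) ^ k"
        using A by (intro power_mono) (auto simp: exp_ge_add_one_self)
      also have "\<dots> = exp (A * (real k / real N))"
        by (simp add: exp_of_nat_mult[symmetric] mult_ac)
      also have "\<dots> \<le> exp (A * t)"
        using mult_left_mono[OF k(1) A] by (simp only: exp_le_cancel_iff)
      finally have "\<epsilon> * (1 + A / real N) ^ k \<le> \<epsilon> * exp (A * t)"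
        using \<epsilon> by (intro mult_left_mono) auto
      then have "\<bar>euler b \<theta> B N k - x (real k / real N)\<bar> \<le> \<epsilon> * exp (A * t)"
        using error[OF N \<epsilon>(1) k(1) mod] \<epsilon>(1) by linarith
      moreover have "\<bar>x (real k / real N) - x t\<bar> \<le> \<epsilon>"
        using k t by (intro mod) auto
      ultimately have "\<bar>euler b \<theta> B N k - x t\<bar> \<le> \<epsilon> * (exp (A * t) + 1)"
        by (simp add: distrib_left)
      then show "norm (euler b \<theta> B (Suc n) (nat \<lfloor>t * real (Suc n)\<rfloor>) - x t) < \<eta>"
        using \<epsilon>(2) by (simp add: N_def[symmetric] k_def[symmetric])
    qed
  qed
qed

section \<open>Measurability of the solution and of its Volterra inverse with respect to the
  past\<close>

context brownian_motion
begin

lemma adapted_euler: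
  assumes B: "\<And>t. 0 \<le> t \<Longrightarrow> t \<le> real m \<Longrightarrow> adapted m (B t)" and b: "b \<in> borel_measurable borel"
    and "real k / real N \<le> real m" "0 < N"
  shows "adapted m (\<lambda>\<omega>. euler b \<theta> (\<lambda>t. B t \<omega>) N k)"
  using assms(3)
proof (induction k)
  case 0
  then show ?case by (simp add: adapted_const)
next
  case (Suc k)
  have k: "real k / real N \<le> real m"
    by (rule order.trans[OF _ Suc.prems]) (use assms(4) in \<open>simp add: divide_right_mono\<close>)
  have "adapted m (\<lambda>\<omega>. (\<lambda>x. x + \<theta> * b x / real N) (euler b \<theta> (\<lambda>t. B t \<omega>) N k))"
    by (rule adapted_compose[OF Suc.IH[OF k]]) (use b in measurable)
  moreover have "adapted m (\<lambda>\<omega>. B (real (Suc k) / real N) \<omega> - B (real k / real N) \<omega>)"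
    using B k Suc.prems by (intro adapted_diff) auto
  ultimately show ?case
    by (auto dest: adapted_add)
qed

text \<open>Every solution path is the limit of the Euler schemes driven by its own noise path, and
  the scheme for time \<open>t\<close> uses the noise at finitely many times up to \<open>t\<close>
  only.\<close>

lemma adapted_SDE_solution:
  assumes B: "\<And>t. 0 \<le> t \<Longrightarrow> t \<le> real m \<Longrightarrow> adapted m (B t)"
    and lip: "\<And>u v. \<bar>b u - b v\<bar> \<le> L * \<bar>u - v\<bar>" and b: "continuous_on UNIV b"
    and X: "AE \<omega> in M. continuous_on {0..} (\<lambda>t. X t \<omega>) \<and> X 0 \<omega> = 0 \<and>
              (\<forall>t\<ge>0. X t \<omega> = \<theta> * (LBINT s:{0..t}. b (X s \<omega>)) + B t \<omega>)"
    and t: "0 \<le> t" "t \<le> real m"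
  shows "adapted m (X t)"
proof (rule adapted_limit)
  fix N
  have "real (nat \<lfloor>t * real (Suc N)\<rfloor>) \<le> t * real (Suc N)"
    using t(1) by simp
  then have "real (nat \<lfloor>t * real (Suc N)\<rfloor>) / real (Suc N) \<le> t"
    by (simp add: divide_le_eq)
  then show "adapted m (\<lambda>\<omega>. euler b \<theta> (\<lambda>t. B t \<omega>) (Suc N) (nat \<lfloor>t * real (Suc N)\<rfloor>))"
    using t by (intro adapted_euler B borel_measurable_continuous_onI b) auto
next
  show "AE \<omega> in M. (\<lambda>N. euler b \<theta> (\<lambda>t. B t \<omega>) (Suc N) (nat \<lfloor>t * real (Suc N)\<rfloor>)) \<longlonglongrightarrow> X t \<omega>"
    using X
  proof eventually_elim
    case (elim \<omega>)
    then show ?case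
      by (intro euler_converges[OF lip _ _ b _ t(1)]) auto
  qed
qed

text \<open>Path integrals need one version jointly measurable in time and \<open>\<omega>\<close>,
  with a common exceptional set for all times. It is the limit of piecewise constant interpolations
  of versions at grid points: these involve countably many times, and path continuity covers the
  others.\<close>

lemma adapted_continuous_version:
  assumes X: "\<And>t. 0 \<le> t \<Longrightarrow> t \<le> real m \<Longrightarrow> adapted m (X t)"
    and cont: "AE \<omega> in M. continuous_on {0..} (\<lambda>t. X t \<omega>)"
  obtains X' where "(\<lambda>(t, \<omega>). X' t \<omega>) \<in> borel_measurable (borel \<Otimes>\<^sub>M past m)"
    and "AE \<omega> in M. \<forall>t\<in>{0..real m}. X t \<omega> = X' t \<omega>"
proof -
  \<comment> \<open>The condition is void for grid times beyond \<open>m\<close>, where the constant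
    \<open>0\<close> is a witness, so versions can be chosen for all indices at once.\<close>
  define P where "P N i Y \<longleftrightarrow> Y \<in> borel_measurable (past m) \<and>
    (real i / real (Suc N) \<le> real m \<longrightarrow> (AE \<omega> in M. X (real i / real (Suc N)) \<omega> = Y \<omega>))" for N i Y
  have "\<exists>Y. P N i Y" for N i
  proof (cases "real i / real (Suc N) \<le> real m")
    case True
    have "adapted m (X (real i / real (Suc N)))"
      by (rule X[OF _ True]) simp
    then show ?thesis unfolding adapted_def P_def by blast
  next
    case False
    then have "P N i (\<lambda>_. 0)" by (simp add: P_def)
    then show ?thesis by (intro exI[of "P N i" "\<lambda>_. 0"])
  qed
  then have "\<exists>Y. \<forall>N i. P N i (Y N i)" by metis
  then obtain Y where Y: "P N i (Y N i)" for N i by blast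
  have Y_meas[measurable]: "Y N i \<in> borel_measurable (past m)" for N i
    using Y[of N i] by (simp add: P_def)
  have Y_eq: "AE \<omega> in M. X (real i / real (Suc N)) \<omega> = Y N i \<omega>" if "real i / real (Suc N) \<le> real m" for N i
    using Y[of N i] that by (simp add: P_def)
  define Z where "Z N t \<omega> = Y N (nat \<lfloor>t * real (Suc N)\<rfloor>) \<omega>" for N t \<omega>
  have Z: "(\<lambda>(t, \<omega>). Z N t \<omega>) \<in> borel_measurable (borel \<Otimes>\<^sub>M past m)" for N
  proof -
    have "(\<lambda>x. Y N (nat \<lfloor>fst x * real (Suc N)\<rfloor>) (snd x)) \<in> borel_measurable (borel \<Otimes>\<^sub>M past m)"
    proof (rule measurable_compose_countable[where g = "\<lambda>x. nat \<lfloor>fst x * real (Suc N)\<rfloor>"])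
      show "(\<lambda>x. Y N i (snd x)) \<in> borel_measurable (borel \<Otimes>\<^sub>M past m)" for i by measurable
      show "(\<lambda>x. nat \<lfloor>fst x * real (Suc N)\<rfloor>) \<in> (borel \<Otimes>\<^sub>M past m) \<rightarrow>\<^sub>M count_space UNIV" by measurable
    qed
    then show ?thesis by (simp add: Z_def case_prod_beta')
  qed
  show ?thesis
  proof
    show "(\<lambda>(t, \<omega>). lim (\<lambda>N. Z N t \<omega>)) \<in> borel_measurable (borel \<Otimes>\<^sub>M past m)"
      using borel_measurable_lim_metric[OF Z] by (simp add: case_prod_beta')
    have "AE \<omega> in M. \<forall>N i. real i / real (Suc N) \<le> real m \<longrightarrow> X (real i / real (Suc N)) \<omega> = Y N i \<omega>"
      using Y_eq by (simp add: AE_all_countable)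
    with cont show "AE \<omega> in M. \<forall>t\<in>{0..real m}. X t \<omega> = lim (\<lambda>N. Z N t \<omega>)"
    proof eventually_elim
      case (elim \<omega>)
      show ?case
      proof
        fix t assume t: "t \<in> {0..real m}"
        define r where "r N = real (nat \<lfloor>t * real (Suc N)\<rfloor>) / real (Suc N)" for N
        have r_le: "r N \<le> t" for N
        proof -
          have "real (nat \<lfloor>t * real (Suc N)\<rfloor>) \<le> t * real (Suc N)" using t by simp
          then show ?thesis by (simp add: r_def divide_le_eq)
        qed
        have r_ge: "t - 1 / real (Suc N) \<le> r N" for N
        proof -
          have "t * real (Suc N) - 1 \<le> real (nat \<lfloor>t * real (Suc N)\<rfloor>)" by linarith
          then have "(t * real (Suc N) - 1) / real (Suc N) \<le> r N"
            unfolding r_def by (intro divide_right_mono) auto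
          then show ?thesis by (simp add: diff_divide_distrib)
        qed
        have "r \<longlonglongrightarrow> t"
        proof (rule tendsto_sandwich)
          have "(\<lambda>N. 1 / real (Suc N)) \<longlonglongrightarrow> 0"
            using LIMSEQ_inverse_real_of_nat by (simp add: inverse_eq_divide)
          then have "(\<lambda>N. t - 1 / real (Suc N)) \<longlonglongrightarrow> t - 0"
            by (intro tendsto_diff tendsto_const)
          then show "(\<lambda>N. t - 1 / real (Suc N)) \<longlonglongrightarrow> t" by simp
        qed (use r_le r_ge in auto)
        moreover have "r N \<in> {0..}" for N by (simp add: r_def)
        ultimately have "(\<lambda>N. X (r N) \<omega>) \<longlonglongrightarrow> X t \<omega>"
          using elim(1) t by (intro continuous_on_tendsto_compose[OF elim(1)]) auto
        moreover have "X (r N) \<omega> = Z N t \<omega>" for N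
        proof -
          have "r N \<le> real m" using r_le[of N] t by auto
          then show ?thesis using elim(2) unfolding r_def Z_def by blast
        qed
        ultimately show "X t \<omega> = lim (\<lambda>N. Z N t \<omega>)"
          by (simp add: limI)
      qed
    qed
  qed
qed

text \<open>The primitive of the weighted inverse at times up to \<open>m\<close> is an explicit
  functional of the path on \<open>{0..real m}\<close>, and \<open>Q (real m)\<close> is a limit of
  its difference quotients. Since these are formed at positive times, \<open>0 < m\<close> is
  assumed.\<close>

lemma adapted_K_inverse:
  assumes H: "0 < H" "H < 1"
    and X: "\<And>t. 0 \<le> t \<Longrightarrow> t \<le> real m \<Longrightarrow> adapted m (X t)"
    and cont: "AE \<omega> in M. continuous_on {0..} (\<lambda>t. X t \<omega>)"
    and b: "continuous_on UNIV b"
    and Q: "AE \<omega> in M. is_K_inverse H (\<lambda>t. LBINT r:{0..t}. b (X r \<omega>)) (\<lambda>t. Q t \<omega>)"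
    and m: "0 < m"
  shows "adapted m (Q (real m))"
proof -
  obtain X' where X'[measurable]: "(\<lambda>(t, \<omega>). X' t \<omega>) \<in> borel_measurable (borel \<Otimes>\<^sub>M past m)"
    and X_eq: "AE \<omega> in M. \<forall>t\<in>{0..real m}. X t \<omega> = X' t \<omega>"
    using adapted_continuous_version[OF X cont] by blast
  have [measurable]: "b \<in> borel_measurable borel"
    using b by (rule borel_measurable_continuous_onI)
  define F where "F \<omega> t = K_H_primitive H (\<lambda>u. b (X' u \<omega>)) t" for \<omega> t
  have F[measurable]: "(\<lambda>\<omega>. F \<omega> t) \<in> borel_measurable (past m)" for t
    unfolding F_def by (rule K_H_primitive_measurable) measurable
  let ?D = "\<lambda>n \<omega>. real m powr (- (1/2 - H)) * ((F \<omega> (real m - real m / real (n + 2)) - F \<omega> (real m)) / (real m - real m / real (n + 2) - real m))"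
  show ?thesis
  proof (rule adapted_limit)
    show "adapted m (?D n)" for n
      by (rule adaptedI[of "?D n"]) measurable
    show "AE \<omega> in M. (\<lambda>n. ?D n \<omega>) \<longlonglongrightarrow> Q (real m) \<omega>"
      using X_eq cont Q
    proof eventually_elim
      case (elim \<omega>)
      have y: "continuous_on {0..} (\<lambda>t. b (X t \<omega>))"
        by (rule continuous_on_compose2[OF b elim(2)]) auto
      show ?case
      proof (rule primitive_difference_quotient)
        show "continuous_on {0<..} (\<lambda>t. Q t \<omega>)"
          using elim(3) by (simp add: is_K_inverse_def)
        show "set_integrable lborel {0..real m} (\<lambda>s. s powr (1/2 - H) * Q s \<omega>)"
          by (rule K_inverse_primitive(2)[OF H elim(3) y]) simp
        fix t assume t: "0 \<le> t" "t \<le> real m"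
        have "(LBINT s:{0..t}. s powr (1/2 - H) * Q s \<omega>) = K_H_primitive H (\<lambda>t. b (X t \<omega>)) t"
          by (rule K_inverse_primitive(1)[OF H elim(3) y t(1)])
        also have "\<dots> = F \<omega> t"
          unfolding F_def using elim(1) t by (intro K_H_primitive_cong) auto
        finally show "(LBINT s:{0..t}. s powr (1/2 - H) * Q s \<omega>) = F \<omega> t" .
      qed (use m in simp)
    qed
  qed
qed

end

section \<open>Consistency of the estimator\<close>

text \<open>On a bounded interval square integrability implies integrability, here as the case of
  weight exponent \<open>0\<close>; the shifted square is then expanded.\<close>

lemma set_integrable_from_square:
  fixes f :: "real \<Rightarrow> real"
  assumes f: "continuous_on {0<..} f" and f2: "\<forall>t\<ge>0. set_integrable lborel {0..t} (\<lambda>s. (f s)\<^sup>2)"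
    and r: "0 \<le> r"
  shows "set_integrable lborel {r..t} f" and "set_integrable lborel {r..t} (\<lambda>s. (f s - c)\<^sup>2)"
proof -
  define f' where "f' s = indicator {0<..} s *\<^sub>R f s" for s
  have f': "0 \<le> s \<Longrightarrow> s \<noteq> 0 \<Longrightarrow> f' s = f s" for s
    by (simp add: f'_def)
  have [measurable]: "f' \<in> borel_measurable borel"
    unfolding f'_def[abs_def] using f by (intro borel_measurable_continuous_on_indicator) auto
  have sub: "{r..t} \<subseteq> {0..max t 0}" using r by auto
  have "set_integrable lborel {0..max t 0} (\<lambda>s. (f s)\<^sup>2)" using f2 by simp
  then have f2': "set_integrable lborel {r..t} (\<lambda>s. (f s)\<^sup>2)"
    by (rule set_integrable_subset) (use sub in auto)
  have "set_integrable lborel {0..max t 0} (\<lambda>s. (f' s)\<^sup>2)"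
    using \<open>set_integrable lborel {0..max t 0} (\<lambda>s. (f s)\<^sup>2)\<close>
      LBINT_cong_except_0(2)[of "{0..max t 0}" "\<lambda>s. (f' s)\<^sup>2" "\<lambda>s. (f s)\<^sup>2"] by (simp add: f')
  then have "set_integrable lborel {0..max t 0} (\<lambda>s. s powr 0 * f' s)"
    by (intro set_integrable_powr_mult) auto
  then have "set_integrable lborel {0..max t 0} f"
    using LBINT_cong_except_0(2)[of "{0..max t 0}" "\<lambda>s. s powr 0 * f' s" f] by (simp add: f')
  then show f1: "set_integrable lborel {r..t} f"
    by (rule set_integrable_subset) (use sub in auto)
  have "set_integrable lborel {r..t} (\<lambda>s. (f s)\<^sup>2 - 2 * c * f s + c\<^sup>2)"
    by (intro set_integral_add set_integral_diff set_integrable_mult_right f2' f1 borel_integrable_atLeastAtMost' continuous_on_const)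
  then show "set_integrable lborel {r..t} (\<lambda>s. (f s - c)\<^sup>2)"
    by (simp add: power2_diff algebra_simps)
qed

text \<open>The variance of \<open>e\<close> on an interval of length 1 is nonnegative; unit length
  is what makes the constant integrate to itself.\<close>

lemma power2_LBINT_unit_le:
  fixes e :: "real \<Rightarrow> real"
  assumes e: "set_integrable lborel {r..r + 1} e" and e2: "set_integrable lborel {r..r + 1} (\<lambda>s. (e s)\<^sup>2)"
  shows "(LBINT s:{r..r + 1}. e s)\<^sup>2 \<le> (LBINT s:{r..r + 1}. (e s)\<^sup>2)"
proof -
  define a where "a = (LBINT s:{r..r + 1}. e s)"
  have const: "set_integrable lborel {r..r + 1} (\<lambda>_. a\<^sup>2)" "(LBINT s:{r..r + 1}. a\<^sup>2) = a\<^sup>2"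
    by (simp_all add: set_integrable_def set_lebesgue_integral_def)
  have "0 \<le> (LBINT s:{r..r + 1}. (e s - a)\<^sup>2)"
    by (simp add: set_lebesgue_integral_def)
  also have "(LBINT s:{r..r + 1}. (e s - a)\<^sup>2) = (LBINT s:{r..r + 1}. (e s)\<^sup>2 - 2 * a * e s + a\<^sup>2)"
    by (simp add: power2_diff algebra_simps)
  also have "\<dots> = (LBINT s:{r..r + 1}. (e s)\<^sup>2) - 2 * a * a + a\<^sup>2"
    using e e2 const by (simp add: set_integral_add(2) set_integral_diff a_def)
  finally show ?thesis
    by (simp add: a_def power2_eq_square)
qed

lemma LBINT_abs_diff_square_nonneg: "0 \<le> (LBINT s:A. \<bar>f s - c\<bar>\<^sup>2)" for f :: "real \<Rightarrow> real"
  by (simp add: set_lebesgue_integral_def)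

text \<open>If the sum of squares stayed bounded, the error term, which increases in \<open>n\<close>, would tend to \<open>0\<close> and
  hence vanish; \<open>Q\<close> would then be constant on each unit interval, hence identically \<open>0\<close>.\<close>

lemma qv_B_tendsto_at_top:
  assumes Q: "continuous_on {0<..} (\<lambda>s. Q s \<omega>)" and Q2: "\<forall>t\<ge>0. set_integrable lborel {0..t} (\<lambda>s. (Q s \<omega>)\<^sup>2)"
    and Q0: "Q 0 \<omega> = 0" and \<alpha>: "0 < \<alpha>"
    and C: "\<forall>\<^sub>F n in sequentially. 0 < qv_B Q n \<omega> \<and> real n powr \<alpha> * (qv_A_minus_B Q n \<omega> / qv_B Q n \<omega>) \<le> C"
  shows "filterlim (\<lambda>n. qv_B Q n \<omega>) at_top sequentially"
proof (rule ccontr)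
  define S where "S n = qv_B Q n \<omega>" for n
  define D where "D n = qv_A_minus_B Q n \<omega>" for n
  assume "\<not> filterlim (\<lambda>n. qv_B Q n \<omega>) at_top sequentially"
  then obtain Z where Z: "\<not> (\<forall>\<^sub>F n in sequentially. Z \<le> S n)"
    by (auto simp: filterlim_at_top S_def)
  have S_mono: "S n \<le> S k" if "n \<le> k" for n k
    unfolding S_def qv_B_def using that by (intro sum_mono2) auto
  have S_less: "S n < Z" for n
    using Z S_mono unfolding eventually_sequentially by (meson le_less_trans linorder_not_le)
  have D_mono: "D n \<le> D k" if "n \<le> k" for n k
    unfolding D_def qv_A_minus_B_def using that by (intro sum_mono2 LBINT_abs_diff_square_nonneg) auto
  have D_nonneg: "0 \<le> D n" for n
    unfolding D_def qv_A_minus_B_def by (intro sum_nonneg LBINT_abs_diff_square_nonneg)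
  have D_zero: "D n = 0" for n
  proof -
    have "(\<lambda>k. \<bar>C\<bar> * Z * real k powr (- \<alpha>)) \<longlonglongrightarrow> \<bar>C\<bar> * Z * 0"
      by (intro tendsto_mult tendsto_const tendsto_neg_powr filterlim_real_sequentially) (use \<alpha> in auto)
    then have lim: "(\<lambda>k. \<bar>C\<bar> * Z * real k powr (- \<alpha>)) \<longlonglongrightarrow> 0" by simp
    have "\<forall>\<^sub>F k in sequentially. D n \<le> \<bar>C\<bar> * Z * real k powr (- \<alpha>)"
      using C eventually_ge_at_top[of "max n 1"]
    proof eventually_elim
      case (elim k)
      have "D k / S k \<le> C * real k powr (- \<alpha>)"
        using elim by (simp add: S_def D_def powr_minus field_simps)
      then have "D k \<le> C * real k powr (- \<alpha>) * S k"
        using elim by (simp add: S_def divide_le_eq)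
      also have "\<dots> \<le> \<bar>C\<bar> * real k powr (- \<alpha>) * Z"
        using S_less[of k] elim by (intro mult_mono) (auto simp: S_def intro!: mult_right_mono)
      finally show ?case
        using D_mono[of n k] elim by (simp add: mult_ac)
    qed
    then have "D n \<le> 0"
      by (intro LIMSEQ_le_const[OF lim]) (auto simp: eventually_sequentially)
    then show ?thesis using D_nonneg[of n] by simp
  qed
  have step: "Q (real i + 1) \<omega> = Q (real i) \<omega>" for i
  proof -
    let ?g = "\<lambda>s. \<bar>Q s \<omega> - Q (real i) \<omega>\<bar>\<^sup>2"
    have "D (Suc i) = D i + (LBINT s:{real i..real i + 1}. ?g s)"
      by (simp add: D_def qv_A_minus_B_def)
    then have zero: "(LBINT s:{real i..real i + 1}. ?g s) = 0"
      using D_zero by simp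
    have int: "set_integrable lborel {real i..real i + 1} ?g"
      using set_integrable_from_square(2)[OF Q Q2] by simp
    \<comment> \<open>For \<open>i = 0\<close> the left endpoint may be singular for
      \<open>Q\<close>. The right half of the interval avoids it and still contains the endpoint
      \<open>i + 1\<close> at which the value is wanted.\<close>
    have cont: "continuous_on {real i + 1/2..real i + 1} ?g"
      by (intro continuous_intros continuous_on_subset[OF Q]) auto
    have "integral {real i + 1/2..real i + 1} ?g \<le> integral {real i..real i + 1} ?g"
      using set_borel_integral_eq_integral(1)[OF int] integrable_continuous_real[OF cont]
      by (intro integral_subset_le) auto
    also have "\<dots> = 0"
      using zero set_borel_integral_eq_integral(2)[OF int] by simp
    finally have "integral {real i + 1/2..real i + 1} ?g \<le> 0" .
    moreover have "0 \<le> integral {real i + 1/2..real i + 1} ?g"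
      by (rule Henstock_Kurzweil_Integration.integral_nonneg[OF integrable_continuous_real[OF cont]]) simp
    ultimately have "integral {real i + 1/2..real i + 1} ?g = 0" by (rule antisym)
    then have "\<forall>s\<in>{real i + 1/2..real i + 1}. ?g s = 0"
      by (subst (asm) integral_eq_0_iff[OF cont]) auto
    then show ?thesis by simp
  qed
  have "Q (real i) \<omega> = 0" for i
  proof (induction i)
    case (Suc i)
    have "real (Suc i) = real i + 1" by simp
    then show ?case using step[of i] Suc by (simp only:)
  qed (simp add: Q0)
  then have "qv_B Q n \<omega> = 0" for n by (simp add: qv_B_def)
  \<comment> \<open>The clause \<open>0 < qv_B Q n \<omega>\<close> of the hypothesis excludes the
    identically vanishing case.\<close>
  moreover obtain n where "0 < qv_B Q n \<omega>"
    using eventually_happens'[OF sequentially_bot C] by blast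
  ultimately show False by simp
qed

text \<open>Cauchy-Schwarz is used twice: over the sum, and within each unit interval to compare the
  squared mean deviation of \<open>Q\<close> with its mean square deviation.\<close>

lemma drift_error_bound:
  assumes Q: "continuous_on {0<..} (\<lambda>s. Q s \<omega>)" and Q2: "\<forall>t\<ge>0. set_integrable lborel {0..t} (\<lambda>s. (Q s \<omega>)\<^sup>2)"
  shows "\<bar>\<Sum>i<n. Q (real i) \<omega> * (LBINT s:{real i..real i + 1}. Q s \<omega> - Q (real i) \<omega>)\<bar>
    \<le> sqrt (qv_B Q n \<omega> * qv_A_minus_B Q n \<omega>)"
proof -
  define e where "e i = (LBINT s:{real i..real i + 1}. Q s \<omega> - Q (real i) \<omega>)" for i
  have "(\<Sum>i<n. Q (real i) \<omega> * e i)\<^sup>2 \<le> (\<Sum>i<n. (Q (real i) \<omega>)\<^sup>2) * (\<Sum>i<n. (e i)\<^sup>2)"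
    by (rule Cauchy_Schwarz_ineq_sum)
  also have "\<dots> \<le> qv_B Q n \<omega> * qv_A_minus_B Q n \<omega>"
    unfolding qv_B_def qv_A_minus_B_def
  proof (intro mult_mono sum_mono)
    fix i
    have "set_integrable lborel {real i..real i + 1} (\<lambda>s. Q s \<omega> - Q (real i) \<omega>)"
      by (rule set_integral_diff(1)[OF set_integrable_from_square(1)[OF Q Q2]])
        (auto intro: borel_integrable_atLeastAtMost')
    moreover have "set_integrable lborel {real i..real i + 1} (\<lambda>s. (Q s \<omega> - Q (real i) \<omega>)\<^sup>2)"
      using set_integrable_from_square(2)[OF Q Q2] by simp
    ultimately show "(e i)\<^sup>2 \<le> (LBINT s:{real i..real i + 1}. \<bar>Q s \<omega> - Q (real i) \<omega>\<bar>\<^sup>2)"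
      unfolding e_def using power2_LBINT_unit_le by simp
  qed (auto intro!: sum_nonneg)
  finally show ?thesis
    unfolding e_def by (intro real_le_rsqrt) simp
qed

text \<open>The drift over a unit interval is \<open>Q\<close> at the left endpoint plus the mean
  deviation from it; the first part reproduces \<open>\<theta>\<close> exactly. The estimator sums
  through \<open>n\<close> inclusive, hence \<open>Suc n\<close> in the brackets.\<close>

lemma theta_bar_decomposition:
  assumes Q: "continuous_on {0<..} (\<lambda>s. Q s \<omega>)" and Q2: "\<forall>t\<ge>0. set_integrable lborel {0..t} (\<lambda>s. (Q s \<omega>)\<^sup>2)"
    and S: "0 < qv_B Q (Suc n) \<omega>"
  shows "theta_bar Q (Z_process \<theta> W Q) n \<omega> =
    (\<Sum>i<Suc n. Q (real i) \<omega> * (W (real i + 1) \<omega> - W (real i) \<omega>)) / qv_B Q (Suc n) \<omega> + \<theta>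
    + \<theta> * ((\<Sum>i<Suc n. Q (real i) \<omega> * (LBINT s:{real i..real i + 1}. Q s \<omega> - Q (real i) \<omega>)) / qv_B Q (Suc n) \<omega>)"
proof -
  define e where "e i = (LBINT s:{real i..real i + 1}. Q s \<omega> - Q (real i) \<omega>)" for i
  define w where "w i = W (real i + 1) \<omega> - W (real i) \<omega>" for i
  have Z: "Z_process \<theta> W Q (real i + 1) \<omega> - Z_process \<theta> W Q (real i) \<omega> = w i + \<theta> * (e i + Q (real i) \<omega>)" for i
  proof -
    note int = set_integrable_from_square(1)[OF Q Q2]
    have hk: "(LBINT s:{r..t}. Q s \<omega>) = integral {r..t} (\<lambda>s. Q s \<omega>)" "(\<lambda>s. Q s \<omega>) integrable_on {r..t}"
      if "0 \<le> r" for r t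
      using set_borel_integral_eq_integral[OF int[OF that]] by auto
    have "integral {0..real i} (\<lambda>s. Q s \<omega>) + integral {real i..real i + 1} (\<lambda>s. Q s \<omega>) = integral {0..real i + 1} (\<lambda>s. Q s \<omega>)"
      by (intro Henstock_Kurzweil_Integration.integral_combine hk) auto
    then have "(LBINT s:{0..real i + 1}. Q s \<omega>) = (LBINT s:{0..real i}. Q s \<omega>) + (LBINT s:{real i..real i + 1}. Q s \<omega>)"
      by (simp add: hk)
    moreover have "e i = (LBINT s:{real i..real i + 1}. Q s \<omega>) - (LBINT s:{real i..real i + 1}. Q (real i) \<omega>)"
      unfolding e_def by (intro set_integral_diff int borel_integrable_atLeastAtMost' continuous_on_const) simp
    moreover have "(LBINT s:{real i..real i + 1}. Q (real i) \<omega>) = Q (real i) \<omega>"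
      by (simp add: set_lebesgue_integral_def)
    ultimately show ?thesis
      by (simp add: Z_process_def w_def algebra_simps)
  qed
  have "(\<Sum>m=0..n. Q (real m) \<omega> * (Z_process \<theta> W Q (real m + 1) \<omega> - Z_process \<theta> W Q (real m) \<omega>)) =
      (\<Sum>i<Suc n. Q (real i) \<omega> * w i + \<theta> * \<bar>Q (real i) \<omega>\<bar>\<^sup>2 + \<theta> * (Q (real i) \<omega> * e i))"
  proof (rule sum.cong)
    fix i
    show "Q (real i) \<omega> * (Z_process \<theta> W Q (real i + 1) \<omega> - Z_process \<theta> W Q (real i) \<omega>) =
        Q (real i) \<omega> * w i + \<theta> * \<bar>Q (real i) \<omega>\<bar>\<^sup>2 + \<theta> * (Q (real i) \<omega> * e i)"
      unfolding Z by (simp add: power2_eq_square algebra_simps)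
  qed auto
  also have "\<dots> = (\<Sum>i<Suc n. Q (real i) \<omega> * w i) + \<theta> * qv_B Q (Suc n) \<omega> + \<theta> * (\<Sum>i<Suc n. Q (real i) \<omega> * e i)"
    by (simp only: sum.distrib sum_distrib_left[symmetric] qv_B_def)
  finally have num: "(\<Sum>m=0..n. Q (real m) \<omega> * (Z_process \<theta> W Q (real m + 1) \<omega> - Z_process \<theta> W Q (real m) \<omega>)) =
      (\<Sum>i<Suc n. Q (real i) \<omega> * w i) + \<theta> * qv_B Q (Suc n) \<omega> + \<theta> * (\<Sum>i<Suc n. Q (real i) \<omega> * e i)" .
  have den: "(\<Sum>m=0..n. \<bar>Q (real m) \<omega>\<bar>\<^sup>2) = qv_B Q (Suc n) \<omega>"
    unfolding qv_B_def by (intro sum.cong) auto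
  show ?thesis
    unfolding theta_bar_def num den e_def[symmetric] w_def[symmetric]
    using S by (simp add: add_divide_distrib del: sum.lessThan_Suc)
qed

text \<open>Divided by \<open>qv_B\<close>, the drift bound is the square root of the ratio of the
  brackets, at most \<open>sqrt (C * real n powr (- \<alpha>))\<close>. The argument is for a fixed
  path, so \<open>C\<close> may depend on \<open>\<omega>\<close>.\<close>

lemma theta_bar_tendsto:
  assumes Q: "continuous_on {0<..} (\<lambda>s. Q s \<omega>)" and Q2: "\<forall>t\<ge>0. set_integrable lborel {0..t} (\<lambda>s. (Q s \<omega>)\<^sup>2)"
    and \<alpha>: "0 < \<alpha>"
    and C: "\<forall>\<^sub>F n in sequentially. 0 < qv_B Q n \<omega> \<and> real n powr \<alpha> * (qv_A_minus_B Q n \<omega> / qv_B Q n \<omega>) \<le> C"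
    and mart: "(\<lambda>n. (\<Sum>i<n. Q (real i) \<omega> * (W (real i + 1) \<omega> - W (real i) \<omega>)) / qv_B Q n \<omega>) \<longlonglongrightarrow> 0"
  shows "(\<lambda>n. theta_bar Q (Z_process \<theta> W Q) n \<omega>) \<longlonglongrightarrow> \<theta>"
proof -
  let ?S = "\<lambda>n. qv_B Q n \<omega>" and ?D = "\<lambda>n. qv_A_minus_B Q n \<omega>"
  let ?R = "\<lambda>n. \<Sum>i<n. Q (real i) \<omega> * (LBINT s:{real i..real i + 1}. Q s \<omega> - Q (real i) \<omega>)"
  let ?N = "\<lambda>n. (\<Sum>i<n. Q (real i) \<omega> * (W (real i + 1) \<omega> - W (real i) \<omega>)) / ?S n"
  have "(\<lambda>n. C * real n powr (- \<alpha>)) \<longlonglongrightarrow> C * 0"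
    by (intro tendsto_mult tendsto_const tendsto_neg_powr filterlim_real_sequentially) (use \<alpha> in auto)
  then have "(\<lambda>n. sqrt (C * real n powr (- \<alpha>))) \<longlonglongrightarrow> sqrt 0"
    by (intro tendsto_real_sqrt) simp
  then have lim: "(\<lambda>n. sqrt (C * real n powr (- \<alpha>))) \<longlonglongrightarrow> 0" by simp
  have R: "(\<lambda>n. ?R n / ?S n) \<longlonglongrightarrow> 0"
  proof (rule Lim_null_comparison[OF _ lim])
    show "\<forall>\<^sub>F n in sequentially. norm (?R n / ?S n) \<le> sqrt (C * real n powr (- \<alpha>))"
      using C eventually_gt_at_top[of 0]
    proof eventually_elim
      case (elim n)
      have "norm (?R n / ?S n) \<le> sqrt (?S n * ?D n) / ?S n"
        using drift_error_bound[where Q = Q and \<omega> = \<omega> and n = n, OF Q Q2] elim by (simp add: abs_div divide_right_mono)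
      also have "\<dots> = sqrt (?D n / ?S n)"
      proof -
        have "sqrt (?S n * ?D n) / ?S n = sqrt (?S n * ?D n) / sqrt ((?S n)\<^sup>2)"
          using elim by simp
        also have "\<dots> = sqrt (?S n * ?D n / (?S n)\<^sup>2)"
          by (rule real_sqrt_divide[symmetric])
        also have "?S n * ?D n / (?S n)\<^sup>2 = ?D n / ?S n"
          using elim by (simp add: power2_eq_square)
        finally show ?thesis .
      qed
      also have "\<dots> \<le> sqrt (C * real n powr (- \<alpha>))"
        using elim by (intro real_sqrt_le_mono) (simp add: powr_minus field_simps)
      finally show ?case .
    qed
  qed
  have "(\<lambda>n. ?N (Suc n) + \<theta> + \<theta> * (?R (Suc n) / ?S (Suc n))) \<longlonglongrightarrow> 0 + \<theta> + \<theta> * 0"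
    by (intro tendsto_add tendsto_mult tendsto_const LIMSEQ_Suc[OF mart] LIMSEQ_Suc[OF R])
  moreover have "\<forall>\<^sub>F n in sequentially. 0 < ?S (Suc n)"
    using C unfolding eventually_sequentially by (meson le_SucI)
  then have "\<forall>\<^sub>F n in sequentially. ?N (Suc n) + \<theta> + \<theta> * (?R (Suc n) / ?S (Suc n)) = theta_bar Q (Z_process \<theta> W Q) n \<omega>"
    by eventually_elim (rule theta_bar_decomposition[where Q = Q and \<omega> = \<omega>, OF Q Q2, symmetric])
  ultimately show ?thesis
    using tendsto_cong by force
qed

lemma lipschitz_if_bounded_deriv:
  fixes b :: "real \<Rightarrow> real"
  assumes diff: "\<And>x. b differentiable (at x)" and bd: "bounded (range (deriv b))"
  obtains L where "\<And>u v. \<bar>b u - b v\<bar> \<le> L * \<bar>u - v\<bar>"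
proof -
  obtain L where L: "\<And>x. \<bar>deriv b x\<bar> \<le> L"
    using bd by (auto simp: bounded_iff)
  have d: "(b has_real_derivative deriv b x) (at x)" for x
    using diff[of x] by (simp add: DERIV_deriv_iff_real_differentiable)
  have "norm (b u - b v) \<le> L * norm (u - v)" for u v
    by (rule field_differentiable_bound[of UNIV b "deriv b"]) (use d L in auto)
  then show ?thesis by (intro that) simp
qed

theorem proposition5:
  fixes M :: "'a measure"
    and H \<theta> \<alpha> :: real
    and b :: "real \<Rightarrow> real"
    and W BH X Q Z :: "real \<Rightarrow> 'a \<Rightarrow> real"
  assumes "prob_space M"
    and H: "0 < H" "H < 1"
    and W: "standard_brownian_motion M W"
    and BH: "fractional_brownian_motion M H BH"
    and BH_repr: "\<And>t. 0 \<le> t \<Longrightarrow> has_wiener_integral M W t (K_H H t) (BH t)"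
    and b_diff: "\<And>x. b differentiable (at x)"
    and b_deriv: "bounded (range (deriv b))"
    and X_meas: "\<And>t. 0 \<le> t \<Longrightarrow> X t \<in> borel_measurable M"
    and X: "AE \<omega> in M. continuous_on {0..} (\<lambda>t. X t \<omega>) \<and> X 0 \<omega> = 0 \<and>
              (\<forall>t\<ge>0. X t \<omega> = \<theta> * (LBINT s:{0..t}. b (X s \<omega>)) + BH t \<omega>)"
    and Q0: "\<And>\<omega>. Q 0 \<omega> = 0"
    and Q: "AE \<omega> in M. is_K_inverse H (\<lambda>t. LBINT r:{0..t}. b (X r \<omega>)) (\<lambda>t. Q t \<omega>)"
    and Z: "Z = Z_process \<theta> W Q"
    and \<alpha>: "0 < \<alpha>"
    and i: "AE \<omega> in M. \<exists>C. \<forall>\<^sub>F n in sequentially.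
              0 < qv_B Q n \<omega> \<and> real n powr \<alpha> * (qv_A_minus_B Q n \<omega> / qv_B Q n \<omega>) \<le> C"
    and ii: "\<And>k::nat. 1 \<le> k \<Longrightarrow>
              \<exists>K>0. AE \<omega> in M. \<forall>\<^sub>F n in sequentially.
                ennreal K * (\<integral>\<^sup>+\<omega>'. ennreal (qv_B Q n \<omega>' ^ k) \<partial>M) \<le> ennreal (qv_B Q n \<omega> ^ k)"
    and iii: "\<And>k::nat. 1 < k \<Longrightarrow>
              \<forall>\<^sub>F n in sequentially.
                (\<integral>\<^sup>+\<omega>. ennreal (\<bar>qv_A_minus_B Q n \<omega>\<bar> ^ k) \<partial>M) \<le>
                ennreal (real n powr (- real k * \<alpha>)) *
                  (\<integral>\<^sup>+\<omega>. ennreal (\<bar>qv_B Q n \<omega>\<bar> ^ k) \<partial>M)"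
  shows "AE \<omega> in M. (\<lambda>n. theta_bar Q Z n \<omega>) \<longlonglongrightarrow> \<theta>"
proof -
  interpret prob_space M by fact
  interpret brownian_motion M W
    by unfold_locales (rule W)
  obtain L where lip: "\<And>u v. \<bar>b u - b v\<bar> \<le> L * \<bar>u - v\<bar>"
    using lipschitz_if_bounded_deriv[OF b_diff b_deriv] by blast
  have b: "continuous_on UNIV b"
    using b_diff by (simp add: continuous_on_eq_continuous_at differentiable_imp_continuous_within)
  have BH_adapted: "adapted m (BH t)" if "0 \<le> t" "t \<le> real m" for m t
    using adapted_wiener_integral[OF BH_repr] that by blast
  have X_cont: "AE \<omega> in M. continuous_on {0..} (\<lambda>t. X t \<omega>)"
    using X by eventually_elim simp
  have Q_adapted: "adapted m (Q (real m))" for m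
  proof (cases "m = 0")
    case True
    moreover have "Q 0 = (\<lambda>_. 0)" using Q0 by auto
    ultimately show ?thesis by (simp add: adapted_const)
  next
    case False
    then show ?thesis
      by (intro adapted_K_inverse[OF H _ X_cont b Q] adapted_SDE_solution[OF BH_adapted lip b X]) auto
  qed
  \<comment> \<open>The strong law is applied to versions measurable for the past itself. There are
    countably many integer times, so outside one null set the versions agree with \<open>Q\<close>
    at all of them.\<close>
  then obtain q where q: "\<And>m. q m \<in> borel_measurable (past m)" "\<And>m. AE \<omega> in M. Q (real m) \<omega> = q m \<omega>"
    unfolding adapted_def by metis
  have q_eq: "AE \<omega> in M. \<forall>m. Q (real m) \<omega> = q m \<omega>"
    using q(2) by (simp add: AE_all_countable)
  show ?thesis
    using Q i q_eq transform_strong_law[of q, OF q(1)]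
  proof eventually_elim
    case (elim \<omega>)
    have Q_cont: "continuous_on {0<..} (\<lambda>s. Q s \<omega>)"
      and Q_int: "\<forall>t\<ge>0. set_integrable lborel {0..t} (\<lambda>s. (Q s \<omega>)\<^sup>2)"
      using elim(1) by (auto simp: is_K_inverse_def)
    obtain C where C: "\<forall>\<^sub>F n in sequentially. 0 < qv_B Q n \<omega> \<and> real n powr \<alpha> * (qv_A_minus_B Q n \<omega> / qv_B Q n \<omega>) \<le> C"
      using elim(2) by blast
    have S: "qv_B Q n \<omega> = (\<Sum>i<n. (q i \<omega>)\<^sup>2)" for n
      using elim(3) by (simp add: qv_B_def)
    have "filterlim (\<lambda>n. qv_B Q n \<omega>) at_top sequentially"
      by (rule qv_B_tendsto_at_top[where \<omega> = \<omega>, OF Q_cont Q_int Q0 \<alpha> C])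
    then have "(\<lambda>n. (\<Sum>i<n. Q (real i) \<omega> * (W (real i + 1) \<omega> - W (real i) \<omega>)) / qv_B Q n \<omega>) \<longlonglongrightarrow> 0"
      using elim(3,4) by (simp add: S)
    then show ?case
      unfolding Z by (intro theta_bar_tendsto[where Q = Q and \<omega> = \<omega>, OF Q_cont Q_int \<alpha> C])
  qed
qed

end
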